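(* If $(M^{2n+1},\varphi,\xi,\eta,g)$ is a compact anti-quasi-Sasakian manifold of dimension $2n+1$, then the Betti numbers $b_2$ and $b_{2n-1}$ of $M$ are strictly positive.
   Context: An almost contact metric structure $(\varphi,\xi,\eta,g)$ on a smooth manifold $M$ of odd dimension consists of a $(1,1)$-tensor field $\varphi$, a vector field $\xi$, a $1$-form $\eta$ and a Riemannian metric $g$ with $\varphi^2=-I+\eta\otimes\xi$, $\eta(\xi)=1$, and $g(\varphi X,\varphi Y)=g(X,Y)-\eta(X)\eta(Y)$ for all vector fields $X,Y$. Its fundamental $2$-form is $\Phi(X,Y)=g(X,\varphi Y)$. Put $N_\varphi=[\varphi,\varphi]+d\eta\otimes\xi$, where $[\varphi,\varphi](X,Y)=[\varphi X,\varphi Y]+\varphi^2[X,Y]-\varphi[X,\varphi Y]-\varphi[\varphi X,Y]$ and $d\eta(X,Y)=X\eta(Y)-Y\eta(X)-\eta([X,Y])$. The structure (and the manifold) is called anti-quasi-Sasakian if $d\Phi=0$ and $N_\varphi=2\,d\eta\otimes\xi$. No assumption on the rank of $\eta$ is made. The Betti numbers are $b_k=\dim H^k(M,\mathbb{R})$. *)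

theory Defs
  imports "HOL-Analysis.Analysis" "HOL-Library.Extended_Nat"
begin

section \<open>Smooth manifolds\<close>

text \<open>The underlying set of the manifold is a whole type \<open>'a\<close> carrying its topology; a smooth
  structure on it is given by an atlas \<open>A\<close>, a set of pairs \<open>(U, \<psi>)\<close>, modelled on
  a Euclidean space \<open>'e\<close>. The atlas need not be maximal.\<close>

primrec Ck_on :: "nat \<Rightarrow> 'e::real_normed_vector set \<Rightarrow> ('e \<Rightarrow> 'f::real_normed_vector) \<Rightarrow> bool" where
  "Ck_on 0 S f \<longleftrightarrow> continuous_on S f"
| "Ck_on (Suc k) S f \<longleftrightarrow>
     (\<forall>x\<in>S. f differentiable (at x)) \<and> (\<forall>v. Ck_on k S (\<lambda>x. frechet_derivative f (at x) v))"

text \<open>Only used for open \<open>S\<close> and finite-dimensional domain.\<close>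
definition smooth_on :: "'e::real_normed_vector set \<Rightarrow> ('e \<Rightarrow> 'f::real_normed_vector) \<Rightarrow> bool" where
  "smooth_on S f \<longleftrightarrow> (\<forall>k. Ck_on k S f)"

type_synonym ('a, 'e) chart = "'a set \<times> ('a \<Rightarrow> 'e)"

definition is_chart :: "('a::topological_space, 'e::euclidean_space) chart \<Rightarrow> bool" where
  "is_chart = (\<lambda>(U, \<psi>). open U \<and> open (\<psi> ` U) \<and> homeomorphism U (\<psi> ` U) \<psi> (inv_into U \<psi>))"

definition smooth_manifold ::
    "('a::{t2_space, second_countable_topology}, 'e::euclidean_space) chart set \<Rightarrow> bool" where
  "smooth_manifold A \<longleftrightarrow>
     (\<forall>c\<in>A. is_chart c) \<and> (\<Union>(U, \<psi>)\<in>A. U) = UNIV \<and>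
     (\<forall>(U, \<psi>)\<in>A. \<forall>(V, \<theta>)\<in>A. smooth_on (\<psi> ` (U \<inter> V)) (\<theta> \<circ> inv_into U \<psi>))"

definition smooth_funs :: "('a, 'e::euclidean_space) chart set \<Rightarrow> ('a \<Rightarrow> real) set" where
  "smooth_funs A = {f. \<forall>(U, \<psi>)\<in>A. smooth_on (\<psi> ` U) (f \<circ> inv_into U \<psi>)}"


section \<open>Tangent vectors and tensor fields\<close>

text \<open>Tangent vectors at \<open>p\<close> are the derivations at \<open>p\<close> of the algebra of smooth functions. They are
  set to 0 on non-smooth functions, so that equal derivations are equal as functions.\<close>

type_synonym 'a tvec = "('a \<Rightarrow> real) \<Rightarrow> real"
type_synonym 'a vfield = "'a \<Rightarrow> 'a tvec"

definition tangent_space :: "('a, 'e::euclidean_space) chart set \<Rightarrow> 'a \<Rightarrow> 'a tvec set" where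
  "tangent_space A p = {v.
     (\<forall>f\<in>smooth_funs A. \<forall>h\<in>smooth_funs A. \<forall>a b. v (\<lambda>x. a * f x + b * h x) = a * v f + b * v h) \<and>
     (\<forall>f\<in>smooth_funs A. \<forall>h\<in>smooth_funs A. v (\<lambda>x. f x * h x) = f p * v h + h p * v f) \<and>
     (\<forall>f. f \<notin> smooth_funs A \<longrightarrow> v f = 0)}"

definition vector_fields :: "('a, 'e::euclidean_space) chart set \<Rightarrow> 'a vfield set" where
  "vector_fields A = {X. (\<forall>p. X p \<in> tangent_space A p) \<and>
     (\<forall>f\<in>smooth_funs A. (\<lambda>p. X p f) \<in> smooth_funs A)}"

definition lie_bracket :: "'a vfield \<Rightarrow> 'a vfield \<Rightarrow> 'a vfield" where
  "lie_bracket X Y = (\<lambda>p f. X p (\<lambda>q. Y q f) - Y p (\<lambda>q. X q f))"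

definition one_form ::
    "('a, 'e::euclidean_space) chart set \<Rightarrow> ('a \<Rightarrow> 'a tvec \<Rightarrow> real) \<Rightarrow> bool" where
  "one_form A \<eta> \<longleftrightarrow>
     (\<forall>p. \<forall>u\<in>tangent_space A p. \<forall>v\<in>tangent_space A p. \<forall>a b.
        \<eta> p (\<lambda>f. a * u f + b * v f) = a * \<eta> p u + b * \<eta> p v) \<and>
     (\<forall>X\<in>vector_fields A. (\<lambda>p. \<eta> p (X p)) \<in> smooth_funs A)"

definition tensor11 ::
    "('a, 'e::euclidean_space) chart set \<Rightarrow> ('a \<Rightarrow> 'a tvec \<Rightarrow> 'a tvec) \<Rightarrow> bool" where
  "tensor11 A \<phi> \<longleftrightarrow>
     (\<forall>p. \<forall>u\<in>tangent_space A p. \<phi> p u \<in> tangent_space A p) \<and>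
     (\<forall>p. \<forall>u\<in>tangent_space A p. \<forall>v\<in>tangent_space A p. \<forall>a b.
        \<phi> p (\<lambda>f. a * u f + b * v f) = (\<lambda>f. a * \<phi> p u f + b * \<phi> p v f)) \<and>
     (\<forall>X\<in>vector_fields A. (\<lambda>p. \<phi> p (X p)) \<in> vector_fields A)"

definition riemannian_metric ::
    "('a, 'e::euclidean_space) chart set \<Rightarrow> ('a \<Rightarrow> 'a tvec \<Rightarrow> 'a tvec \<Rightarrow> real) \<Rightarrow> bool" where
  "riemannian_metric A g \<longleftrightarrow>
     (\<forall>p. \<forall>u\<in>tangent_space A p. \<forall>v\<in>tangent_space A p. \<forall>w\<in>tangent_space A p. \<forall>a b.
        g p (\<lambda>f. a * u f + b * v f) w = a * g p u w + b * g p v w) \<and>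
     (\<forall>p. \<forall>u\<in>tangent_space A p. \<forall>v\<in>tangent_space A p. g p u v = g p v u) \<and>
     (\<forall>p. \<forall>u\<in>tangent_space A p. u \<noteq> (\<lambda>f. 0) \<longrightarrow> g p u u > 0) \<and>
     (\<forall>X\<in>vector_fields A. \<forall>Y\<in>vector_fields A. (\<lambda>p. g p (X p) (Y p)) \<in> smooth_funs A)"


section \<open>Differential forms and de Rham cohomology\<close>

text \<open>A \<open>k\<close>-form takes a point and the list of its \<open>k\<close> arguments; it is set to 0 on lists that
  are not lists of \<open>k\<close> tangent vectors at that point.\<close>

type_synonym 'a form = "'a \<Rightarrow> 'a tvec list \<Rightarrow> real"

definition diff_forms :: "('a, 'e::euclidean_space) chart set \<Rightarrow> nat \<Rightarrow> 'a form set" where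
  "diff_forms A k = {\<omega>.
     (\<forall>p vs. \<not> (length vs = k \<and> set vs \<subseteq> tangent_space A p) \<longrightarrow> \<omega> p vs = 0) \<and>
     (\<forall>p vs. length vs = k \<and> set vs \<subseteq> tangent_space A p \<longrightarrow>
        (\<forall>i<k. \<forall>u\<in>tangent_space A p. \<forall>v\<in>tangent_space A p. \<forall>a b.
           \<omega> p (vs[i := (\<lambda>f. a * u f + b * v f)]) = a * \<omega> p (vs[i := u]) + b * \<omega> p (vs[i := v]))) \<and>
     (\<forall>p vs. length vs = k \<and> set vs \<subseteq> tangent_space A p \<longrightarrow>
        (\<forall>i<k. \<forall>j<k. i \<noteq> j \<and> vs ! i = vs ! j \<longrightarrow> \<omega> p vs = 0)) \<and>
     (\<forall>Xs. length Xs = k \<and> set Xs \<subseteq> vector_fields A \<longrightarrow>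
        (\<lambda>p. \<omega> p (map (\<lambda>X. X p) Xs)) \<in> smooth_funs A)}"

definition omit :: "nat \<Rightarrow> 'b list \<Rightarrow> 'b list" where
  "omit i xs = take i xs @ drop (Suc i) xs"

text \<open>The invariant formula for \<open>d\<omega>(X\<^sub>0, \<dots>, X\<^sub>k)\<close>, normalised without a factor \<open>1/(k+1)\<close>.
  In the second sum \<open>i < j\<close>, so \<open>j\<close> is omitted first.\<close>
definition ext_deriv_formula :: "'a form \<Rightarrow> 'a vfield list \<Rightarrow> 'a \<Rightarrow> real" where
  "ext_deriv_formula \<omega> Xs p =
     (\<Sum>i<length Xs. (-1) ^ i * (Xs ! i) p (\<lambda>q. \<omega> q (map (\<lambda>X. X q) (omit i Xs)))) +
     (\<Sum>j<length Xs. \<Sum>i<j. (-1) ^ (i + j) *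
        \<omega> p (map (\<lambda>X. X p) (lie_bracket (Xs ! i) (Xs ! j) # omit i (omit j Xs))))"

text \<open>\<open>\<theta> = d\<omega>\<close> for a \<open>k\<close>-form \<open>\<omega>\<close>.\<close>
definition is_ext_deriv ::
    "('a, 'e::euclidean_space) chart set \<Rightarrow> nat \<Rightarrow> 'a form \<Rightarrow> 'a form \<Rightarrow> bool" where
  "is_ext_deriv A k \<omega> \<theta> \<longleftrightarrow> \<omega> \<in> diff_forms A k \<and> \<theta> \<in> diff_forms A (Suc k) \<and>
     (\<forall>Xs. length Xs = Suc k \<and> set Xs \<subseteq> vector_fields A \<longrightarrow>
        (\<forall>p. \<theta> p (map (\<lambda>X. X p) Xs) = ext_deriv_formula \<omega> Xs p))"

definition zero_form :: "'a form" where
  "zero_form = (\<lambda>p vs. 0)"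

definition closed_forms :: "('a, 'e::euclidean_space) chart set \<Rightarrow> nat \<Rightarrow> 'a form set" where
  "closed_forms A k = {\<omega>. is_ext_deriv A k \<omega> zero_form}"

definition exact_forms :: "('a, 'e::euclidean_space) chart set \<Rightarrow> nat \<Rightarrow> 'a form set" where
  "exact_forms A k = (case k of 0 \<Rightarrow> {zero_form} | Suc j \<Rightarrow> {\<omega>. \<exists>\<tau>. is_ext_deriv A j \<tau> \<omega>})"

definition coh_class ::
    "('a, 'e::euclidean_space) chart set \<Rightarrow> nat \<Rightarrow> 'a form \<Rightarrow> 'a form set" where
  "coh_class A k \<omega> = {\<omega>' \<in> closed_forms A k. (\<lambda>p vs. \<omega>' p vs - \<omega> p vs) \<in> exact_forms A k}"

definition de_rham :: "('a, 'e::euclidean_space) chart set \<Rightarrow> nat \<Rightarrow> 'a form set set" where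
  "de_rham A k = coh_class A k ` closed_forms A k"

text \<open>The linear combination of the finitely many cohomology classes \<open>a \<in> S\<close> with
  coefficients \<open>c a\<close>, formed by means of arbitrary representatives \<open>r a \<in> a\<close>.\<close>
definition coh_lincomb ::
    "('a, 'e::euclidean_space) chart set \<Rightarrow> nat \<Rightarrow> 'a form set set \<Rightarrow> ('a form set \<Rightarrow> real) \<Rightarrow> 'a form set"
  where
  "coh_lincomb A k S c = {\<omega>. \<exists>r. (\<forall>a\<in>S. r a \<in> a) \<and>
     \<omega> \<in> coh_class A k (\<lambda>p vs. \<Sum>a\<in>S. c a * r a p vs)}"

definition coh_independent ::
    "('a, 'e::euclidean_space) chart set \<Rightarrow> nat \<Rightarrow> 'a form set set \<Rightarrow> bool" where
  "coh_independent A k S \<longleftrightarrow>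
     (\<forall>c. coh_lincomb A k S c = coh_class A k zero_form \<longrightarrow> (\<forall>a\<in>S. c a = 0))"

text \<open>The dimension of the \<open>k\<close>-th de Rham cohomology space, an element of
  \<open>{0, 1, 2, \<dots>, \<infinity>}\<close>. On a compact manifold it is finite; allowing \<open>\<infinity>\<close> avoids
  assigning a spurious natural number to an infinite-dimensional space.\<close>
definition betti :: "('a, 'e::euclidean_space) chart set \<Rightarrow> nat \<Rightarrow> enat" where
  "betti A k = Sup {enat (card S) | S. finite S \<and> S \<subseteq> de_rham A k \<and> coh_independent A k S}"


section \<open>Anti-quasi-Sasakian structures\<close>

definition almost_contact_metric ::
    "('a, 'e::euclidean_space) chart set \<Rightarrow> ('a \<Rightarrow> 'a tvec \<Rightarrow> 'a tvec) \<Rightarrow> 'a vfield \<Rightarrow>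
     ('a \<Rightarrow> 'a tvec \<Rightarrow> real) \<Rightarrow> ('a \<Rightarrow> 'a tvec \<Rightarrow> 'a tvec \<Rightarrow> real) \<Rightarrow> bool" where
  "almost_contact_metric A \<phi> \<xi> \<eta> g \<longleftrightarrow>
     tensor11 A \<phi> \<and> \<xi> \<in> vector_fields A \<and> one_form A \<eta> \<and> riemannian_metric A g \<and>
     (\<forall>p. \<forall>v\<in>tangent_space A p. \<phi> p (\<phi> p v) = (\<lambda>f. - v f + \<eta> p v * \<xi> p f)) \<and>
     (\<forall>p. \<eta> p (\<xi> p) = 1) \<and>
     (\<forall>X\<in>vector_fields A. \<forall>Y\<in>vector_fields A. \<forall>p.
        g p (\<phi> p (X p)) (\<phi> p (Y p)) = g p (X p) (Y p) - \<eta> p (X p) * \<eta> p (Y p))"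

definition fundamental_form ::
    "('a, 'e::euclidean_space) chart set \<Rightarrow> ('a \<Rightarrow> 'a tvec \<Rightarrow> 'a tvec) \<Rightarrow>
     ('a \<Rightarrow> 'a tvec \<Rightarrow> 'a tvec \<Rightarrow> real) \<Rightarrow> 'a form" where
  "fundamental_form A \<phi> g = (\<lambda>p vs.
     if length vs = 2 \<and> set vs \<subseteq> tangent_space A p then g p (vs ! 0) (\<phi> p (vs ! 1)) else 0)"

definition d_one_form :: "('a \<Rightarrow> 'a tvec \<Rightarrow> real) \<Rightarrow> 'a vfield \<Rightarrow> 'a vfield \<Rightarrow> 'a \<Rightarrow> real" where
  "d_one_form \<eta> X Y p =
     X p (\<lambda>q. \<eta> q (Y q)) - Y p (\<lambda>q. \<eta> q (X q)) - \<eta> p (lie_bracket X Y p)"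

definition nijenhuis :: "('a \<Rightarrow> 'a tvec \<Rightarrow> 'a tvec) \<Rightarrow> 'a vfield \<Rightarrow> 'a vfield \<Rightarrow> 'a vfield" where
  "nijenhuis \<phi> X Y = (\<lambda>p f.
     lie_bracket (\<lambda>q. \<phi> q (X q)) (\<lambda>q. \<phi> q (Y q)) p f
     + \<phi> p (\<phi> p (lie_bracket X Y p)) f
     - \<phi> p (lie_bracket X (\<lambda>q. \<phi> q (Y q)) p) f
     - \<phi> p (lie_bracket (\<lambda>q. \<phi> q (X q)) Y p) f)"

definition N_tensor ::
    "('a \<Rightarrow> 'a tvec \<Rightarrow> 'a tvec) \<Rightarrow> 'a vfield \<Rightarrow> ('a \<Rightarrow> 'a tvec \<Rightarrow> real) \<Rightarrow>
     'a vfield \<Rightarrow> 'a vfield \<Rightarrow> 'a vfield" where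
  "N_tensor \<phi> \<xi> \<eta> X Y = (\<lambda>p f. nijenhuis \<phi> X Y p f + d_one_form \<eta> X Y p * \<xi> p f)"

definition anti_quasi_Sasakian ::
    "('a, 'e::euclidean_space) chart set \<Rightarrow> ('a \<Rightarrow> 'a tvec \<Rightarrow> 'a tvec) \<Rightarrow> 'a vfield \<Rightarrow>
     ('a \<Rightarrow> 'a tvec \<Rightarrow> real) \<Rightarrow> ('a \<Rightarrow> 'a tvec \<Rightarrow> 'a tvec \<Rightarrow> real) \<Rightarrow> bool" where
  "anti_quasi_Sasakian A \<phi> \<xi> \<eta> g \<longleftrightarrow>
     almost_contact_metric A \<phi> \<xi> \<eta> g \<and>
     is_ext_deriv A 2 (fundamental_form A \<phi> g) zero_form \<and>
     (\<forall>X\<in>vector_fields A. \<forall>Y\<in>vector_fields A.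
        N_tensor \<phi> \<xi> \<eta> X Y = (\<lambda>p f. 2 * d_one_form \<eta> X Y p * \<xi> p f))"

end

theory Submission
  imports Defs
begin

text \<open>Let \<open>\<Psi> = \<eta> \<and> \<Phi>\<^sup>n\<^sup>-\<^sup>1\<close>. Applying \<open>\<eta>\<close> to the condition \<open>N\<^sub>\<phi> = 2 d\<eta> \<otimes> \<xi>\<close> shows
  \<open>d\<eta>(\<phi>X, \<phi>Y) = - d\<eta>(X, Y)\<close>. In a basis \<open>\<xi>, e\<^sub>i, \<phi>e\<^sub>i\<close> of the tangent space this forces \<open>d\<eta>(e\<^sub>i, \<phi>e\<^sub>i) = 0\<close> and
  \<open>\<iota>\<^sub>\<xi> d\<eta> = 0\<close>, hence \<open>d\<eta> \<and> \<Phi>\<^sup>n\<^sup>-\<^sup>1 = 0\<close> and \<open>\<Psi>\<close> is closed. In the same basis \<open>\<Psi> \<and> \<Phi>\<close> is seen to be a volume form.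
  If \<open>\<Phi> = d\<beta>\<close>, then \<open>\<Psi> \<and> \<Phi> = - d(\<Psi> \<and> \<beta>)\<close>; if \<open>\<Psi> = d\<gamma>\<close>, then \<open>\<Psi> \<and> \<Phi> = d(\<gamma> \<and> \<Phi>)\<close>. Both contradict
  Stokes' theorem on the compact manifold, so \<open>\<Phi>\<close> and \<open>\<Psi>\<close> represent nonzero classes in degrees \<open>2\<close> and \<open>2n - 1\<close>.\<close>

section \<open>Calculus of smooth functions\<close>

text \<open>Behind the vanishing of the wedge of d\<eta> with \<Phi>^(n-1) lies a matter of type:
  anti-invariance under \<phi> makes d\<eta> of type (2,0)+(0,2) on the 2n-dimensional kernel of
  \<eta>, whereas \<Phi> is of type (1,1), so their product has no component in top degree there.
  The larger obstacle is Stokes' theorem. Tangent vectors are derivations and forms are functions on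
  lists, so the exterior calculus is built by contraction recursions on lists of vector fields,
  without coordinates. Charts enter to identify derivations with partial derivatives and to
  integrate. No orientation is given in advance: a nowhere vanishing top form has a coefficient of
  constant sign on each coordinate ball, and this sign orients the chart. Each chart carries a scale
  of radii: r for the balls that cover the manifold, 3r/2 for the supports of the partition of
  unity, 2r for the region where the global coordinate fields are genuine, 3r for the support of
  their cut-off, and 4r for a ball still inside the chart.\<close>

lemma Ck_on_cong:
  assumes "open S" "\<And>x. x \<in> S \<Longrightarrow> f x = h x"
  shows "Ck_on k S f \<longleftrightarrow> Ck_on k S h"
  using assms(2)
proof (induction k arbitrary: f h)
  case 0
  then show ?case by (auto intro: continuous_on_cong)
next
  case (Suc k)
  have ev: "eventually (\<lambda>y. f y = h y) (nhds x)" if "x \<in> S" for x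
    using assms(1) Suc.prems that by (auto simp: eventually_nhds)
  have hd: "(f has_derivative D) (at x) \<longleftrightarrow> (h has_derivative D) (at x)" if "x \<in> S" for x D
    using has_derivative_transform_within_open[OF _ assms(1) that] Suc.prems by metis
  have "frechet_derivative f (at x) = frechet_derivative h (at x)" if "x \<in> S" for x
    using hd[OF that] by (simp add: frechet_derivative_def)
  then show ?case
    using Suc.IH[of "\<lambda>x. frechet_derivative f (at x) v" "\<lambda>x. frechet_derivative h (at x) v" for v] hd
    by (auto simp: differentiable_def)
qed

lemma Ck_on_subset: "Ck_on k S f \<Longrightarrow> T \<subseteq> S \<Longrightarrow> Ck_on k T f"
  by (induction k arbitrary: f) (auto intro: continuous_on_subset)

lemma Ck_on_local:
  assumes "\<And>x. x \<in> S \<Longrightarrow> \<exists>T. open T \<and> x \<in> T \<and> Ck_on k T f"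
  shows "Ck_on k S f"
  using assms
proof (induction k arbitrary: f)
  case 0
  then show ?case
    by (metis Ck_on.simps(1) continuous_at_imp_continuous_on continuous_on_eq_continuous_at)
next
  case (Suc k)
  have "f differentiable at x" if "x \<in> S" for x
    using Suc.prems[OF that] by auto
  moreover have "Ck_on k S (\<lambda>x. frechet_derivative f (at x) v)" for v
    by (rule Suc.IH) (use Suc.prems in \<open>metis Ck_on.simps(2)\<close>)
  ultimately show ?case by simp
qed

lemma Ck_on_SucI:
  assumes "open S" "\<And>x. x \<in> S \<Longrightarrow> (f has_derivative f' x) (at x)" "\<And>v. Ck_on k S (\<lambda>x. f' x v)"
  shows "Ck_on (Suc k) S f"
proof -
  have "frechet_derivative f (at x) = f' x" if "x \<in> S" for x
    using assms(2)[OF that] frechet_derivative_at by metis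
  then have "Ck_on k S (\<lambda>x. frechet_derivative f (at x) v)" for v
    using Ck_on_cong[OF assms(1), of "\<lambda>x. frechet_derivative f (at x) v" "\<lambda>x. f' x v"] assms(3) by simp
  then show ?thesis using assms(2) by (auto simp: differentiable_def)
qed

lemma Ck_on_SucD:
  assumes "Ck_on (Suc k) S f"
  shows "x \<in> S \<Longrightarrow> (f has_derivative frechet_derivative f (at x)) (at x)"
    and "Ck_on k S (\<lambda>x. frechet_derivative f (at x) v)"
  using assms by (auto simp: frechet_derivative_works)

lemma Ck_on_Suc_imp: "Ck_on (Suc k) S f \<Longrightarrow> Ck_on k S f"
proof (induction k arbitrary: f)
  case 0
  then have "\<forall>x\<in>S. isCont f x" by (auto intro: differentiable_imp_continuous_within)
  then show ?case by (simp add: continuous_at_imp_continuous_on)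
next
  case (Suc k)
  have "Ck_on k S (\<lambda>x. frechet_derivative f (at x) v)" for v
    using Suc.IH[OF Ck_on_SucD(2)[OF Suc.prems]] .
  moreover have "\<forall>x\<in>S. f differentiable (at x)" using Suc.prems by simp
  ultimately show ?case by simp
qed

lemma Ck_on_const: "Ck_on k S (\<lambda>x. c)"
proof -
  \<comment> \<open>The induction runs on \<open>UNIV\<close> because \<open>Ck_on_SucI\<close> asks
    for an open set, while S is arbitrary.\<close>
  have "Ck_on k UNIV (\<lambda>x. c)"
  proof (induction k arbitrary: c)
    case (Suc k)
    show ?case by (rule Ck_on_SucI[where f' = "\<lambda>_ _. 0"]) (use Suc in auto)
  qed simp
  then show ?thesis using Ck_on_subset by blast
qed

lemma Ck_on_bounded_linear:
  assumes "bounded_linear L"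
  shows "Ck_on k S L"
proof -
  have "Ck_on k UNIV L"
  proof (cases k)
    case 0
    then show ?thesis using assms by (simp add: linear_continuous_on)
  next
    case (Suc j)
    show ?thesis unfolding Suc
      by (rule Ck_on_SucI[where f' = "\<lambda>_. L"]) (use assms Ck_on_const in \<open>auto intro: bounded_linear_imp_has_derivative\<close>)
  qed
  then show ?thesis using Ck_on_subset by blast
qed

lemma Ck_on_linear_comp:
  assumes "bounded_linear L" "open S" "Ck_on k S f"
  shows "Ck_on k S (\<lambda>x. L (f x))"
  using assms(3)
proof (induction k arbitrary: f)
  case 0
  then show ?case using assms(1) by (auto intro: linear_continuous_on continuous_on_compose2)
next
  case (Suc k)
  show ?case
    by (rule Ck_on_SucI[where f' = "\<lambda>x v. L (frechet_derivative f (at x) v)"])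
      (use assms Ck_on_SucD[OF Suc.prems] Suc.IH in
        \<open>auto intro!: bounded_linear.has_derivative[OF assms(1)]\<close>)
qed

lemma Ck_on_add:
  assumes "open S" "Ck_on k S f" "Ck_on k S h"
  shows "Ck_on k S (\<lambda>x. f x + h x)"
  using assms(2,3)
proof (induction k arbitrary: f h)
  case (Suc k)
  show ?case
    by (rule Ck_on_SucI[where f' = "\<lambda>x v. frechet_derivative f (at x) v + frechet_derivative h (at x) v"])
      (use assms Ck_on_SucD[OF Suc.prems(1)] Ck_on_SucD[OF Suc.prems(2)] Suc.IH in
        \<open>auto intro!: has_derivative_add\<close>)
qed (auto intro: continuous_intros)

lemma Ck_on_scaleR:
  fixes a :: "'e::real_normed_vector \<Rightarrow> real"
  assumes "open S" "Ck_on k S a" "Ck_on k S f"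
  shows "Ck_on k S (\<lambda>x. a x *\<^sub>R f x)"
  using assms(2,3)
proof (induction k arbitrary: a f)
  case (Suc k)
  note 1 = Ck_on_Suc_imp[OF Suc.prems(1)] Ck_on_Suc_imp[OF Suc.prems(2)]
  show ?case
    by (rule Ck_on_SucI[where f' = "\<lambda>x v. a x *\<^sub>R frechet_derivative f (at x) v + frechet_derivative a (at x) v *\<^sub>R f x"])
      (use assms Ck_on_SucD[OF Suc.prems(1)] Ck_on_SucD[OF Suc.prems(2)] Suc.IH 1 in
        \<open>auto intro!: has_derivative_scaleR Ck_on_add\<close>)
qed (auto intro: continuous_intros)

lemma Ck_on_sum:
  assumes "open S" "\<And>i. i \<in> I \<Longrightarrow> Ck_on k S (f i)"
  shows "Ck_on k S (\<lambda>x. \<Sum>i\<in>I. f i x)"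
  using assms(2) by (induction I rule: infinite_finite_induct) (auto intro: Ck_on_const Ck_on_add assms(1))

text \<open>The chain rule evaluates a varying linear map at a varying vector. Expanding that vector
  in \<open>Basis\<close> turns the derivative into a finite sum of products of two C^k functions,
  the second by the induction hypothesis applied to a partial derivative of f.\<close>

lemma Ck_on_compose:
  fixes h :: "'d::real_normed_vector \<Rightarrow> 'e::euclidean_space" and f :: "'e \<Rightarrow> 'f::real_normed_vector"
  assumes "open S" "open T" "h ` S \<subseteq> T" "Ck_on k S h" "Ck_on k T f"
  shows "Ck_on k S (\<lambda>x. f (h x))"
  using assms(4,5)
proof (induction k arbitrary: f)
  case 0
  then show ?case using assms(3) by (auto intro: continuous_on_compose2)
next
  case (Suc k)
  let ?f' = "\<lambda>x v. \<Sum>b\<in>Basis. (frechet_derivative h (at x) v \<bullet> b) *\<^sub>R frechet_derivative f (at (h x)) b"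
  show ?case
  proof (rule Ck_on_SucI[where f' = ?f'])
    fix x assume x: "x \<in> S"
    then have hx: "h x \<in> T" using assms(3) by auto
    note df = Ck_on_SucD(1)[OF Suc.prems(2) hx]
    have c: "((\<lambda>x. f (h x)) has_derivative (\<lambda>v. frechet_derivative f (at (h x)) (frechet_derivative h (at x) v))) (at x)"
      using has_derivative_compose[OF Ck_on_SucD(1)[OF Suc.prems(1) x] df] .
    have r: "frechet_derivative f (at (h x)) w = (\<Sum>b\<in>Basis. (w \<bullet> b) *\<^sub>R frechet_derivative f (at (h x)) b)" for w
    proof -
      have l: "linear (frechet_derivative f (at (h x)))" using df has_derivative_linear by blast
      show ?thesis
        by (subst (1) euclidean_representation[symmetric])
          (simp add: linear_sum[OF l] linear_cmul[OF l])
    qed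
    show "((\<lambda>x. f (h x)) has_derivative ?f' x) (at x)"
      by (rule has_derivative_eq_rhs[OF c]) (rule ext, rule r)
  next
    fix v
    show "Ck_on k S (\<lambda>x. ?f' x v)"
    proof (intro Ck_on_sum Ck_on_scaleR assms(1))
      fix b :: 'e
      show "Ck_on k S (\<lambda>x. frechet_derivative h (at x) v \<bullet> b)"
        by (rule Ck_on_linear_comp[OF bounded_linear_inner_left assms(1) Ck_on_SucD(2)[OF Suc.prems(1)]])
      show "Ck_on k S (\<lambda>x. frechet_derivative f (at (h x)) b)"
        by (rule Suc.IH[OF Ck_on_Suc_imp[OF Suc.prems(1)] Ck_on_SucD(2)[OF Suc.prems(2)]])
    qed
  qed (rule assms(1))
qed

text \<open>The derivative -(1/f)^2 f' contains only 1/f and f', so each step of the induction gains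
  one order.\<close>

lemma Ck_on_inverse:
  fixes f :: "'e::real_normed_vector \<Rightarrow> real"
  assumes "open S" "\<And>x. x \<in> S \<Longrightarrow> f x \<noteq> 0" "Ck_on k S f"
  shows "Ck_on k S (\<lambda>x. inverse (f x))"
  using assms(3)
proof (induction k)
  case 0
  then show ?case using assms(2) by (auto intro: continuous_intros)
next
  case (Suc k)
  let ?f' = "\<lambda>x v. (- (inverse (f x) *\<^sub>R inverse (f x))) *\<^sub>R frechet_derivative f (at x) v"
  have neg: "Ck_on k S (\<lambda>x. - h x)" if "Ck_on k S h" for h :: "'e \<Rightarrow> real"
    using Ck_on_linear_comp[OF bounded_linear_minus[OF bounded_linear_ident] assms(1) that] .
  show ?case
  proof (rule Ck_on_SucI[where f' = ?f'])
    fix x assume x: "x \<in> S"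
    show "((\<lambda>x. inverse (f x)) has_derivative ?f' x) (at x)"
      using Deriv.has_derivative_inverse[OF assms(2)[OF x] Ck_on_SucD(1)[OF Suc.prems x]]
      by (rule has_derivative_eq_rhs) (simp add: mult.commute mult.left_commute)
  next
    fix v show "Ck_on k S (\<lambda>x. ?f' x v)"
      by (intro Ck_on_scaleR neg assms(1) Suc.IH Ck_on_Suc_imp[OF Suc.prems] Ck_on_SucD(2)[OF Suc.prems])
  qed (rule assms(1))
qed

lemma smooth_on_cong: "open S \<Longrightarrow> (\<And>x. x \<in> S \<Longrightarrow> f x = h x) \<Longrightarrow> smooth_on S f \<longleftrightarrow> smooth_on S h"
  using Ck_on_cong unfolding smooth_on_def by metis

lemma smooth_on_subset: "smooth_on S f \<Longrightarrow> T \<subseteq> S \<Longrightarrow> smooth_on T f"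
  using Ck_on_subset unfolding smooth_on_def by metis

lemma smooth_on_local:
  "(\<And>x. x \<in> S \<Longrightarrow> \<exists>T. open T \<and> x \<in> T \<and> smooth_on T f) \<Longrightarrow> smooth_on S f"
  unfolding smooth_on_def by (meson Ck_on_local)

lemma smooth_on_const: "smooth_on S (\<lambda>x. c)"
  by (simp add: smooth_on_def Ck_on_const)

lemma smooth_on_bounded_linear: "bounded_linear L \<Longrightarrow> smooth_on S L"
  by (simp add: smooth_on_def Ck_on_bounded_linear)

lemma smooth_on_linear_comp: "bounded_linear L \<Longrightarrow> open S \<Longrightarrow> smooth_on S f \<Longrightarrow> smooth_on S (\<lambda>x. L (f x))"
  by (simp add: smooth_on_def Ck_on_linear_comp)

lemma smooth_on_add: "open S \<Longrightarrow> smooth_on S f \<Longrightarrow> smooth_on S h \<Longrightarrow> smooth_on S (\<lambda>x. f x + h x)"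
  by (simp add: smooth_on_def Ck_on_add)

lemma smooth_on_mult:
  fixes f h :: "'e::real_normed_vector \<Rightarrow> real"
  shows "open S \<Longrightarrow> smooth_on S f \<Longrightarrow> smooth_on S h \<Longrightarrow> smooth_on S (\<lambda>x. f x * h x)"
  using Ck_on_scaleR[of S _ f h] by (simp add: smooth_on_def)

lemma smooth_on_sum:
  "open S \<Longrightarrow> (\<And>i. i \<in> I \<Longrightarrow> smooth_on S (f i)) \<Longrightarrow> smooth_on S (\<lambda>x. \<Sum>i\<in>I. f i x)"
  by (simp add: smooth_on_def Ck_on_sum)

lemma smooth_on_compose:
  fixes h :: "'d::real_normed_vector \<Rightarrow> 'e::euclidean_space"
  shows "open S \<Longrightarrow> open T \<Longrightarrow> h ` S \<subseteq> T \<Longrightarrow> smooth_on S h \<Longrightarrow> smooth_on T f \<Longrightarrow> smooth_on S (\<lambda>x. f (h x))"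
  unfolding smooth_on_def by (blast intro: Ck_on_compose)

lemma smooth_on_inverse:
  fixes f :: "'e::real_normed_vector \<Rightarrow> real"
  shows "open S \<Longrightarrow> (\<And>x. x \<in> S \<Longrightarrow> f x \<noteq> 0) \<Longrightarrow> smooth_on S f \<Longrightarrow> smooth_on S (\<lambda>x. inverse (f x))"
  by (simp add: smooth_on_def Ck_on_inverse)

lemma smooth_on_has_derivative:
  "smooth_on S f \<Longrightarrow> x \<in> S \<Longrightarrow> (f has_derivative frechet_derivative f (at x)) (at x)"
  unfolding smooth_on_def using Ck_on_SucD(1)[of 0] by blast

lemma smooth_on_derivative: "smooth_on S f \<Longrightarrow> smooth_on S (\<lambda>x. frechet_derivative f (at x) v)"
  unfolding smooth_on_def using Ck_on_SucD(2) by blast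

lemma smooth_on_continuous: "smooth_on S f \<Longrightarrow> continuous_on S f"
  unfolding smooth_on_def using Ck_on.simps(1) by blast

subsection \<open>Hadamard's lemma\<close>

text \<open>Differentiation under the integral sign. The chain rule contributes a factor t; carrying
  the weight t^j makes the family of such integrals closed under differentiation.\<close>

lemma has_derivative_integral_segment:
  fixes f :: "'e::euclidean_space \<Rightarrow> real"
  assumes S: "open S" and star: "\<And>x t. x \<in> S \<Longrightarrow> 0 \<le> t \<Longrightarrow> t \<le> 1 \<Longrightarrow> t *\<^sub>R x \<in> S"
    and f: "Ck_on 1 S f" and x: "x \<in> S"
  shows "((\<lambda>x. integral {0..1} (\<lambda>t. t ^ j * f (t *\<^sub>R x))) has_derivative
      (\<lambda>v. integral {0..1} (\<lambda>t. t ^ Suc j * frechet_derivative f (at (t *\<^sub>R x)) v))) (at x)"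
proof -
  obtain e where e: "e > 0" "ball x e \<subseteq> S" using S x open_contains_ball by blast
  let ?U = "ball x e"
  have U: "t *\<^sub>R y \<in> S" if "y \<in> ?U" "t \<in> {0..1}" for y t
    using star[of y t] e that by auto
  note df = Ck_on_SucD[OF f[unfolded One_nat_def]]
  \<comment> \<open>\<open>leibniz_rule\<close> takes the derivative as a family of bounded linear
    functions whose joint continuity is measured in operator norm; in finite dimension this reduces
    to continuity of each component.\<close>
  define g where "g = (\<lambda>y t. Blinfun (\<lambda>v. t ^ Suc j * frechet_derivative f (at (t *\<^sub>R y)) v))"
  have bl: "bounded_linear (\<lambda>v. t ^ Suc j * frechet_derivative f (at (t *\<^sub>R y)) v)" if "y \<in> ?U" "t \<in> {0..1}" for y t
    using df(1)[OF U[OF that]] has_derivative_bounded_linear bounded_linear_const_mult by blast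
  have app: "blinfun_apply (g y t) v = t ^ Suc j * frechet_derivative f (at (t *\<^sub>R y)) v" if "y \<in> ?U" "t \<in> {0..1}" for y t v
    unfolding g_def using bounded_linear_Blinfun_apply[OF bl[OF that]] by simp
  have contD: "continuous_on (?U \<times> cbox 0 1) (\<lambda>(y,t). blinfun_apply (g y t) v)" for v
  proof -
    have "continuous_on (?U \<times> cbox (0::real) 1) (\<lambda>(y,t). t ^ Suc j * frechet_derivative f (at (t *\<^sub>R y)) v)"
      unfolding case_prod_beta
      by (intro continuous_intros continuous_on_compose2[OF df(2)[unfolded Ck_on.simps], of _ "\<lambda>z. snd z *\<^sub>R fst z"])
        (use U in auto)
    then show ?thesis
      by (rule continuous_on_eq) (auto simp: app)
  qed
  have cg: "continuous_on (?U \<times> cbox 0 1) (\<lambda>(y,t). g y t)"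
    unfolding case_prod_beta
    by (rule continuous_on_blinfun_componentwise) (use contD in \<open>auto simp: case_prod_beta\<close>)
  have D: "((\<lambda>y. integral (cbox 0 1) (\<lambda>t. t ^ j * f (t *\<^sub>R y))) has_derivative integral (cbox 0 1) (g x)) (at x within ?U)"
  proof (rule leibniz_rule[OF _ _ cg])
    fix y and t :: real assume yt: "y \<in> ?U" "t \<in> cbox 0 1"
    then have t: "t \<in> {0..1}" by auto
    have "((\<lambda>y. t ^ j * f (t *\<^sub>R y)) has_derivative (\<lambda>v. t ^ j * frechet_derivative f (at (t *\<^sub>R y)) (t *\<^sub>R v))) (at y)"
      by (intro has_derivative_mult_right has_derivative_compose[where g = f and f = "\<lambda>y. t *\<^sub>R y" and x = y, OF _ df(1)[OF U[OF yt(1) t]]]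
          has_derivative_scaleR_right has_derivative_ident)
    moreover have "linear (frechet_derivative f (at (t *\<^sub>R y)))"
      using df(1)[OF U[OF yt(1) t]] has_derivative_linear by blast
    ultimately have "((\<lambda>y. t ^ j * f (t *\<^sub>R y)) has_derivative blinfun_apply (g y t)) (at y)"
      by (elim has_derivative_eq_rhs) (auto simp: app[OF yt(1) t] linear_cmul)
    then show "((\<lambda>y. t ^ j * f (t *\<^sub>R y)) has_derivative blinfun_apply (g y t)) (at y within ?U)"
      using has_derivative_at_withinI by blast
  next
    fix y assume y: "y \<in> ?U"
    have "continuous_on S f" using Ck_on_Suc_imp[OF f[unfolded One_nat_def]] by simp
    then have "continuous_on (cbox 0 1) (\<lambda>t. f (t *\<^sub>R y))"
      by (rule continuous_on_compose2) (use U[OF y] in \<open>auto intro!: continuous_intros\<close>)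
    then have "continuous_on (cbox 0 1) (\<lambda>t. t ^ j * f (t *\<^sub>R y))"
      by (rule continuous_on_mult[rotated]) (intro continuous_intros)
    then show "(\<lambda>t. t ^ j * f (t *\<^sub>R y)) integrable_on cbox (0::real) 1"
      by (rule integrable_continuous)
  qed (use e in auto)
  have int: "g x integrable_on cbox 0 1"
    by (rule integrable_continuous, rule continuous_on_compose2[OF cg, of _ "\<lambda>t. (x, t)", simplified])
      (use e in \<open>auto intro!: continuous_intros\<close>)
  have "blinfun_apply (integral (cbox 0 1) (g x)) v = integral {0..1} (\<lambda>t. t ^ Suc j * frechet_derivative f (at (t *\<^sub>R x)) v)" for v
  proof -
    have "blinfun_apply (integral (cbox 0 1) (g x)) v = integral (cbox 0 1) (\<lambda>t. blinfun_apply (g x t) v)"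
      using integral_linear[OF int, of "\<lambda>b. blinfun_apply b v"] by (simp add: o_def blinfun.bounded_linear_left)
    also have "\<dots> = integral {0..1} (\<lambda>t. t ^ Suc j * frechet_derivative f (at (t *\<^sub>R x)) v)"
      by (auto intro!: integral_cong simp: app e)
    finally show ?thesis .
  qed
  then have "blinfun_apply (integral (cbox 0 1) (g x)) = (\<lambda>v. integral {0..1} (\<lambda>t. t ^ Suc j * frechet_derivative f (at (t *\<^sub>R x)) v))"
    by auto
  then show ?thesis using D e at_within_open[of x ?U] by simp
qed

lemma Ck_on_integral_segment:
  fixes f :: "'e::euclidean_space \<Rightarrow> real"
  assumes S: "open S" and star: "\<And>x t. x \<in> S \<Longrightarrow> 0 \<le> t \<Longrightarrow> t \<le> 1 \<Longrightarrow> t *\<^sub>R x \<in> S"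
    and f: "smooth_on S f"
  shows "Ck_on k S (\<lambda>x. integral {0..1} (\<lambda>t. t ^ j * f (t *\<^sub>R x)))"
  using f
proof (induction k arbitrary: j f)
  case 0
  have "Ck_on 1 S f" using 0 smooth_on_def by blast
  from has_derivative_integral_segment[OF S star this] show ?case
    by (auto intro!: has_derivative_continuous_on intro: has_derivative_at_withinI)
next
  case (Suc k)
  have c: "Ck_on 1 S f" using Suc smooth_on_def by blast
  show ?case
  proof (rule Ck_on_SucI[OF S])
    fix x assume x: "x \<in> S"
    show "((\<lambda>x. integral {0..1} (\<lambda>t. t ^ j * f (t *\<^sub>R x))) has_derivative
        (\<lambda>v. integral {0..1} (\<lambda>t. t ^ Suc j * frechet_derivative f (at (t *\<^sub>R x)) v))) (at x)"
      using has_derivative_integral_segment[OF S star c x] .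
  next
    fix v
    show "Ck_on k S (\<lambda>x. integral {0..1} (\<lambda>t. t ^ Suc j * frechet_derivative f (at (t *\<^sub>R x)) v))"
      by (rule Suc.IH[OF smooth_on_derivative[OF Suc.prems]])
  qed
qed

text \<open>Fundamental theorem of calculus along the segment from c to x, with the directional
  derivative expanded in \<open>Basis\<close>; h b x is the mean of the partial derivative in
  direction b over that segment. It serves to identify point derivations with partial
  derivatives.\<close>

lemma Hadamard:
  fixes f :: "'e::euclidean_space \<Rightarrow> real"
  assumes S: "open S" "convex S" and c: "c \<in> S" and f: "smooth_on S f"
  obtains h where "\<And>b. smooth_on S (h b)"
    "\<And>x. x \<in> S \<Longrightarrow> f x = f c + (\<Sum>b\<in>Basis. ((x - c) \<bullet> b) * h b x)"
    "\<And>b. h b c = frechet_derivative f (at c) b"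
proof -
  \<comment> \<open>The preceding lemmas scale towards 0, so c is first moved to the origin, where
    convexity gives star-shapedness.\<close>
  let ?T = "(\<lambda>x. x - c) ` S"
  have T: "open ?T" using S(1) open_translation_subtract by blast
  have star: "t *\<^sub>R x \<in> ?T" if x: "x \<in> ?T" and t: "0 \<le> t" "t \<le> 1" for x and t :: real
  proof -
    obtain y where y: "y \<in> S" "x = y - c" using x by auto
    have "(1 - t) *\<^sub>R c + t *\<^sub>R y \<in> S" using S(2) c y t convexD_alt by blast
    then show ?thesis unfolding y(2)
      by (auto simp: image_iff algebra_simps intro!: bexI[of _ "(1 - t) *\<^sub>R c + t *\<^sub>R y"])
  qed
  define f0 where "f0 = (\<lambda>x. f (x + c))"
  have f0: "smooth_on ?T f0" unfolding f0_def
    by (rule smooth_on_compose[OF T S(1) _ _ f])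
      (use smooth_on_add[OF T smooth_on_bounded_linear[OF bounded_linear_ident] smooth_on_const] in auto)
  define h where "h = (\<lambda>b x. integral {0..1} (\<lambda>t. t ^ 0 * frechet_derivative f0 (at (t *\<^sub>R (x - c))) b))"
  show ?thesis
  proof
    fix b
    have "smooth_on ?T (\<lambda>x. integral {0..1} (\<lambda>t. t ^ 0 * frechet_derivative f0 (at (t *\<^sub>R x)) b))"
      unfolding smooth_on_def using Ck_on_integral_segment[OF T star smooth_on_derivative[OF f0]] by blast
    from smooth_on_compose[OF S(1) T _ _ this, of "\<lambda>x. x - c"]
    show "smooth_on S (h b)" unfolding h_def
      using smooth_on_add[OF S(1) smooth_on_bounded_linear[OF bounded_linear_ident] smooth_on_const[of _ "-c"]]
      by simp
    have "((\<lambda>x. x + c) has_derivative (\<lambda>v. v)) (at 0)" by (auto intro!: derivative_eq_intros)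
    then have "(f0 has_derivative frechet_derivative f (at c)) (at 0)"
      unfolding f0_def using has_derivative_compose[of "\<lambda>x. x + c" "\<lambda>v. v" 0 UNIV f] smooth_on_has_derivative[OF f c] by simp
    then have "frechet_derivative f0 (at 0) = frechet_derivative f (at c)"
      using frechet_derivative_at by metis
    then show "h b c = frechet_derivative f (at c) b" unfolding h_def by simp
  next
    fix x assume x: "x \<in> S"
    then have xT: "x - c \<in> ?T" by auto
    note dv = smooth_on_has_derivative[OF f0 star[OF xT]]
    have rep: "frechet_derivative f0 (at (t *\<^sub>R (x - c))) (x - c)
        = (\<Sum>b\<in>Basis. ((x - c) \<bullet> b) * frechet_derivative f0 (at (t *\<^sub>R (x - c))) b)" if "t \<in> {0..1}" for t
    proof -
      have l: "linear (frechet_derivative f0 (at (t *\<^sub>R (x - c))))"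
        using dv that has_derivative_linear by auto
      have "frechet_derivative f0 (at (t *\<^sub>R (x - c))) (x - c) =
        frechet_derivative f0 (at (t *\<^sub>R (x - c))) (\<Sum>b\<in>Basis. ((x - c) \<bullet> b) *\<^sub>R b)"
        by (simp only: euclidean_representation)
      then show ?thesis by (simp add: linear_sum[OF l] linear_cmul[OF l])
    qed
    have "((\<lambda>t. frechet_derivative f0 (at (t *\<^sub>R (x - c))) (x - c)) has_integral
        f0 (1 *\<^sub>R (x - c)) - f0 (0 *\<^sub>R (x - c))) {0..1}"
    proof (rule fundamental_theorem_of_calculus)
      fix t :: real assume t: "t \<in> {0..1}"
      have "((\<lambda>t. f0 (t *\<^sub>R (x - c))) has_derivative
          (\<lambda>s. frechet_derivative f0 (at (t *\<^sub>R (x - c))) (s *\<^sub>R (x - c)))) (at t within {0..1})"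
        by (rule has_derivative_compose[where g = f0 and f = "\<lambda>t. t *\<^sub>R (x - c)" and x = t, OF _ dv]) (use t in \<open>auto intro!: derivative_eq_intros\<close>)
      then show "((\<lambda>t. f0 (t *\<^sub>R (x - c))) has_vector_derivative frechet_derivative f0 (at (t *\<^sub>R (x - c))) (x - c)) (at t within {0..1})"
        unfolding has_vector_derivative_def
        using has_derivative_linear[OF dv] t by (elim has_derivative_eq_rhs) (auto simp: linear_cmul)
    qed simp
    then have "f x - f c = integral {0..1} (\<lambda>t. frechet_derivative f0 (at (t *\<^sub>R (x - c))) (x - c))"
      by (simp add: f0_def integral_unique)
    also have "\<dots> = integral {0..1} (\<lambda>t. \<Sum>b\<in>Basis. ((x - c) \<bullet> b) * frechet_derivative f0 (at (t *\<^sub>R (x - c))) b)"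
      by (rule integral_cong) (use rep in auto)
    also have "\<dots> = (\<Sum>b\<in>Basis. integral {0..1} (\<lambda>t. ((x - c) \<bullet> b) * frechet_derivative f0 (at (t *\<^sub>R (x - c))) b))"
    proof (rule integral_sum)
      fix b
      have "continuous_on {0..1} (\<lambda>t. frechet_derivative f0 (at (t *\<^sub>R (x - c))) b)"
        by (rule continuous_on_compose2[OF smooth_on_continuous[OF smooth_on_derivative[OF f0]]])
          (use star[OF xT] in \<open>auto intro!: continuous_intros\<close>)
      then show "(\<lambda>t. ((x - c) \<bullet> b) * frechet_derivative f0 (at (t *\<^sub>R (x - c))) b) integrable_on {0..1}"
        by (intro integrable_continuous_interval continuous_intros)
    qed simp
    finally show "f x = f c + (\<Sum>b\<in>Basis. ((x - c) \<bullet> b) * h b x)"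
      by (simp add: h_def)
  qed
qed

subsection \<open>Plateau functions\<close>

text \<open>The functions t^(-j) exp(-1/t), continued by 0. The derivative of the j-th is a
  combination of the members j + 1 and j + 2, so smoothness of all of them follows by one
  induction.\<close>

definition flat_exp :: "nat \<Rightarrow> real \<Rightarrow> real" where
  "flat_exp j t = (if t > 0 then inverse t ^ j * exp (- inverse t) else 0)"

text \<open>With s = 1/t, a single term s^(j+k) / (j+k)! of the exponential series already bounds
  exp s from below.\<close>

lemma flat_exp_bound:
  assumes "t > 0"
  shows "flat_exp j t \<le> fact (j + k) * t ^ k"
proof -
  let ?s = "inverse t"
  have s: "?s > 0" using assms by simp
  have "(\<Sum>n\<in>{j + k}. ?s ^ n /\<^sub>R fact n) \<le> exp ?s"
    unfolding exp_def by (rule sum_le_suminf[OF summable_exp_generic]) (use s in auto)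
  then have "?s ^ (j + k) / fact (j + k) \<le> exp ?s" by (simp add: divide_inverse mult.commute)
  then have "?s ^ (j + k) \<le> exp ?s * fact (j + k)" by (simp add: pos_divide_le_eq)
  then have "?s ^ (j + k) * exp (- ?s) \<le> exp ?s * fact (j + k) * exp (- ?s)"
    by (intro mult_right_mono) auto
  also have "\<dots> = fact (j + k)" by (simp add: exp_minus)
  finally have "(?s ^ (j + k) * exp (- ?s)) * t ^ k \<le> fact (j + k) * t ^ k"
    using assms by (intro mult_right_mono) auto
  then show ?thesis using assms by (simp add: flat_exp_def power_add power_inverse field_simps)
qed

lemma flat_exp_nonneg: "flat_exp j t \<ge> 0"
  by (simp add: flat_exp_def)

lemma flat_exp_has_derivative:
  "(flat_exp j has_derivative (\<lambda>v. v * (flat_exp (j + 2) t - real j * flat_exp (Suc j) t))) (at t)"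
proof -
  consider "t > 0" | "t < 0" | "t = 0" by linarith
  then have "(flat_exp j has_real_derivative (flat_exp (j + 2) t - real j * flat_exp (Suc j) t)) (at t)"
  proof cases
    case 1
    have "((\<lambda>t. inverse t ^ j * exp (- inverse t)) has_real_derivative
        (real j * (inverse t ^ (j - 1) * (- (inverse t ^ 2))) * exp (- inverse t)
          + inverse t ^ j * (exp (- inverse t) * inverse t ^ 2))) (at t)"
      using 1 by (auto intro!: derivative_eq_intros simp: power2_eq_square)
    also have "real j * (inverse t ^ (j - 1) * (- (inverse t ^ 2))) * exp (- inverse t)
          + inverse t ^ j * (exp (- inverse t) * inverse t ^ 2)
        = flat_exp (j + 2) t - real j * flat_exp (Suc j) t"
      using 1 by (cases j) (auto simp: flat_exp_def power2_eq_square algebra_simps)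
    finally show ?thesis
      by (rule has_field_derivative_transform_within_open[of _ _ _ "{0<..}"])
        (use 1 in \<open>auto simp: flat_exp_def\<close>)
  next
    case 2
    have "((\<lambda>_. 0) has_real_derivative 0) (at t)" by simp
    then have "(flat_exp j has_real_derivative 0) (at t)"
      by (rule has_field_derivative_transform_within_open[of _ _ _ "{..<0}"])
        (use 2 in \<open>auto simp: flat_exp_def\<close>)
    then show ?thesis using 2 by (simp add: flat_exp_def)
  next
    \<comment> \<open>At 0 the bound with k = 2 makes the difference quotient O(h).\<close>
    case 3
    have "((\<lambda>h. (flat_exp j (0 + h) - flat_exp j 0) / h) \<longlongrightarrow> 0) (at 0)"
    proof (rule Lim_null_comparison)
      show "\<forall>\<^sub>F h in at 0. norm ((flat_exp j (0 + h) - flat_exp j 0) / h) \<le> fact (j + 2) * \<bar>h\<bar>"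
      proof (rule always_eventually, rule allI)
        fix h :: real
        show "norm ((flat_exp j (0 + h) - flat_exp j 0) / h) \<le> fact (j + 2) * \<bar>h\<bar>"
        proof (cases "h > 0")
          case True
          then have "flat_exp j h / h \<le> fact (j + 2) * h"
            using flat_exp_bound[OF True, of j 2] by (simp add: divide_le_eq power2_eq_square mult.assoc)
          then show ?thesis using True flat_exp_nonneg[of j h] by (simp add: flat_exp_def)
        next
          case False
          then have "flat_exp j (0 + h) = flat_exp j 0" by (simp add: flat_exp_def)
          then show ?thesis by (simp del: fact_Suc)
        qed
      qed
      show "((\<lambda>h. fact (j + 2) * \<bar>h\<bar>) \<longlongrightarrow> 0) (at (0::real))"
        by (auto intro!: tendsto_eq_intros)
    qed
    then show ?thesis using 3 unfolding DERIV_def by (simp add: flat_exp_def)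
  qed
  then show ?thesis by (simp add: has_field_derivative_def mult_commute_abs)
qed

lemma smooth_on_flat_exp: "smooth_on S (flat_exp j)"
proof -
  have "Ck_on k UNIV (flat_exp j)" for k
  proof (induction k arbitrary: j)
    case 0
    have "isCont (flat_exp j) t" for t
      using flat_exp_has_derivative has_derivative_continuous by blast
    then show ?case by (simp add: continuous_at_imp_continuous_on)
  next
    case (Suc k)
    show ?case
    proof (rule Ck_on_SucI[OF _ flat_exp_has_derivative])
      fix v
      have "Ck_on k UNIV (\<lambda>t. v *\<^sub>R (flat_exp (j + 2) t + (- real j) *\<^sub>R flat_exp (Suc j) t))"
        by (intro Ck_on_scaleR Ck_on_add Ck_on_const Suc.IH open_UNIV)
      then show "Ck_on k UNIV (\<lambda>t. v * (flat_exp (j + 2) t - real j * flat_exp (Suc j) t))" by simp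
    qed simp
  qed
  then have "smooth_on UNIV (flat_exp j)" by (simp add: smooth_on_def)
  then show ?thesis by (rule smooth_on_subset) simp
qed

lemma smooth_on_sqdist:
  fixes c :: "'e::euclidean_space"
  shows "smooth_on UNIV (\<lambda>x. (dist c x)\<^sup>2)"
proof -
  have "(dist c x)\<^sup>2 = (\<Sum>b\<in>Basis. ((x \<bullet> b) + - (c \<bullet> b)) * ((x \<bullet> b) + - (c \<bullet> b)))" for x
    by (subst dist_commute) (simp add: dist_norm power2_norm_eq_inner euclidean_inner[of "x - c" "x - c"] flip: inner_diff_left)
  moreover have "smooth_on UNIV (\<lambda>x. \<Sum>b\<in>Basis. ((x \<bullet> b) + - (c \<bullet> b)) * ((x \<bullet> b) + - (c \<bullet> b)))"
    by (intro smooth_on_sum smooth_on_mult smooth_on_add smooth_on_const open_UNIV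
        smooth_on_bounded_linear bounded_linear_inner_left)
  ultimately show ?thesis by presburger
qed

text \<open>The smooth step f(s) / (f(s) + f(1 - s)) with f = \<open>flat_exp 0\<close>; its
  denominator is positive because s and 1 - s are never both nonpositive.\<close>

lemma plateau:
  fixes c :: "'e::euclidean_space"
  assumes "0 < r" "r < R"
  obtains \<beta> :: "'e \<Rightarrow> real" where "smooth_on UNIV \<beta>" "\<And>x. 0 \<le> \<beta> x"
    "\<And>x. dist c x \<le> r \<Longrightarrow> \<beta> x = 1" "\<And>x. dist c x \<ge> R \<Longrightarrow> \<beta> x = 0"
proof -
  \<comment> \<open>Affine in the squared distance, equal to 1 at radius r and 0 at radius R; the
    square keeps it smooth at the centre.\<close>
  define s where "s = (\<lambda>x. inverse (R\<^sup>2 - r\<^sup>2) * (R\<^sup>2 + (- 1) * (dist c x)\<^sup>2))"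
  let ?f = "flat_exp 0"
  define \<beta> where "\<beta> = (\<lambda>x. ?f (s x) * inverse (?f (s x) + ?f (1 + (- 1) * s x)))"
  have Rr: "R\<^sup>2 - r\<^sup>2 > 0" using assms by (simp add: power_strict_mono)
  have s: "smooth_on UNIV s" unfolding s_def
    by (intro smooth_on_mult smooth_on_add smooth_on_const open_UNIV smooth_on_sqdist)
  have f1: "smooth_on UNIV (\<lambda>x. ?f (s x))"
    by (rule smooth_on_compose[OF _ _ _ s smooth_on_flat_exp[of UNIV]]) auto
  have f2: "smooth_on UNIV (\<lambda>x. ?f (1 + (- 1) * s x))"
    by (rule smooth_on_compose[where h = "\<lambda>x. 1 + (- 1) * s x", OF open_UNIV open_UNIV subset_UNIV _
          smooth_on_flat_exp[of UNIV]])
      (intro smooth_on_mult smooth_on_add smooth_on_const s open_UNIV)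
  have pos: "?f (s x) + ?f (1 + (- 1) * s x) > 0" for x
  proof (cases "s x > 0")
    case True
    then have "?f (s x) > 0" by (simp add: flat_exp_def)
    then show ?thesis using flat_exp_nonneg[of 0 "1 + (- 1) * s x"] by linarith
  next
    case False
    then have "?f (1 + (- 1) * s x) > 0" by (simp add: flat_exp_def)
    then show ?thesis using flat_exp_nonneg[of 0 "s x"] by linarith
  qed
  show ?thesis
  proof
    show "smooth_on UNIV \<beta>" unfolding \<beta>_def
      by (intro smooth_on_mult smooth_on_inverse smooth_on_add f1 f2 open_UNIV) (use pos in \<open>metis less_irrefl\<close>)
    show "0 \<le> \<beta> x" for x
      using pos[of x] flat_exp_nonneg[of 0 "s x"] by (simp add: \<beta>_def)
    show "\<beta> x = 1" if "dist c x \<le> r" for x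
    proof -
      have "(dist c x)\<^sup>2 \<le> r\<^sup>2" using that by (simp add: power_mono)
      then have "s x \<ge> 1" using Rr by (simp add: s_def field_simps)
      then have "?f (1 + (- 1) * s x) = 0" by (simp add: flat_exp_def)
      then show ?thesis using pos[of x] by (simp add: \<beta>_def)
    qed
    show "\<beta> x = 0" if "dist c x \<ge> R" for x
    proof -
      have "(dist c x)\<^sup>2 \<ge> R\<^sup>2" using that assms by (simp add: power_mono)
      then have "s x \<le> 0" using Rr by (simp add: s_def mult_le_0_iff)
      then show ?thesis by (simp add: \<beta>_def flat_exp_def)
    qed
  qed
qed

section \<open>Exterior algebra on lists\<close>

text \<open>The grade involution.\<close>

definition sgnf :: "('v list \<Rightarrow> real) \<Rightarrow> 'v list \<Rightarrow> real" where
  "sgnf w = (\<lambda>ys. (- 1) ^ length ys * w ys)"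

text \<open>Interior product with x.\<close>

definition ins :: "'v \<Rightarrow> ('v list \<Rightarrow> real) \<Rightarrow> 'v list \<Rightarrow> real" where
  "ins x w = (\<lambda>ys. w (x # ys))"

text \<open>Forms are functions on lists of vectors; \<open>wedge\<close> is the shuffle product (no factorials),
  given by the rule that contraction is an antiderivation.\<close>

fun wedge :: "('v list \<Rightarrow> real) \<Rightarrow> ('v list \<Rightarrow> real) \<Rightarrow> 'v list \<Rightarrow> real" where
  "wedge w t [] = w [] * t []"
| "wedge w t (x # xs) = wedge (ins x w) t xs + wedge (sgnf w) (ins x t) xs"

text \<open>The constant 0-form 1, the unit of \<open>wedge\<close>.\<close>

definition one_form0 :: "'v list \<Rightarrow> real" where
  "one_form0 = (\<lambda>xs. if xs = [] then 1 else 0)"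

primrec wpow :: "('v list \<Rightarrow> real) \<Rightarrow> nat \<Rightarrow> 'v list \<Rightarrow> real" where
  "wpow w 0 = one_form0"
| "wpow w (Suc k) = wedge (wpow w k) w"

text \<open>Identities between forms usually hold only on lists drawn from a given set, such as the
  vector fields; this is what allows them to be substituted inside a product.\<close>

lemma wedge_cong:
  assumes "\<And>ys. set ys \<subseteq> set xs \<Longrightarrow> w ys = w' ys" "\<And>ys. set ys \<subseteq> set xs \<Longrightarrow> t ys = t' ys"
  shows "wedge w t xs = wedge w' t' xs"
  using assms
proof (induction xs arbitrary: w t w' t')
  case (Cons x xs)
  have "wedge (ins x w) t xs = wedge (ins x w') t' xs"
    by (rule Cons.IH) (auto simp: ins_def intro!: Cons.prems)
  moreover have "wedge (sgnf w) (ins x t) xs = wedge (sgnf w') (ins x t') xs"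
    by (rule Cons.IH) (auto simp: ins_def sgnf_def intro!: Cons.prems)
  ultimately show ?case by simp
qed auto

lemma wedge_add_left: "wedge (\<lambda>ys. w ys + w' ys) t xs = wedge w t xs + wedge w' t xs"
  by (induction xs arbitrary: w w' t) (auto simp: ins_def sgnf_def algebra_simps)

lemma wedge_add_right: "wedge w (\<lambda>ys. t ys + t' ys) xs = wedge w t xs + wedge w t' xs"
  by (induction xs arbitrary: w t t') (auto simp: ins_def sgnf_def algebra_simps)

lemma wedge_scale_left: "wedge (\<lambda>ys. c * w ys) t xs = c * wedge w t xs"
proof (induction xs arbitrary: w t)
  case (Cons x xs)
  have "sgnf (\<lambda>ys. c * w ys) = (\<lambda>ys. c * sgnf w ys)" by (auto simp: sgnf_def)
  then show ?case using Cons by (simp add: ins_def algebra_simps)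
qed simp

lemma wedge_scale_right: "wedge w (\<lambda>ys. c * t ys) xs = c * wedge w t xs"
  by (induction xs arbitrary: w t) (auto simp: ins_def algebra_simps)

lemma wedge_zero_left: "wedge (\<lambda>ys. 0) t xs = 0"
  using wedge_scale_left[of 0 "\<lambda>_. 0"] by simp

lemma wedge_zero_right: "wedge w (\<lambda>ys. 0) xs = 0"
  using wedge_scale_right[of w 0 "\<lambda>_. 0"] by simp

lemma wedge_minus_left: "wedge (\<lambda>ys. - w ys) t xs = - wedge w t xs"
  using wedge_scale_left[of "-1" w] by simp

lemma wedge_minus_right: "wedge w (\<lambda>ys. - t ys) xs = - wedge w t xs"
  using wedge_scale_right[of w "-1"] by simp

lemma wedge_sum_left: "wedge (\<lambda>ys. \<Sum>i\<in>I. w i ys) t xs = (\<Sum>i\<in>I. wedge (w i) t xs)"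
  by (induction I rule: infinite_finite_induct) (auto simp: wedge_zero_left wedge_add_left)

lemma sgnf_sgnf: "sgnf (sgnf w) = w"
  by (auto simp: sgnf_def simp flip: power_add mult.assoc)

lemma ins_sgnf: "ins x (sgnf w) = (\<lambda>ys. - sgnf (ins x w) ys)"
  by (auto simp: sgnf_def ins_def)

lemma sgnf_one: "sgnf one_form0 = one_form0"
  by (auto simp: sgnf_def one_form0_def)

lemma ins_one: "ins x one_form0 = (\<lambda>ys. 0)"
  by (auto simp: ins_def one_form0_def)

lemma wedge_one_right: "wedge w one_form0 xs = w xs"
  by (induction xs arbitrary: w) (auto simp: ins_one wedge_zero_right, auto simp: one_form0_def ins_def)

lemma wedge_one_left: "wedge one_form0 w xs = w xs"
  by (induction xs arbitrary: w) (auto simp: ins_one wedge_zero_left sgnf_one, auto simp: one_form0_def ins_def)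

text \<open>Pullback is multiplicative. It is applied both to evaluation of fields at a point and to
  the coordinate isomorphism of a tangent space.\<close>

lemma wedge_map: "wedge (\<lambda>ys. w (map f ys)) (\<lambda>ys. t (map f ys)) xs = wedge w t (map f xs)"
proof (induction xs arbitrary: w t)
  case (Cons x xs)
  have "sgnf (\<lambda>ys. w (map f ys)) = (\<lambda>ys. sgnf w (map f ys))" by (auto simp: sgnf_def)
  then show ?case using Cons[of "ins (f x) w" t] Cons[of "sgnf w" "ins (f x) t"] by (simp add: ins_def)
qed simp

lemma wpow_map: "wpow (\<lambda>ys. w (map f ys)) k xs = wpow w k (map f xs)"
proof (induction k arbitrary: xs)
  case (Suc k)
  show ?case using Suc wedge_map[of "wpow w k" f w xs] by (simp add: wedge_cong[of xs "wpow (\<lambda>ys. w (map f ys)) k"])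
qed (simp add: one_form0_def)

section \<open>Degree, support, alternation and multilinearity of forms on lists\<close>

definition deg :: "nat \<Rightarrow> ('v list \<Rightarrow> real) \<Rightarrow> bool" where
  "deg k w \<longleftrightarrow> (\<forall>xs. length xs \<noteq> k \<longrightarrow> w xs = 0)"

lemma deg_wedge: "deg a w \<Longrightarrow> deg b t \<Longrightarrow> deg (a + b) (wedge w t)"
proof -
  have "length xs \<noteq> a + b \<Longrightarrow> deg a w \<Longrightarrow> deg b t \<Longrightarrow> wedge w t xs = 0" for xs
  proof (induction xs arbitrary: a b w t)
    case Nil
    then show ?case by (auto simp: deg_def)
  next
    case (Cons x xs)
    have "wedge (ins x w) t xs = 0"
    proof (cases a)
      case 0
      then have "ins x w = (\<lambda>ys. 0)" using Cons.prems by (auto simp: deg_def ins_def)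
      then show ?thesis by (simp add: wedge_zero_left)
    next
      case (Suc a')
      then have "deg a' (ins x w)" using Cons.prems by (auto simp: deg_def ins_def)
      then show ?thesis using Cons.IH[of a' b] Cons.prems Suc by auto
    qed
    moreover have "wedge (sgnf w) (ins x t) xs = 0"
    proof (cases b)
      case 0
      then have "ins x t = (\<lambda>ys. 0)" using Cons.prems by (auto simp: deg_def ins_def)
      then show ?thesis by (simp add: wedge_zero_right)
    next
      case (Suc b')
      then have "deg b' (ins x t)" "deg a (sgnf w)" using Cons.prems by (auto simp: deg_def ins_def sgnf_def)
      then show ?thesis using Cons.IH[of a b'] Cons.prems Suc by auto
    qed
    ultimately show ?case by simp
  qed
  then show "deg a w \<Longrightarrow> deg b t \<Longrightarrow> deg (a + b) (wedge w t)" by (auto simp: deg_def[of "a + b"])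
qed

lemma wedge_0_form: "deg 0 w \<Longrightarrow> wedge w t xs = w [] * t xs"
proof -
  assume "deg 0 w"
  then have "w = (\<lambda>ys. w [] * one_form0 ys)" by (auto simp: deg_def one_form0_def fun_eq_iff)
  then show ?thesis using wedge_scale_left[of "w []" one_form0 t xs] wedge_one_left[of t xs] by simp
qed

definition supp :: "'v set \<Rightarrow> ('v list \<Rightarrow> real) \<Rightarrow> bool" where
  "supp T w \<longleftrightarrow> (\<forall>xs. \<not> set xs \<subseteq> T \<longrightarrow> w xs = 0)"

lemma supp_wedge: "supp T w \<Longrightarrow> supp T t \<Longrightarrow> supp T (wedge w t)"
proof -
  have "\<not> set xs \<subseteq> T \<Longrightarrow> supp T w \<Longrightarrow> supp T t \<Longrightarrow> wedge w t xs = 0" for xs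
  proof (induction xs arbitrary: w t)
    case (Cons x xs)
    show ?case
    proof (cases "x \<in> T")
      case True
      then have "supp T (ins x w)" "supp T (ins x t)" "supp T (sgnf w)"
        using Cons.prems by (auto simp: supp_def ins_def sgnf_def)
      then show ?thesis using Cons True by auto
    next
      case False
      then have "ins x w = (\<lambda>ys. 0)" "ins x t = (\<lambda>ys. 0)" using Cons.prems by (auto simp: supp_def ins_def)
      then show ?thesis by (simp add: wedge_zero_left wedge_zero_right)
    qed
  qed simp
  then show "supp T w \<Longrightarrow> supp T t \<Longrightarrow> supp T (wedge w t)" by (auto simp: supp_def[of T "wedge w t"])
qed

text \<open>Adjacent swaps generate all permutations and are what the recursion of
  \<open>wedge\<close>, which consumes one argument at a time, can follow.\<close>

definition alt :: "('v list \<Rightarrow> real) \<Rightarrow> bool" where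
  "alt w \<longleftrightarrow> (\<forall>xs y z ys. w (xs @ y # z # ys) = - w (xs @ z # y # ys))"

lemma altI: "(\<And>xs y z ys. w (xs @ y # z # ys) = - w (xs @ z # y # ys)) \<Longrightarrow> alt w"
  unfolding alt_def by blast

lemma altD: "alt w \<Longrightarrow> w (xs @ y # z # ys) = - w (xs @ z # y # ys)"
  unfolding alt_def by blast

lemma alt_ins: "alt w \<Longrightarrow> alt (ins x w)"
  unfolding ins_def by (rule altI) (metis altD append_Cons)

lemma alt_sgnf:
  assumes "alt w"
  shows "alt (sgnf w)"
proof (rule altI)
  fix xs y z ys
  show "sgnf w (xs @ y # z # ys) = - sgnf w (xs @ z # y # ys)"
    unfolding sgnf_def altD[OF assms, of xs y z ys] by simp
qed

lemma alt_one: "alt one_form0"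
  by (simp add: alt_def one_form0_def)

lemma alt_wedge:
  assumes "alt w" "alt t"
  shows "alt (wedge w t)"
proof -
  have "wedge w t (xs @ y # z # ys) = - wedge w t (xs @ z # y # ys)" for xs y z ys
    using assms
  proof (induction xs arbitrary: w t)
    case Nil
    \<comment> \<open>Contracting the product with y and z gives four terms: those with both
      contractions in one factor change sign by alternation of that factor, and the two mixed ones
      trade places through \<open>ins_sgnf\<close>.\<close>
    have 1: "ins z (ins y w) = (\<lambda>us. - ins y (ins z w) us)" "ins z (ins y t) = (\<lambda>us. - ins y (ins z t) us)"
      using altD[OF Nil(1), of "[]" y z] altD[OF Nil(2), of "[]" y z] by (auto simp: ins_def)
    show ?case
      by (simp add: 1 ins_sgnf sgnf_sgnf wedge_minus_left wedge_minus_right)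
  next
    case (Cons x xs)
    then show ?case by (simp add: alt_ins alt_sgnf)
  qed
  then show ?thesis by (rule altI)
qed

lemma alt_wpow: "alt w \<Longrightarrow> alt (wpow w k)"
  by (induction k) (auto simp: alt_one alt_wedge)

lemma alt_move_front:
  assumes "alt w"
  shows "w (xs @ x # ys) = (- 1) ^ length xs * w (x # xs @ ys)"
  using assms
proof (induction xs arbitrary: w)
  case (Cons y xs)
  have "w ((y # xs) @ x # ys) = (- 1) ^ length xs * w (y # x # xs @ ys)"
    using Cons.IH[OF alt_ins[OF Cons.prems, of y]] by (simp add: ins_def)
  also have "w (y # x # xs @ ys) = - w (x # y # xs @ ys)"
    using altD[OF Cons.prems, of "[]" y x] by simp
  finally show ?case by simp
qed simp

text \<open>Absolute values replace the sign of the permutation; this is enough to transport the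
  vanishing of w from one ordering to another.\<close>

lemma alt_mset:
  assumes "alt w" "mset xs = mset ys"
  shows "\<bar>w xs\<bar> = \<bar>w ys\<bar>"
  using assms
proof (induction xs arbitrary: w ys)
  case (Cons x xs)
  have "x \<in> set ys" using Cons.prems(2) by (metis list.set_intros(1) set_mset_mset)
  then obtain a b where ys: "ys = a @ x # b" using split_list by metis
  then have "mset xs = mset (a @ b)" using Cons.prems(2) by simp
  then have "\<bar>ins x w xs\<bar> = \<bar>ins x w (a @ b)\<bar>" using Cons.IH alt_ins[OF Cons.prems(1)] by blast
  then show ?case unfolding ys alt_move_front[OF Cons.prems(1)] by (simp add: ins_def abs_mult)
qed simp

lemma alt_not_distinct:
  assumes "alt w" "\<not> distinct xs"
  shows "w xs = 0"
proof -
  obtain a b c y where xs: "xs = a @ [y] @ b @ [y] @ c" using assms(2) not_distinct_decomp by blast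
  have "\<bar>w xs\<bar> = \<bar>w ([] @ y # y # (a @ b @ c))\<bar>" unfolding xs by (rule alt_mset[OF assms(1)]) simp
  moreover have "w ([] @ y # y # (a @ b @ c)) = 0"
    using altD[OF assms(1), of "[]" y y] by simp
  ultimately show ?thesis by simp
qed

text \<open>\<open>cmb a u b v\<close> stands for the linear combination \<open>a u + b v\<close> in the space \<open>T\<close>.\<close>
definition mlin :: "(real \<Rightarrow> 'v \<Rightarrow> real \<Rightarrow> 'v \<Rightarrow> 'v) \<Rightarrow> 'v set \<Rightarrow> ('v list \<Rightarrow> real) \<Rightarrow> bool" where
  "mlin cmb T w \<longleftrightarrow> (\<forall>xs ys. set xs \<subseteq> T \<longrightarrow> set ys \<subseteq> T \<longrightarrow> (\<forall>u\<in>T. \<forall>v\<in>T. \<forall>a b.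
     w (xs @ cmb a u b v # ys) = a * w (xs @ u # ys) + b * w (xs @ v # ys)))"

lemma mlinI:
  "(\<And>xs ys u v a b. set xs \<subseteq> T \<Longrightarrow> set ys \<subseteq> T \<Longrightarrow> u \<in> T \<Longrightarrow> v \<in> T \<Longrightarrow>
     w (xs @ cmb a u b v # ys) = a * w (xs @ u # ys) + b * w (xs @ v # ys)) \<Longrightarrow> mlin cmb T w"
  unfolding mlin_def by blast

lemma mlinD:
  "mlin cmb T w \<Longrightarrow> set xs \<subseteq> T \<Longrightarrow> set ys \<subseteq> T \<Longrightarrow> u \<in> T \<Longrightarrow> v \<in> T \<Longrightarrow>
     w (xs @ cmb a u b v # ys) = a * w (xs @ u # ys) + b * w (xs @ v # ys)"
  unfolding mlin_def by blast

lemma mlin_ins: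
  assumes "mlin cmb T w" "x \<in> T"
  shows "mlin cmb T (ins x w)"
proof (rule mlinI)
  fix xs ys u v a b
  assume a: "set xs \<subseteq> T" "set ys \<subseteq> T" "u \<in> T" "v \<in> T"
  have "set (x # xs) \<subseteq> T" using a assms(2) by simp
  from mlinD[OF assms(1) this a(2-4), of a b]
  show "ins x w (xs @ cmb a u b v # ys) = a * ins x w (xs @ u # ys) + b * ins x w (xs @ v # ys)"
    by (simp add: ins_def)
qed

lemma mlin_sgnf:
  assumes "mlin cmb T w"
  shows "mlin cmb T (sgnf w)"
proof (rule mlinI)
  fix xs ys u v a b
  assume a: "set xs \<subseteq> T" "set ys \<subseteq> T" "u \<in> T" "v \<in> T"
  show "sgnf w (xs @ cmb a u b v # ys) = a * sgnf w (xs @ u # ys) + b * sgnf w (xs @ v # ys)"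
    unfolding sgnf_def mlinD[OF assms a, of a b] by (simp add: algebra_simps)
qed

lemma mlin_one: "mlin cmb T one_form0"
  by (simp add: mlin_def one_form0_def)

lemma mlin_wedge:
  assumes "mlin cmb T w" "mlin cmb T t"
  shows "mlin cmb T (wedge w t)"
proof -
  have "wedge w t (xs @ cmb a u b v # ys) = a * wedge w t (xs @ u # ys) + b * wedge w t (xs @ v # ys)"
    if "set xs \<subseteq> T" "set ys \<subseteq> T" "u \<in> T" "v \<in> T" for xs ys u v a b
    using assms that(1)
  proof (induction xs arbitrary: w t)
    case Nil
    have 1: "w (cmb a u b v # us) = a * w (u # us) + b * w (v # us)"
      "t (cmb a u b v # us) = a * t (u # us) + b * t (v # us)" if "set us \<subseteq> set ys" for us
      using mlinD[OF Nil(1), of "[]" us u v a b] mlinD[OF Nil(2), of "[]" us u v a b]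
        that \<open>set ys \<subseteq> T\<close> \<open>u \<in> T\<close> \<open>v \<in> T\<close> by auto
    have "wedge (ins (cmb a u b v) w) t ys = wedge (\<lambda>us. a * ins u w us + b * ins v w us) t ys"
      "wedge (sgnf w) (ins (cmb a u b v) t) ys = wedge (sgnf w) (\<lambda>us. a * ins u t us + b * ins v t us) ys"
      by (rule wedge_cong; use 1 in \<open>auto simp: ins_def\<close>)+
    then show ?case
      by (simp add: wedge_add_left wedge_add_right wedge_scale_left wedge_scale_right algebra_simps)
  next
    case (Cons x xs)
    then have "mlin cmb T (ins x w)" "mlin cmb T (ins x t)" "mlin cmb T (sgnf w)"
      by (auto intro: mlin_ins mlin_sgnf)
    then show ?case using Cons.IH[of "ins x w" t] Cons.IH[of "sgnf w" "ins x t"] Cons.prems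
      by (simp add: algebra_simps)
  qed
  then show ?thesis by (rule mlinI)
qed

lemma mlin_wpow: "mlin cmb T w \<Longrightarrow> mlin cmb T (wpow w k)"
  by (induction k) (auto simp: mlin_one mlin_wedge)

abbreviation mlin' :: "('v::real_vector list \<Rightarrow> real) \<Rightarrow> bool" where
  "mlin' \<equiv> mlin (\<lambda>a u b v. a *\<^sub>R u + b *\<^sub>R v) UNIV"

lemma mlin_vanish:
  fixes w :: "'v::real_vector list \<Rightarrow> real"
  assumes "mlin' w" "span B = UNIV" "\<And>zs. length zs = k \<Longrightarrow> set zs \<subseteq> B \<Longrightarrow> w zs = 0" "length xs = k"
  shows "w xs = 0"
proof -
  \<comment> \<open>The suffix ys already consists of members of B, the prefix xs is arbitrary; the
    last entry of the prefix is moved into the suffix by span induction.\<close>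
  have "w (xs @ ys) = 0" if "set ys \<subseteq> B" "length xs + length ys = k" for xs ys
    using that
  proof (induction xs arbitrary: ys rule: rev_induct)
    case Nil
    then show ?case using assms(3) by simp
  next
    case (snoc x xs)
    have "x \<in> span B" using assms(2) by simp
    then have "w (xs @ x # ys) = 0"
    proof (rule span_induct)
      fix z assume "z \<in> B"
      then show "w (xs @ z # ys) = 0" using snoc.IH[of "z # ys"] snoc.prems by simp
    next
      show "subspace {x. w (xs @ x # ys) = 0}"
        unfolding subspace_def
      proof (intro conjI ballI allI; clarsimp)
        note m = mlinD[OF assms(1), of xs ys]
        show "w (xs @ 0 # ys) = 0" using m[of 0 0 0 0] by simp
        show "w (xs @ (u + v) # ys) = 0" if "w (xs @ u # ys) = 0" "w (xs @ v # ys) = 0" for u v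
          using m[of u v 1 1] that by simp
        show "w (xs @ (c *\<^sub>R u) # ys) = 0" if "w (xs @ u # ys) = 0" for c u
          using m[of u 0 c 0] that by simp
      qed
    qed
    then show ?case by simp
  qed
  from this[of "[]" xs] show ?thesis using assms(4) by simp
qed

text \<open>Uniqueness of the determinant: the difference of w and the proposed multiple of it is
  alternating and multilinear and vanishes on the standard basis, hence everywhere. It yields the
  Jacobian factor when a top form changes coordinates.\<close>

lemma alt_top_det:
  fixes v :: "'n::finite \<Rightarrow> real^'n"
  assumes w: "alt w" "mlin' w" and ns: "distinct ns" "set ns = (UNIV :: 'n set)"
  shows "w (map v ns) = det (\<chi> i. v i) * w (map (\<lambda>i. axis i 1) ns)"
proof -
  let ?m = "length ns" and ?b = "map (\<lambda>i. axis i 1 :: real^'n) ns"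
  \<comment> \<open>The position of an index in \<open>ns\<close>; through it a list of vectors is
    read as the rows of a matrix.\<close>
  define pos where "pos = (\<lambda>i. THE k. k < ?m \<and> ns ! k = i)"
  have pos: "pos (ns ! k) = k" if "k < ?m" for k
    unfolding pos_def using that ns(1) by (auto simp: nth_eq_iff_index_eq)
  have pos': "pos i < ?m" "ns ! pos i = i" for i
  proof -
    have "i \<in> set ns" using ns by auto
    then obtain k where "k < ?m" "ns ! k = i" by (auto simp: in_set_conv_nth)
    then show "pos i < ?m" "ns ! pos i = i" using pos[of k] by auto
  qed
  \<comment> \<open>The determinant as a form on lists; the default 0 at other lengths makes it
    alternating and multilinear on all lists.\<close>
  define dt where "dt = (\<lambda>vs. if length vs = ?m then det (\<chi> i. (vs ! pos i :: real^'n)) else 0)"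
  have dt: "dt (map v ns) = det (\<chi> i. v i)" for v
    unfolding dt_def using pos' by (simp add: nth_map)
  have upd: "(\<chi> i. (xs @ y # ys) ! pos i) = (\<chi> i. if i = ns ! length xs then y else (xs @ x # ys) ! pos i)"
    if "Suc (length xs + length ys) = ?m" for xs x y and ys :: "(real^'n) list"
  proof -
    have p: "pos i = length xs \<longleftrightarrow> i = ns ! length xs" for i
      using pos'(2)[of i] pos[of "length xs"] that by auto
    have "(xs @ y # ys) ! pos i = (if i = ns ! length xs then y else (xs @ x # ys) ! pos i)" for i
      using p[of i] by (auto simp: nth_append nth_Cons')
    then show ?thesis by (simp add: vec_eq_iff)
  qed
  have altd: "dt (xs @ y # z # ys) = - dt (xs @ z # y # ys)" for xs y z ys
  proof (cases "length (xs @ y # z # ys) = ?m")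
    case True
    define p where "p = Transposition.transpose (ns ! length xs) (ns ! Suc (length xs))"
    have l: "length xs < ?m" "Suc (length xs) < ?m" using True by auto
    then have ne: "ns ! length xs \<noteq> ns ! Suc (length xs)" using ns(1) by (simp add: nth_eq_iff_index_eq)
    have pp: "p permutes UNIV" unfolding p_def by (simp add: permutes_swap_id)
    have ii: "pos i = length xs \<longleftrightarrow> i = ns ! length xs" "pos i = Suc (length xs) \<longleftrightarrow> i = ns ! Suc (length xs)" for i
      using pos'(2)[of i] pos l by auto
    have "(xs @ y # z # ys) ! pos i = (xs @ z # y # ys) ! pos (p i)" for i
    proof (cases "i = ns ! length xs \<or> i = ns ! Suc (length xs)")
      case True
      then show ?thesis using pos l by (auto simp: p_def nth_append)
    next
      case False
      then have "p i = i" by (auto simp: p_def transpose_def)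
      then show ?thesis using False ii[of i] by (auto simp: nth_append nth_Cons' split: if_splits)
    qed
    then have e: "(\<chi> i. (xs @ y # z # ys) ! pos i) = (\<chi> i. (\<chi> i. (xs @ z # y # ys) ! pos i) $ p i)"
      by (simp add: vec_eq_iff)
    have sg: "sign p = -1" unfolding p_def using ne by (simp add: sign_swap_id)
    have "det (\<chi> i. (xs @ y # z # ys) ! pos i) = - det (\<chi> i. (xs @ z # y # ys) ! pos i)"
      unfolding e det_permute_rows[OF pp] sg by simp
    then show ?thesis unfolding dt_def using True by simp
  qed (auto simp: dt_def)
  have mld: "dt (xs @ (a *\<^sub>R u + b *\<^sub>R u') # ys) = a * dt (xs @ u # ys) + b * dt (xs @ u' # ys)" for xs a u b u' ys
  proof (cases "Suc (length xs + length ys) = ?m")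
    case True
    let ?c = "\<lambda>i. (xs @ u # ys) ! pos i"
    let ?k = "ns ! length xs"
    have sm: "c *s x = c *\<^sub>R x" for c and x :: "real^'n" by (simp add: vec_eq_iff)
    have "det (\<chi> i. if i = ?k then a *\<^sub>R u + b *\<^sub>R u' else ?c i) =
        det (\<chi> i. if i = ?k then a *\<^sub>R u else ?c i) + det (\<chi> i. if i = ?k then b *\<^sub>R u' else ?c i)"
      by (rule det_row_add)
    also have "det (\<chi> i. if i = ?k then a *\<^sub>R u else ?c i) = a * det (\<chi> i. if i = ?k then u else ?c i)"
      using det_row_mul[of ?k a "\<lambda>_. u" ?c] unfolding sm .
    also have "det (\<chi> i. if i = ?k then b *\<^sub>R u' else ?c i) = b * det (\<chi> i. if i = ?k then u' else ?c i)"
      using det_row_mul[of ?k b "\<lambda>_. u'" ?c] unfolding sm .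
    finally show ?thesis using True by (simp add: dt_def flip: upd[OF True])
  qed (auto simp: dt_def)
  define \<delta> where "\<delta> = (\<lambda>vs. w vs - w ?b * dt vs)"
  have "alt \<delta>"
  proof (rule altI)
    fix xs y z ys
    show "\<delta> (xs @ y # z # ys) = - \<delta> (xs @ z # y # ys)"
      unfolding \<delta>_def altD[OF w(1), of xs y z ys] altd[of xs y z ys] by simp
  qed
  have ml: "mlin' \<delta>"
  proof (rule mlinI)
    fix xs ys :: "(real^'n) list" and u v a b
    show "\<delta> (xs @ (a *\<^sub>R u + b *\<^sub>R v) # ys) = a * \<delta> (xs @ u # ys) + b * \<delta> (xs @ v # ys)"
      unfolding \<delta>_def mld using mlinD[OF w(2), of xs ys u v a b] by (simp add: algebra_simps)
  qed
  have "(\<chi> i. axis i 1) = (mat 1 :: real^'n^'n)" by (simp add: mat_def axis_def vec_eq_iff)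
  then have "dt ?b = 1" unfolding dt by simp
  then have "\<delta> ?b = 0" by (simp add: \<delta>_def)
  have "\<delta> (map v ns) = 0"
  proof (rule mlin_vanish[OF ml, of Basis])
    fix zs :: "(real^'n) list" assume zs: "length zs = ?m" "set zs \<subseteq> Basis"
    show "\<delta> zs = 0"
    proof (cases "distinct zs")
      case True
      have sb: "set ?b = Basis" using ns by (auto simp: Basis_vec_def)
      have db: "distinct ?b" using ns by (auto simp: distinct_map inj_on_def axis_eq_axis)
      have "card (set zs) = card (Basis :: (real^'n) set)"
        using True zs(1) db sb by (metis distinct_card length_map)
      then have "set zs = Basis" using zs(2) by (simp add: card_subset_eq)
      then have "mset zs = mset ?b" using sb True db by (metis set_eq_iff_mset_eq_distinct)
      then show ?thesis using alt_mset[OF \<open>alt \<delta>\<close>] \<open>\<delta> ?b = 0\<close> by fastforce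
    qed (rule alt_not_distinct[OF \<open>alt \<delta>\<close>])
  qed auto
  then show ?thesis unfolding \<delta>_def dt by (simp add: mult.commute)
qed

subsection \<open>Linear algebra of almost contact metric structures\<close>

definition lin_form :: "('v \<Rightarrow> real) \<Rightarrow> 'v list \<Rightarrow> real" where
  "lin_form h xs = (if length xs = 1 then h (xs ! 0) else 0)"

definition bil_form :: "('v \<Rightarrow> 'v \<Rightarrow> real) \<Rightarrow> 'v list \<Rightarrow> real" where
  "bil_form B xs = (if length xs = 2 then B (xs ! 0) (xs ! 1) else 0)"

lemma ins_ins_bil: "ins f (ins e (bil_form B)) = (\<lambda>ys. B e f * one_form0 ys)"
  by (auto simp: ins_def bil_form_def one_form0_def)

lemma ins_lin: "ins e (lin_form h) = (\<lambda>ys. h e * one_form0 ys)"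
  by (auto simp: ins_def lin_form_def one_form0_def)

lemma ins_bil_zero: "(\<And>y. y \<in> set ys \<Longrightarrow> B x y = 0) \<Longrightarrow> ins x (bil_form B) ys = 0"
  by (simp add: ins_def bil_form_def)

lemma wpow_bil_ins_zero:
  assumes "\<And>y. y \<in> set xs \<Longrightarrow> B x y = 0"
  shows "ins x (wpow (bil_form B) k) xs = 0"
  using assms
proof (induction k arbitrary: xs)
  case 0
  then show ?case by (simp add: ins_one)
next
  case (Suc k)
  have "wedge (ins x (wpow (bil_form B) k)) (bil_form B) xs = wedge (\<lambda>ys. 0) (bil_form B) xs"
    by (rule wedge_cong) (use Suc in auto)
  moreover have "wedge (sgnf (wpow (bil_form B) k)) (ins x (bil_form B)) xs = wedge (sgnf (wpow (bil_form B) k)) (\<lambda>ys. 0) xs"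
    by (rule wedge_cong) (use Suc in \<open>auto intro!: ins_bil_zero\<close>)
  ultimately show ?case unfolding wpow.simps
    by (simp add: ins_def[of x "wedge _ _"] wedge_zero_left wedge_zero_right)
qed

lemma wedge_pair:
  "wedge w t (e # f # xs) = wedge (ins f (ins e w)) t xs + wedge (sgnf (ins e w)) (ins f t) xs
     - wedge (sgnf (ins f w)) (ins e t) xs + wedge w (ins f (ins e t)) xs"
  by (simp add: ins_sgnf sgnf_sgnf wedge_minus_left)

text \<open>Since e and f are B-orthogonal to the remaining entries, only the terms that feed both
  to the same factor survive, and any of the k + 1 factors can take them.\<close>

lemma wpow_bil_pair:
  assumes "\<And>y. y \<in> set xs \<Longrightarrow> B e y = 0 \<and> B f y = 0"
  shows "wpow (bil_form B) (Suc k) (e # f # xs) = real (Suc k) * B e f * wpow (bil_form B) k xs"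
  using assms
proof (induction k arbitrary: xs)
  case 0
  show ?case
    by (simp add: ins_one wedge_zero_left wedge_zero_right sgnf_def ins_ins_bil wedge_scale_right wedge_one_right)
      (simp add: ins_def wedge_zero_left wedge_zero_right bil_form_def one_form0_def)
next
  case (Suc k)
  let ?F = "bil_form B" and ?P = "wpow (bil_form B) (Suc k)"
  have z: "ins e ?P ys = 0" "ins f ?P ys = 0" "ins e ?F ys = 0" "ins f ?F ys = 0" if "set ys \<subseteq> set xs" for ys
    using that Suc.prems by (auto intro!: wpow_bil_ins_zero ins_bil_zero simp del: wpow.simps)
  have "wedge (ins f (ins e ?P)) ?F xs = wedge (\<lambda>ys. real (Suc k) * B e f * wpow ?F k ys) ?F xs"
    by (rule wedge_cong) (use Suc in \<open>auto simp: ins_def simp del: wpow.simps\<close>)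
  moreover have "wedge (sgnf (ins e ?P)) (ins f ?F) xs = wedge (sgnf (ins e ?P)) (\<lambda>ys. 0) xs"
    by (rule wedge_cong) (use z in auto)
  moreover have "wedge (sgnf (ins f ?P)) (ins e ?F) xs = wedge (sgnf (ins f ?P)) (\<lambda>ys. 0) xs"
    by (rule wedge_cong) (use z in auto)
  ultimately have "wedge ?P ?F (e # f # xs) =
      real (Suc k) * B e f * wedge (wpow ?F k) ?F xs + B e f * ?P xs"
    unfolding wedge_pair ins_ins_bil
    by (simp only: wedge_scale_left wedge_scale_right wedge_zero_right wedge_one_right)
  also have "\<dots> = real (Suc (Suc k)) * B e f * ?P xs" by (simp add: algebra_simps)
  finally show ?case by simp
qed

text \<open>As in \<open>wpow_bil_pair\<close>, except that the factor a cannot absorb the pair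
  because a e f = 0; the k + 1 copies of B remain.\<close>

lemma wedge_bil_pair:
  assumes "\<And>y. y \<in> set xs \<Longrightarrow> B e y = 0 \<and> B f y = 0" and a: "a e f = 0"
  shows "wedge (bil_form a) (wpow (bil_form B) (Suc k)) (e # f # xs)
    = real (Suc k) * B e f * wedge (bil_form a) (wpow (bil_form B) k) xs"
proof -
  let ?F = "bil_form B" and ?P = "wpow (bil_form B) (Suc k)"
  have z: "ins e ?P ys = 0" "ins f ?P ys = 0" if "set ys \<subseteq> set xs" for ys
    using that assms by (auto intro!: wpow_bil_ins_zero simp del: wpow.simps)
  have "wedge (bil_form a) (ins f (ins e ?P)) xs = wedge (bil_form a) (\<lambda>ys. real (Suc k) * B e f * wpow ?F k ys) xs"
    by (rule wedge_cong) (use wpow_bil_pair[of _ B e f k] assms in \<open>auto simp: ins_def simp del: wpow.simps\<close>)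
  moreover have "wedge (sgnf (ins e (bil_form a))) (ins f ?P) xs = wedge (sgnf (ins e (bil_form a))) (\<lambda>ys. 0) xs"
    by (rule wedge_cong) (use z in auto)
  moreover have "wedge (sgnf (ins f (bil_form a))) (ins e ?P) xs = wedge (sgnf (ins f (bil_form a))) (\<lambda>ys. 0) xs"
    by (rule wedge_cong) (use z in auto)
  ultimately show ?thesis
    unfolding wedge_pair ins_ins_bil using a
    by (simp only: wedge_scale_left wedge_scale_right wedge_zero_right wedge_zero_left mult_zero_left)
qed

text \<open>A model of one tangent space. The metric is G; the inner product of the type is
  auxiliary and supplies dimension and orthogonal complements.\<close>

locale contact_vector_space =
  fixes G :: "'v::euclidean_space \<Rightarrow> 'v \<Rightarrow> real" and J :: "'v \<Rightarrow> 'v" and \<xi> :: 'v and h :: "'v \<Rightarrow> real" and n :: nat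
  assumes dim: "DIM('v) = 2 * n + 1"
    and G_add: "G (a *\<^sub>R x + b *\<^sub>R y) z = a * G x z + b * G y z"
    and G_sym: "G x y = G y x"
    and G_pos: "x \<noteq> 0 \<Longrightarrow> G x x > 0"
    and JJ: "J (J x) = - x + h x *\<^sub>R \<xi>"
    and J_xi: "J \<xi> = 0"
    and h_xi: "h \<xi> = 1"
    and G_J: "G (J x) (J y) = G x y - h x * h y"
    and h_J: "h (J x) = 0"
begin

definition B where "B x y = G x (J y)"

lemma G_add_left: "G (x + y) z = G x z + G y z"
  using G_add[of 1 x 1 y] by simp

lemma G_zero: "G 0 z = 0" "G z 0 = 0"
  using G_add[of 0 0 0 0 z] G_sym[of 0 z] by simp_all

lemma G_scale: "G (a *\<^sub>R x) z = a * G x z" "G z (a *\<^sub>R x) = a * G z x"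
  using G_add[of a x 0 0] G_sym by (simp_all add: G_zero)

lemma G_minus: "G (- x) z = - G x z" "G z (- x) = - G z x"
  using G_scale[where a = "-1"] by simp_all

lemma G_add_right: "G z (x + y) = G z x + G z y"
  using G_add_left G_sym by metis

lemma G_diff_right: "G z (x - y) = G z x - G z y"
  using G_add_right[of z x "- y"] by (simp add: G_minus)

lemma h_eq: "h x = G x \<xi>"
  using G_J[of x \<xi>] by (simp add: J_xi G_zero h_xi)

lemma G_xi_J: "G \<xi> (J x) = 0"
  using h_J[of x] h_eq G_sym by metis

lemma J_skew: "G x (J y) = - G (J x) y"
proof -
  have "G x (J y) = G (J x) (J (J y))" using G_J[of x "J y"] by (simp add: h_J)
  also have "\<dots> = - G (J x) y + h y * G (J x) \<xi>" by (simp add: JJ G_diff_right G_add_right G_minus G_scale)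
  also have "G (J x) \<xi> = 0" using h_J h_eq by simp
  finally show ?thesis by simp
qed

lemma B_J: "B x (J x) = - G x x + h x * h x"
  by (simp add: B_def JJ G_diff_right G_add_right G_minus G_scale h_eq)

lemma B_xi: "B \<xi> y = 0"
  by (simp add: B_def G_xi_J)

lemma B_J_left: "B (J x) y = G x y - h x * h y"
  by (simp add: B_def G_J)

definition pairs :: "'v list \<Rightarrow> 'v list" where
  "pairs es = concat (map (\<lambda>e. [e, J e]) es)"

text \<open>The vectors are left unnormalised, since only the nonvanishing of G e e matters. With n
  of them, \<xi> and the \<open>pairs\<close> form a G-orthogonal basis.\<close>

definition adapted :: "'v list \<Rightarrow> bool" where
  "adapted es \<longleftrightarrow> (\<forall>e\<in>set es. e \<noteq> 0 \<and> h e = 0) \<and> sorted_wrt (\<lambda>x y. G x y = 0 \<and> B x y = 0) es"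

lemma pairs_simps: "pairs [] = []" "pairs (e # es) = e # J e # pairs es"
  by (auto simp: pairs_def)

lemma length_pairs: "length (pairs es) = 2 * length es"
  by (induction es) (auto simp: pairs_simps)

lemma set_pairs: "set (pairs es) = set es \<union> J ` set es"
  by (induction es) (auto simp: pairs_simps)

lemma adapted_Cons:
  assumes "adapted (e # es)"
  shows "adapted es" "G e e > 0" "h e = 0" "y \<in> set (pairs es) \<Longrightarrow> G e y = 0 \<and> G (J e) y = 0 \<and> B e y = 0 \<and> B (J e) y = 0"
proof -
  show a: "adapted es" "G e e > 0" and h: "h e = 0" using assms G_pos by (auto simp: adapted_def)
  have o: "G e z = 0" "B e z = 0" "h z = 0" if "z \<in> set es" for z using assms that by (auto simp: adapted_def)
  show "G e y = 0 \<and> G (J e) y = 0 \<and> B e y = 0 \<and> B (J e) y = 0" if y: "y \<in> set (pairs es)"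
  proof -
    from y consider "y \<in> set es" | z where "z \<in> set es" "y = J z" by (auto simp: set_pairs)
    then show ?thesis
    proof cases
      case 1
      have "G (J e) y = 0" using J_skew[of e y] o(2)[OF 1] by (simp add: B_def)
      then show ?thesis using o[OF 1] h by (simp add: B_J_left)
    next
      case 2
      then have "B e y = 0" using o[OF 2(1)] by (simp add: B_def JJ G_diff_right G_add_right G_minus G_scale)
      then show ?thesis using 2 o[OF 2(1)] h h_J by (simp add: B_J_left G_J) (simp add: B_def)
    qed
  qed
qed

lemma adapted_exists:
  assumes "k \<le> n"
  shows "\<exists>es. length es = k \<and> adapted es"
  using assms
proof (induction k)
  case 0
  then show ?case by (simp add: adapted_def)
next
  case (Suc k)
  then obtain es where es: "length es = k" "adapted es" by auto
  \<comment> \<open>\<open>A y\<close> represents the functional G(-, y) by the inner product, so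
    that G-orthogonality becomes ordinary orthogonality.\<close>
  define A where "A = (\<lambda>y. \<Sum>b\<in>Basis. G b y *\<^sub>R b)"
  have A: "x \<bullet> A y = G x y" for x y
  proof -
    have "G (\<Sum>b\<in>I. (x \<bullet> b) *\<^sub>R b) y = (\<Sum>b\<in>I. (x \<bullet> b) * G b y)" for I :: "'v set"
      by (induction I rule: infinite_finite_induct) (auto simp: G_zero G_add_left G_scale)
    from this[of Basis] show ?thesis
      by (simp add: A_def inner_sum_right euclidean_representation mult.commute)
  qed
  \<comment> \<open>There are at most 2k + 1 conditions, fewer than 2n + 1 as long as k < n, so a
    new vector satisfying them all exists.\<close>
  let ?S = "A ` (insert \<xi> (set (pairs es)))"
  have "card ?S \<le> card (insert \<xi> (set (pairs es)))" by (rule card_image_le) simp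
  also have "\<dots> \<le> Suc (length (pairs es))" using card_length card_insert_le_m1
    by (metis (no_types, lifting) List.finite_set card_insert_if le_Suc_eq not_less_eq_eq)
  also have "\<dots> < DIM('v)" using es Suc.prems dim by (simp add: length_pairs)
  finally have "dim ?S < DIM('v)" using dim_le_card'[of ?S] by simp
  then obtain v where v: "v \<noteq> 0" "\<And>y. y \<in> span ?S \<Longrightarrow> orthogonal v y"
    using orthogonal_to_subspace_exists by blast
  have ov: "G v y = 0" if "y \<in> insert \<xi> (set (pairs es))" for y
    using v(2)[of "A y"] that span_base[of "A y" ?S] by (auto simp: orthogonal_def A)
  have hv: "h v = 0" using ov[of \<xi>] by (simp add: h_eq)
  have "G e v = 0 \<and> B e v = 0" if "e \<in> set es" for e
    using ov[of e] ov[of "J e"] that G_sym[of e v] J_skew[of e v] G_sym[of "J e" v] by (simp add: set_pairs B_def)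
  then have "adapted (es @ [v])" using es v hv by (auto simp: adapted_def sorted_wrt_append)
  then show ?case using es by (intro exI[of _ "es @ [v]"]) simp
qed

text \<open>The pairs split off one at a time by \<open>wpow_bil_pair\<close>, each with a factor B
  e (J e) = - G e e, which is nonzero.\<close>

lemma wpow_pairs:
  "adapted es \<Longrightarrow> wpow (bil_form B) (length es) (pairs es) \<noteq> 0"
proof (induction es)
  case Nil
  then show ?case by (simp add: pairs_simps one_form0_def)
next
  case (Cons e es)
  note a = adapted_Cons[OF Cons.prems]
  have "wpow (bil_form B) (length (e # es)) (pairs (e # es)) =
      real (Suc (length es)) * B e (J e) * wpow (bil_form B) (length es) (pairs es)"
    unfolding pairs_simps list.size add_0_right add_Suc_right One_nat_def
    by (rule wpow_bil_pair) (use a(4) in auto)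
  then show ?case using Cons.IH[OF a(1)] a(2,3) B_J[of e] by simp
qed

text \<open>A counting argument: anti-invariance prevents a from absorbing any pair (e, J e), and k
  copies of B cannot absorb k + 1 pairs.\<close>

lemma wedge_pairs:
  assumes "\<And>x y. a (J x) (J y) = - a x y" "\<And>x y. a x y = - a y x" "\<And>x y. a x (- y) = - a x y"
  shows "adapted es \<Longrightarrow> length es = Suc k \<Longrightarrow> wedge (bil_form a) (wpow (bil_form B) k) (pairs es) = 0"
proof (induction es arbitrary: k)
  case (Cons e es)
  note ad = adapted_Cons[OF Cons.prems(1)]
  \<comment> \<open>a (J e) (J (J e)) equals - a e (J e) by anti-invariance, but a e (J e) by J (J
    e) = - e and skewness.\<close>
  have ae: "a e (J e) = 0"
  proof -
    have "a (J e) (J (J e)) = a e (J e)" using assms(2)[of "J e" e] ad(3) by (simp add: JJ assms(3))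
    then show ?thesis using assms(1)[of e "J e"] by simp
  qed
  show ?case
  proof (cases k)
    case 0
    then have "es = []" using Cons.prems by simp
    then show ?thesis using 0 ae unfolding wpow.simps(1) 0 wedge_one_right by (simp add: pairs_simps bil_form_def)
  next
    case (Suc j)
    have "wedge (bil_form a) (wpow (bil_form B) (Suc j)) (e # J e # pairs es)
      = real (Suc j) * B e (J e) * wedge (bil_form a) (wpow (bil_form B) j) (pairs es)"
      by (rule wedge_bil_pair) (use ad(4) ae in auto)
    then show ?thesis unfolding Suc pairs_simps using Cons.IH[OF ad(1), of j] Cons.prems Suc by simp
  qed
qed simp

lemma ins_xi_wpow: "ins \<xi> (wpow (bil_form B) k) = (\<lambda>ys. 0)"
  by (rule ext, rule wpow_bil_ins_zero, rule B_xi)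

lemma ins_xi_bil: "ins \<xi> (bil_form B) = (\<lambda>ys. 0)"
  by (rule ext, rule ins_bil_zero, rule B_xi)

lemma volume_nonzero:
  assumes "n \<ge> 1"
  shows "\<exists>xs. wedge (wedge (lin_form h) (wpow (bil_form B) (n - 1))) (bil_form B) xs \<noteq> 0"
proof -
  obtain m where m: "n = Suc m" using assms by (cases n) auto
  let ?P = "wpow (bil_form B) m"
  obtain es where es: "length es = n" "adapted es" using adapted_exists[of n] by auto
  \<comment> \<open>Contraction with \<xi> kills B and its powers and turns the 1-form into the
    constant 1, so \<xi> in front leaves exactly the power of B.\<close>
  have i: "ins \<xi> (wedge (lin_form h) ?P) = ?P"
    by (auto simp: ins_def[of \<xi> "wedge _ _"] ins_xi_wpow wedge_zero_right ins_lin h_xi wedge_one_left)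
  have "wedge (wedge (lin_form h) ?P) (bil_form B) (\<xi> # pairs es) = wpow (bil_form B) n (pairs es)"
    by (simp add: i ins_xi_bil wedge_zero_right m)
  then show ?thesis using wpow_pairs[OF es(2)] es(1) unfolding m diff_Suc_1 by metis
qed

lemma mlin_bil:
  fixes a :: "'v \<Rightarrow> 'v \<Rightarrow> real"
  assumes "\<And>x y z s t. a (s *\<^sub>R x + t *\<^sub>R y) z = s * a x z + t * a y z" "\<And>x y. a x y = - a y x"
  shows "mlin' (bil_form a)" "alt (bil_form a)"
proof -
  have r: "a z (s *\<^sub>R x + t *\<^sub>R y) = s * a z x + t * a z y" for x y z s t
  proof -
    have "a z (s *\<^sub>R x + t *\<^sub>R y) = - a (s *\<^sub>R x + t *\<^sub>R y) z" by (rule assms(2))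
    also have "\<dots> = s * a z x + t * a z y" unfolding assms(1) assms(2)[of x z] assms(2)[of y z] by simp
    finally show ?thesis .
  qed
  show "mlin' (bil_form a)"
  proof (rule mlinI)
    fix xs ys and u v :: 'v and s t :: real
    show "bil_form a (xs @ (s *\<^sub>R u + t *\<^sub>R v) # ys) = s * bil_form a (xs @ u # ys) + t * bil_form a (xs @ v # ys)"
    proof (cases xs)
      case Nil
      then show ?thesis by (simp add: bil_form_def assms(1))
    next
      case (Cons x xs')
      then show ?thesis by (cases xs') (auto simp: bil_form_def r)
    qed
  qed
  show "alt (bil_form a)"
  proof (rule altI)
    fix xs ys and u v :: 'v
    show "bil_form a (xs @ u # v # ys) = - bil_form a (xs @ v # u # ys)"
      using assms(2)[of u v] by (cases xs) (auto simp: bil_form_def)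
  qed
qed

lemma B_lin: "B (s *\<^sub>R x + t *\<^sub>R y) z = s * B x z + t * B y z"
  by (simp add: B_def G_add)

lemma B_skew: "B x y = - B y x"
  unfolding B_def using J_skew[of x y] G_sym by metis

text \<open>By multilinearity it suffices to test lists from the basis made of \<xi> and the adapted
  pairs. Repeated entries and occurrences of \<xi> give 0, and what remains is the list of
  \<open>wedge_pairs\<close> up to order.\<close>

lemma anti_invariant_wedge_zero:
  fixes a :: "'v \<Rightarrow> 'v \<Rightarrow> real"
  assumes a: "\<And>x y z s t. a (s *\<^sub>R x + t *\<^sub>R y) z = s * a x z + t * a y z" "\<And>x y. a x y = - a y x"
    and aJ: "\<And>x y. a (J x) (J y) = - a x y" and n: "n \<ge> 1" and xs: "length xs = 2 * n"
  shows "wedge (bil_form a) (wpow (bil_form B) (n - 1)) xs = 0"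
proof -
  let ?W = "wedge (bil_form a) (wpow (bil_form B) (n - 1))"
  have alt: "alt ?W" by (intro alt_wedge alt_wpow mlin_bil a B_lin B_skew)
  have ml: "mlin' ?W" by (intro mlin_wedge mlin_wpow mlin_bil a B_lin B_skew)
  have am: "a x (- y) = - a x y" for x y
  proof -
    have "a x (- y) = - a (- y) x" by (rule a(2))
    also have "\<dots> = a y x" using a(1)[of "-1" y 0 0 x] by simp
    also have "\<dots> = - a x y" by (rule a(2))
    finally show ?thesis .
  qed
  have a0: "a 0 z = 0" for z using a(1)[of 0 0 0 0 z] by simp
  \<comment> \<open>J \<xi> = 0 makes the left side of anti-invariance vanish.\<close>
  have axi: "a \<xi> y = 0" for y using aJ[of \<xi> y] by (simp add: J_xi a0)
  obtain es where es: "length es = n" "adapted es" using adapted_exists[of n] by auto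
  define bs where "bs = \<xi> # pairs es"
  have o: "sorted_wrt (\<lambda>x y. G x y = 0) (pairs es) \<and> (\<forall>x\<in>set (pairs es). x \<noteq> 0 \<and> h x = 0)"
    using es(2)
  proof (induction es)
    case Nil
    then show ?case by (simp add: pairs_simps)
  next
    case (Cons e es)
    note ad = adapted_Cons[OF Cons.prems(1)]
    have "G e (J e) = 0" using J_skew[of e e] G_sym[of e "J e"] by simp
    moreover have "G (J e) (J e) > 0" using ad by (simp add: G_J)
    then have "J e \<noteq> 0" "e \<noteq> 0" using G_zero ad(2) by auto
    ultimately show ?case using Cons.IH[OF ad(1)] ad(3,4) by (auto simp: pairs_simps h_J)
  qed
  have "\<xi> \<noteq> 0" using h_xi h_eq[of \<xi>] G_zero by auto
  then have ob: "sorted_wrt (\<lambda>x y. G x y = 0) bs" "0 \<notin> set bs"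
    using o h_eq G_sym by (auto simp: bs_def)
  have pij: "G (bs ! i) (bs ! j) = 0" if "i < length bs" "j < length bs" "i \<noteq> j" for i j
  proof (cases "i < j")
    case True
    show ?thesis by (rule sorted_wrt_nth_less[OF ob(1) True that(2)])
  next
    case False
    then have "j < i" using that by simp
    from sorted_wrt_nth_less[OF ob(1) this that(1)] show ?thesis using G_sym[of "bs ! i"] by simp
  qed
  have po: "G x y = 0" if "x \<in> set bs" "y \<in> set bs" "x \<noteq> y" for x y
    using that pij by (auto simp: in_set_conv_nth)
  have dis: "distinct bs"
    unfolding distinct_conv_nth
  proof (intro allI impI)
    fix i j assume ij: "i < length bs" "j < length bs" "i \<noteq> j"
    then have "G (bs ! i) (bs ! j) = 0" by (rule pij)
    moreover have "bs ! i \<noteq> 0" using ob(2) ij(1) nth_mem by metis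
    ultimately show "bs ! i \<noteq> bs ! j" using G_pos by force
  qed
  have "independent (set bs)"
    unfolding dependent_def
  proof clarify
    fix x assume x: "x \<in> set bs" "x \<in> span (set bs - {x})"
    have "subspace {y. G x y = 0}" by (simp add: subspace_def G_zero G_add_right G_scale)
    moreover have "set bs - {x} \<subseteq> {y. G x y = 0}" using po x(1) by auto
    ultimately have "G x x = 0" using x(2) span_minimal by blast
    then show False using G_pos[of x] ob(2) x(1) by force
  qed
  moreover have "card (set bs) = DIM('v)" using dis dim es by (simp add: distinct_card bs_def length_pairs)
  ultimately have sp: "span (set bs) = UNIV"
    using card_ge_dim_independent[of "set bs" UNIV] by auto
  show ?thesis
  proof (rule mlin_vanish[OF ml sp _ xs])
    fix zs assume zs: "length zs = 2 * n" "set zs \<subseteq> set bs"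
    show "?W zs = 0"
    proof (cases "distinct zs")
      case dz: True
      show ?thesis
      proof (cases "\<xi> \<in> set zs")
        case True
        then obtain u v where uv: "zs = u @ \<xi> # v" using split_list by metis
        have "ins \<xi> (bil_form a) = (\<lambda>ys. 0)" by (rule ext, rule ins_bil_zero, rule axi)
        then have "?W (\<xi> # u @ v) = 0" by (simp add: ins_xi_wpow wedge_zero_left wedge_zero_right)
        then show ?thesis unfolding uv alt_move_front[OF alt] by simp
      next
        case False
        \<comment> \<open>Without \<xi>, the 2n distinct entries exhaust the 2n vectors e and J
          e.\<close>
        then have "set zs \<subseteq> set (pairs es)" using zs by (auto simp: bs_def)
        moreover have "card (set zs) = card (set (pairs es))"
          using dz dis zs es by (simp add: distinct_card bs_def length_pairs)
        ultimately have "set zs = set (pairs es)" by (simp add: card_subset_eq)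
        then have "mset zs = mset (pairs es)"
          using dz dis by (simp add: set_eq_iff_mset_eq_distinct[symmetric] bs_def)
        moreover have "?W (pairs es) = 0" using wedge_pairs[OF aJ a(2) am es(2), of "n - 1"] es n by simp
        ultimately show ?thesis using alt_mset[OF alt] by fastforce
      qed
    qed (rule alt_not_distinct[OF alt])
  qed
qed

end

section \<open>Vector fields and differential forms\<close>

text \<open>Tangent spaces are sets of functions rather than types, so linearity is phrased by an
  explicit combination, in the argument order that \<open>mlin\<close> expects.\<close>

definition cmbT :: "real \<Rightarrow> 'a tvec \<Rightarrow> real \<Rightarrow> 'a tvec \<Rightarrow> 'a tvec" where
  "cmbT a u b v = (\<lambda>f. a * u f + b * v f)"

lemma wedge_diff_left: "wedge (\<lambda>ys. w ys - w' ys) t xs = wedge w t xs - wedge w' t xs"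
  using wedge_add_left[of w "\<lambda>ys. - w' ys" t xs] by (simp add: wedge_minus_left)

lemma wedge_diff_right: "wedge w (\<lambda>ys. t ys - t' ys) xs = wedge w t xs - wedge w t' xs"
  using wedge_add_right[of w t "\<lambda>ys. - t' ys" xs] by (simp add: wedge_minus_right)

locale smooth_mfd =
  fixes A :: "('a::{t2_space, second_countable_topology}, 'e::euclidean_space) chart set"
  assumes mfd: "smooth_manifold A"
begin

abbreviation "C \<equiv> smooth_funs A"
abbreviation "VF \<equiv> vector_fields A"
abbreviation "TS \<equiv> tangent_space A"

section \<open>Smooth functions, tangent vectors and vector fields\<close>

lemma chart_open: "(U, \<psi>) \<in> A \<Longrightarrow> open U" "(U, \<psi>) \<in> A \<Longrightarrow> open (\<psi> ` U)"
  using mfd by (auto simp: smooth_manifold_def is_chart_def)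

lemma C_I: "(\<And>U \<psi>. (U, \<psi>) \<in> A \<Longrightarrow> smooth_on (\<psi> ` U) (\<lambda>x. f (inv_into U \<psi> x))) \<Longrightarrow> f \<in> C"
  by (auto simp: smooth_funs_def o_def)

lemma C_D: "f \<in> C \<Longrightarrow> (U, \<psi>) \<in> A \<Longrightarrow> smooth_on (\<psi> ` U) (\<lambda>x. f (inv_into U \<psi> x))"
  by (auto simp: smooth_funs_def o_def)

lemma C_const: "(\<lambda>x. c) \<in> C"
  by (rule C_I) (rule smooth_on_const)

lemma C_add: "f \<in> C \<Longrightarrow> h \<in> C \<Longrightarrow> (\<lambda>x. f x + h x) \<in> C"
  by (rule C_I) (intro smooth_on_add chart_open C_D)

lemma C_mult: "f \<in> C \<Longrightarrow> h \<in> C \<Longrightarrow> (\<lambda>x. f x * h x) \<in> C"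
  by (rule C_I) (intro smooth_on_mult chart_open C_D)

lemma C_minus: "f \<in> C \<Longrightarrow> (\<lambda>x. - f x) \<in> C"
  using C_mult[OF C_const[of "-1"]] by simp

lemma C_diff: "f \<in> C \<Longrightarrow> h \<in> C \<Longrightarrow> (\<lambda>x. f x - h x) \<in> C"
  using C_add[OF _ C_minus] by simp

lemma C_sum: "(\<And>i. i \<in> I \<Longrightarrow> f i \<in> C) \<Longrightarrow> (\<lambda>x. \<Sum>i\<in>I. f i x) \<in> C"
  by (rule C_I) (intro smooth_on_sum chart_open C_D)

lemma C_inverse: "f \<in> C \<Longrightarrow> (\<And>x. f x \<noteq> 0) \<Longrightarrow> (\<lambda>x. inverse (f x)) \<in> C"
  by (rule C_I) (intro smooth_on_inverse chart_open C_D)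

lemma T_lin: "v \<in> TS p \<Longrightarrow> f \<in> C \<Longrightarrow> h \<in> C \<Longrightarrow> v (\<lambda>x. a * f x + b * h x) = a * v f + b * v h"
  by (auto simp: tangent_space_def)

lemma T_mult: "v \<in> TS p \<Longrightarrow> f \<in> C \<Longrightarrow> h \<in> C \<Longrightarrow> v (\<lambda>x. f x * h x) = f p * v h + h p * v f"
  by (auto simp: tangent_space_def)

lemma T_out: "v \<in> TS p \<Longrightarrow> f \<notin> C \<Longrightarrow> v f = 0"
  by (auto simp: tangent_space_def)

lemma T_add: "v \<in> TS p \<Longrightarrow> f \<in> C \<Longrightarrow> h \<in> C \<Longrightarrow> v (\<lambda>x. f x + h x) = v f + v h"
  using T_lin[of v p f h 1 1] by simp

lemma T_scale: "v \<in> TS p \<Longrightarrow> f \<in> C \<Longrightarrow> v (\<lambda>x. c * f x) = c * v f"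
  using T_lin[of v p f f c 0] by simp

lemma T_const:
  assumes "v \<in> TS p"
  shows "v (\<lambda>x. c) = 0"
proof -
  have "v (\<lambda>x. 1 * 1) = 1 * v (\<lambda>x. 1) + 1 * v (\<lambda>x. 1)"
    using T_mult[OF assms C_const C_const, of 1 1] by simp
  then have "v (\<lambda>x. 1) = 0" by simp
  then show ?thesis using T_scale[OF assms C_const, of c 1] by simp
qed

lemma T_sum:
  assumes "v \<in> TS p" "\<And>i. i \<in> I \<Longrightarrow> f i \<in> C"
  shows "v (\<lambda>x. \<Sum>i\<in>I. f i x) = (\<Sum>i\<in>I. v (f i))"
  using assms(2)
proof (induction I rule: infinite_finite_induct)
  case (insert i I)
  then show ?case using T_add[OF assms(1), of "f i" "\<lambda>x. \<Sum>i\<in>I. f i x"] C_sum[of I f] by simp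
qed (auto simp: T_const[OF assms(1)])

lemma T_I:
  assumes "\<And>f h a b. f \<in> C \<Longrightarrow> h \<in> C \<Longrightarrow> v (\<lambda>x. a * f x + b * h x) = a * v f + b * v h"
    "\<And>f h. f \<in> C \<Longrightarrow> h \<in> C \<Longrightarrow> v (\<lambda>x. f x * h x) = f p * v h + h p * v f"
    "\<And>f. f \<notin> C \<Longrightarrow> v f = 0"
  shows "v \<in> TS p"
  using assms by (auto simp: tangent_space_def)

lemma T_cmb: "u \<in> TS p \<Longrightarrow> v \<in> TS p \<Longrightarrow> cmbT a u b v \<in> TS p"
  unfolding cmbT_def by (rule T_I) (simp_all add: T_lin T_mult T_out algebra_simps)

lemma T_zero: "(\<lambda>f. 0) \<in> TS p"
  by (rule T_I) auto

lemma VF_T: "X \<in> VF \<Longrightarrow> X p \<in> TS p"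
  by (simp add: vector_fields_def)

lemma VF_C: "X \<in> VF \<Longrightarrow> f \<in> C \<Longrightarrow> (\<lambda>p. X p f) \<in> C"
  by (simp add: vector_fields_def)

lemma VF_I: "(\<And>p. X p \<in> TS p) \<Longrightarrow> (\<And>f. f \<in> C \<Longrightarrow> (\<lambda>p. X p f) \<in> C) \<Longrightarrow> X \<in> VF"
  by (simp add: vector_fields_def)

lemma VF_cmb:
  assumes "X \<in> VF" "Y \<in> VF" "a \<in> C" "b \<in> C"
  shows "(\<lambda>p. cmbT (a p) (X p) (b p) (Y p)) \<in> VF"
proof (rule VF_I)
  show "cmbT (a p) (X p) (b p) (Y p) \<in> TS p" for p
    by (intro T_cmb VF_T assms)
  show "(\<lambda>p. cmbT (a p) (X p) (b p) (Y p) f) \<in> C" if "f \<in> C" for f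
    unfolding cmbT_def by (intro C_add C_mult VF_C[OF assms(1) that] VF_C[OF assms(2) that] assms(3,4))
qed

lemma VF_zero: "(\<lambda>p f. 0) \<in> VF"
  by (rule VF_I) (rule T_zero C_const)+

lemma VF_sum:
  assumes "finite I" "\<And>i. i \<in> I \<Longrightarrow> a i \<in> C" "\<And>i. i \<in> I \<Longrightarrow> X i \<in> VF"
  shows "(\<lambda>p f. \<Sum>i\<in>I. a i p * X i p f) \<in> VF"
  using assms
proof (induction I rule: finite_induct)
  case (insert i I)
  have "(\<lambda>p. cmbT (a i p) (X i p) 1 (\<lambda>f. \<Sum>i\<in>I. a i p * X i p f)) \<in> VF"
    by (intro VF_cmb C_const) (use insert in auto)
  then show ?case using insert by (simp add: cmbT_def)
qed (simp add: VF_zero)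

lemma lie_bracket_VF:
  assumes X: "X \<in> VF" and Y: "Y \<in> VF"
  shows "lie_bracket X Y \<in> VF"
proof (rule VF_I)
  fix p
  show "lie_bracket X Y p \<in> TS p"
  proof (rule T_I)
    \<comment> \<open>Both fields send a non-smooth f to the constant function 0, which every
      derivation kills; the bracket thus keeps the default value 0.\<close>
    fix f assume "f \<notin> C"
    then have "(\<lambda>q. Y q f) = (\<lambda>q. 0)" "(\<lambda>q. X q f) = (\<lambda>q. 0)" using X Y T_out VF_T by blast+
    then show "lie_bracket X Y p f = 0"
      unfolding lie_bracket_def using T_const[OF VF_T[OF X]] T_const[OF VF_T[OF Y]] by simp
  next
    fix f h a b assume f: "f \<in> C" and h: "h \<in> C"
    show "lie_bracket X Y p (\<lambda>x. a * f x + b * h x) = a * lie_bracket X Y p f + b * lie_bracket X Y p h"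
      unfolding lie_bracket_def using X Y f h
      by (simp add: T_lin[OF VF_T[OF X]] T_lin[OF VF_T[OF Y]] VF_C[OF X] VF_C[OF Y] algebra_simps)
    show "lie_bracket X Y p (\<lambda>x. f x * h x) = f p * lie_bracket X Y p h + h p * lie_bracket X Y p f"
      unfolding lie_bracket_def using X Y f h
      by (simp add: T_mult[OF VF_T[OF X]] T_mult[OF VF_T[OF Y]] T_add[OF VF_T[OF X]] T_add[OF VF_T[OF Y]]
          VF_C[OF X] VF_C[OF Y] C_mult algebra_simps)
  qed
next
  fix f assume "f \<in> C"
  then show "(\<lambda>p. lie_bracket X Y p f) \<in> C"
    unfolding lie_bracket_def by (intro C_diff VF_C[OF X VF_C[OF Y]] VF_C[OF Y VF_C[OF X]])
qed

subsection \<open>Forms evaluated on vector fields\<close>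

text \<open>The Lie derivative and the exterior derivative are defined by Cartan's recursion
  \<open>\<iota>\<^sub>Y L\<^sub>X = L\<^sub>X \<iota>\<^sub>Y - \<iota>\<^bsub>[X,Y]\<^esub>\<close> and \<open>\<iota>\<^sub>X d = L\<^sub>X - d \<iota>\<^sub>X\<close>; this makes the Leibniz rule a
  plain induction on the list of arguments.\<close>

fun Lie :: "'a vfield \<Rightarrow> ('a \<Rightarrow> 'a vfield list \<Rightarrow> real) \<Rightarrow> 'a \<Rightarrow> 'a vfield list \<Rightarrow> real" where
  "Lie X w p [] = X p (\<lambda>q. w q [])"
| "Lie X w p (Y # Ys) = Lie X (\<lambda>q. ins Y (w q)) p Ys - w p (lie_bracket X Y # Ys)"

fun extd :: "('a \<Rightarrow> 'a vfield list \<Rightarrow> real) \<Rightarrow> 'a \<Rightarrow> 'a vfield list \<Rightarrow> real" where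
  "extd w p [] = 0"
| "extd w p (X # Xs) = Lie X w p Xs - extd (\<lambda>q. ins X (w q)) p Xs"

text \<open>A class closed under contraction with a field, \<open>sgnf\<close> and
  \<open>wedge\<close>, as the inductions over argument lists require.\<close>

definition smoothf :: "('a \<Rightarrow> 'a vfield list \<Rightarrow> real) \<Rightarrow> bool" where
  "smoothf w \<longleftrightarrow> (\<forall>Xs. set Xs \<subseteq> VF \<longrightarrow> (\<lambda>p. w p Xs) \<in> C)"

lemma smoothf_ins: "smoothf w \<Longrightarrow> X \<in> VF \<Longrightarrow> smoothf (\<lambda>p. ins X (w p))"
  by (simp add: smoothf_def ins_def)

lemma smoothf_sgnf: "smoothf w \<Longrightarrow> smoothf (\<lambda>p. sgnf (w p))"
  by (simp add: smoothf_def sgnf_def C_mult C_const)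

lemma smoothf_scale: "smoothf w \<Longrightarrow> smoothf (\<lambda>p Xs. c * w p Xs)"
  by (simp add: smoothf_def C_mult C_const)

lemma smoothf_add: "smoothf w \<Longrightarrow> smoothf t \<Longrightarrow> smoothf (\<lambda>p Xs. w p Xs + t p Xs)"
  by (simp add: smoothf_def C_add)

lemma smoothf_wedge:
  assumes "smoothf w" "smoothf t"
  shows "smoothf (\<lambda>p. wedge (w p) (t p))"
proof -
  have "(\<lambda>p. wedge (w p) (t p) Xs) \<in> C" if "set Xs \<subseteq> VF" for Xs
    using assms that
  proof (induction Xs arbitrary: w t)
    case Nil
    then show ?case by (simp add: smoothf_def C_mult)
  next
    case (Cons X Xs)
    then show ?case
      using Cons.IH[of "\<lambda>p. ins X (w p)" t] Cons.IH[of "\<lambda>p. sgnf (w p)" "\<lambda>p. ins X (t p)"]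
      by (simp add: C_add smoothf_ins smoothf_sgnf)
  qed
  then show ?thesis by (simp add: smoothf_def)
qed

lemma Lie_scale:
  "X \<in> VF \<Longrightarrow> smoothf w \<Longrightarrow> set Xs \<subseteq> VF \<Longrightarrow> Lie X (\<lambda>p Xs. c * w p Xs) p Xs = c * Lie X w p Xs"
proof (induction Xs arbitrary: w)
  case Nil
  then show ?case by (simp add: smoothf_def T_scale[OF VF_T[OF Nil(1)]])
next
  case (Cons Y Ys)
  have "(\<lambda>q. ins Y (\<lambda>Xs. c * w q Xs)) = (\<lambda>q Xs. c * ins Y (w q) Xs)" by (simp add: ins_def)
  then show ?case using Cons.IH[of "\<lambda>q. ins Y (w q)"] Cons.prems
    by (simp add: smoothf_ins algebra_simps)
qed

lemma Lie_add:
  "X \<in> VF \<Longrightarrow> smoothf w \<Longrightarrow> smoothf t \<Longrightarrow> set Xs \<subseteq> VF \<Longrightarrow>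
    Lie X (\<lambda>p Xs. w p Xs + t p Xs) p Xs = Lie X w p Xs + Lie X t p Xs"
proof (induction Xs arbitrary: w t)
  case Nil
  then show ?case by (simp add: smoothf_def T_add[OF VF_T[OF Nil(1)]])
next
  case (Cons Y Ys)
  have "(\<lambda>q. ins Y (\<lambda>Xs. w q Xs + t q Xs)) = (\<lambda>q Xs. ins Y (w q) Xs + ins Y (t q) Xs)" by (simp add: ins_def)
  then show ?case using Cons.IH[of "\<lambda>q. ins Y (w q)" "\<lambda>q. ins Y (t q)"] Cons.prems
    by (simp add: smoothf_ins)
qed

lemma Lie_sgnf:
  "X \<in> VF \<Longrightarrow> smoothf w \<Longrightarrow> set Xs \<subseteq> VF \<Longrightarrow> Lie X (\<lambda>p. sgnf (w p)) p Xs = sgnf (Lie X w p) Xs"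
proof (induction Xs arbitrary: w)
  case Nil
  then show ?case by (simp add: sgnf_def)
next
  case (Cons Y Ys)
  have "(\<lambda>q. ins Y (sgnf (w q))) = (\<lambda>q Xs. (- 1) * sgnf (ins Y (w q)) Xs)" by (simp add: ins_sgnf)
  then have "Lie X (\<lambda>q. ins Y (sgnf (w q))) p Ys = - Lie X (\<lambda>q. sgnf (ins Y (w q))) p Ys"
    using Lie_scale[of X "\<lambda>q. sgnf (ins Y (w q))" Ys "-1" p] Cons.prems by (simp add: smoothf_ins smoothf_sgnf)
  then show ?case using Cons.IH[of "\<lambda>q. ins Y (w q)"] Cons.prems
    by (simp add: smoothf_ins) (simp add: sgnf_def algebra_simps)
qed

lemma extd_scale:
  "smoothf w \<Longrightarrow> set Xs \<subseteq> VF \<Longrightarrow> extd (\<lambda>p Xs. c * w p Xs) p Xs = c * extd w p Xs"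
proof (induction Xs arbitrary: w)
  case (Cons Y Ys)
  have "(\<lambda>q. ins Y (\<lambda>Xs. c * w q Xs)) = (\<lambda>q Xs. c * ins Y (w q) Xs)" by (simp add: ins_def)
  then show ?case using Cons.IH[of "\<lambda>q. ins Y (w q)"] Cons.prems
    by (simp add: smoothf_ins Lie_scale algebra_simps)
qed simp

lemma extd_add:
  "smoothf w \<Longrightarrow> smoothf t \<Longrightarrow> set Xs \<subseteq> VF \<Longrightarrow>
    extd (\<lambda>p Xs. w p Xs + t p Xs) p Xs = extd w p Xs + extd t p Xs"
proof (induction Xs arbitrary: w t)
  case (Cons Y Ys)
  have "(\<lambda>q. ins Y (\<lambda>Xs. w q Xs + t q Xs)) = (\<lambda>q Xs. ins Y (w q) Xs + ins Y (t q) Xs)" by (simp add: ins_def)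
  then show ?case using Cons.IH[of "\<lambda>q. ins Y (w q)" "\<lambda>q. ins Y (t q)"] Cons.prems
    by (simp add: smoothf_ins Lie_add)
qed simp

lemma extd_sgnf:
  "smoothf w \<Longrightarrow> set Xs \<subseteq> VF \<Longrightarrow> extd (\<lambda>p. sgnf (w p)) p Xs = - sgnf (extd w p) Xs"
proof (induction Xs arbitrary: w)
  case Nil
  then show ?case by (simp add: sgnf_def)
next
  case (Cons Y Ys)
  have "(\<lambda>q. ins Y (sgnf (w q))) = (\<lambda>q Xs. (- 1) * sgnf (ins Y (w q)) Xs)" by (simp add: ins_sgnf)
  then have "extd (\<lambda>q. ins Y (sgnf (w q))) p Ys = - extd (\<lambda>q. sgnf (ins Y (w q))) p Ys"
    using extd_scale[of "\<lambda>q. sgnf (ins Y (w q))" Ys "-1" p] Cons.prems by (simp add: smoothf_ins smoothf_sgnf)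
  then show ?case using Cons.IH[of "\<lambda>q. ins Y (w q)"] Cons.prems
    by (simp add: smoothf_ins Lie_sgnf) (simp add: sgnf_def algebra_simps)
qed

lemma ins_wedge: "ins Y (wedge w t) = (\<lambda>Xs. wedge (ins Y w) t Xs + wedge (sgnf w) (ins Y t) Xs)"
  by (simp add: ins_def[of Y "wedge _ _"])

lemma ins_Lie: "ins Y (Lie X w p) = (\<lambda>Ys. Lie X (\<lambda>q. ins Y (w q)) p Ys + (- 1) * ins (lie_bracket X Y) (w p) Ys)"
  by (simp add: ins_def[of Y "Lie _ _ _"] ins_def[of "lie_bracket _ _"])

text \<open>The base case is the product rule of the derivation X p. In the step, the correction by
  the bracket [X, Y] is itself a contraction and distributes over \<open>wedge\<close> in the same
  way as the contraction with Y.\<close>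

lemma Lie_wedge:
  assumes "X \<in> VF"
  shows "smoothf w \<Longrightarrow> smoothf t \<Longrightarrow> set Xs \<subseteq> VF \<Longrightarrow>
    Lie X (\<lambda>p. wedge (w p) (t p)) p Xs = wedge (Lie X w p) (t p) Xs + wedge (w p) (Lie X t p) Xs"
proof (induction Xs arbitrary: w t)
  case Nil
  then show ?case by (simp add: smoothf_def T_mult[OF VF_T[OF assms]])
next
  case (Cons Y Ys)
  then have Y: "Y \<in> VF" "set Ys \<subseteq> VF" by auto
  note s = smoothf_ins[OF Cons.prems(1) Y(1)] smoothf_ins[OF Cons.prems(2) Y(1)] smoothf_sgnf[OF Cons.prems(1)]
  have c: "wedge (Lie X (\<lambda>q. sgnf (w q)) p) (ins Y (t p)) Ys = wedge (sgnf (Lie X w p)) (ins Y (t p)) Ys"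
    by (rule wedge_cong) (use Y in \<open>auto intro!: Lie_sgnf assms Cons.prems\<close>)
  have "Lie X (\<lambda>q. ins Y (wedge (w q) (t q))) p Ys =
      Lie X (\<lambda>q. wedge (ins Y (w q)) (t q)) p Ys + Lie X (\<lambda>q. wedge (sgnf (w q)) (ins Y (t q))) p Ys"
    unfolding ins_wedge by (rule Lie_add) (use assms s Cons.prems Y in \<open>auto intro!: smoothf_wedge\<close>)
  also have "Lie X (\<lambda>q. wedge (ins Y (w q)) (t q)) p Ys =
      wedge (Lie X (\<lambda>q. ins Y (w q)) p) (t p) Ys + wedge (ins Y (w p)) (Lie X t p) Ys"
    by (rule Cons.IH) (use s Cons.prems Y in auto)
  also have "Lie X (\<lambda>q. wedge (sgnf (w q)) (ins Y (t q))) p Ys =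
      wedge (sgnf (Lie X w p)) (ins Y (t p)) Ys + wedge (sgnf (w p)) (Lie X (\<lambda>q. ins Y (t q)) p) Ys"
    unfolding c[symmetric] by (rule Cons.IH) (use s Cons.prems Y in auto)
  finally show ?case
    by (simp add: ins_Lie wedge_add_left wedge_add_right wedge_diff_left wedge_diff_right wedge_minus_left wedge_minus_right)
qed

lemma ins_extd: "ins X (extd w p) = (\<lambda>Ys. Lie X w p Ys + (- 1) * extd (\<lambda>q. ins X (w q)) p Ys)"
  by (simp add: ins_def[of X "extd _ _"])

text \<open>Contracting with the first field Y, the recursion i_Y d = L_Y - d i_Y reduces the claim
  to \<open>Lie_wedge\<close> and the induction hypothesis; \<open>extd_sgnf\<close> provides the
  sign of the second term.\<close>

theorem extd_wedge:
  "smoothf w \<Longrightarrow> smoothf t \<Longrightarrow> set Xs \<subseteq> VF \<Longrightarrow>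
    extd (\<lambda>p. wedge (w p) (t p)) p Xs = wedge (extd w p) (t p) Xs + wedge (sgnf (w p)) (extd t p) Xs"
proof (induction Xs arbitrary: w t)
  case (Cons Y Ys)
  then have Y: "Y \<in> VF" "set Ys \<subseteq> VF" by auto
  note s = smoothf_ins[OF Cons.prems(1) Y(1)] smoothf_ins[OF Cons.prems(2) Y(1)] smoothf_sgnf[OF Cons.prems(1)]
  \<comment> \<open>\<open>closed_coord_ball\<close> is merely the bound list of fields here. The
    identity is known on lists of fields, hence the detour through
    \<open>wedge_cong\<close>.\<close>
  have c: "wedge (extd (\<lambda>q. sgnf (w q)) p) (ins Y (t p)) Ys = wedge (\<lambda>closed_coord_ball. - sgnf (extd w p) closed_coord_ball) (ins Y (t p)) Ys"
    by (rule wedge_cong) (use Y in \<open>auto intro!: extd_sgnf Cons.prems\<close>)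
  have "extd (\<lambda>q. ins Y (wedge (w q) (t q))) p Ys =
      extd (\<lambda>q. wedge (ins Y (w q)) (t q)) p Ys + extd (\<lambda>q. wedge (sgnf (w q)) (ins Y (t q))) p Ys"
    unfolding ins_wedge by (rule extd_add) (use s Cons.prems Y in \<open>auto intro!: smoothf_wedge\<close>)
  also have "extd (\<lambda>q. wedge (ins Y (w q)) (t q)) p Ys =
      wedge (extd (\<lambda>q. ins Y (w q)) p) (t p) Ys + wedge (sgnf (ins Y (w p))) (extd t p) Ys"
    by (rule Cons.IH) (use s Cons.prems Y in auto)
  also have "extd (\<lambda>q. wedge (sgnf (w q)) (ins Y (t q))) p Ys =
      wedge (\<lambda>closed_coord_ball. - sgnf (extd w p) closed_coord_ball) (ins Y (t p)) Ys + wedge (sgnf (sgnf (w p))) (extd (\<lambda>q. ins Y (t q)) p) Ys"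
    unfolding c[symmetric] by (rule Cons.IH) (use s Cons.prems Y in auto)
  finally show ?case
    by (simp add: Lie_wedge[OF Y(1) Cons.prems(1,2) Y(2)] ins_extd ins_sgnf sgnf_sgnf
        wedge_add_left wedge_add_right wedge_diff_left wedge_diff_right wedge_minus_left wedge_minus_right)
qed simp

text \<open>Alternation carries each bracket from position j to the front, which is the source of
  the sign.\<close>

lemma Lie_alternating:
  assumes "\<And>p. alt (w p)"
  shows "Lie X w p Xs = X p (\<lambda>q. w q Xs)
     - (\<Sum>j<length Xs. (- 1) ^ j * w p (lie_bracket X (Xs ! j) # omit j Xs))"
  using assms
proof (induction Xs arbitrary: w)
  case (Cons Y Ys)
  have "w p (Y # Z # closed_coord_ball) = - w p (Z # Y # closed_coord_ball)" for Z closed_coord_ball using altD[OF Cons.prems, of p "[]" Y Z closed_coord_ball] by simp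
  moreover have "Lie X (\<lambda>q. ins Y (w q)) p Ys = X p (\<lambda>q. ins Y (w q) Ys)
     - (\<Sum>j<length Ys. (- 1) ^ j * ins Y (w p) (lie_bracket X (Ys ! j) # omit j Ys))"
    by (rule Cons.IH) (rule alt_ins[OF Cons.prems])
  ultimately show ?case
    by (simp add: sum.lessThan_Suc_shift omit_def ins_def sum_negf del: sum.lessThan_Suc)
qed simp

text \<open>The link between Cartan's recursion and the invariant formula: the first field
  contributes the summand i = 0 and all brackets that contain it; the recursive term contributes the
  other summands with indices shifted by one.\<close>

lemma extd_eq_formula:
  assumes "\<And>p. alt (w p)"
  shows "extd w p Xs = (\<Sum>i<length Xs. (-1) ^ i * (Xs ! i) p (\<lambda>q. w q (omit i Xs))) +
     (\<Sum>j<length Xs. \<Sum>i<j. (-1) ^ (i + j) * w p (lie_bracket (Xs ! i) (Xs ! j) # omit i (omit j Xs)))"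
  using assms
proof (induction Xs arbitrary: w)
  case (Cons Y Ys)
  have sw: "w p (Y # Z # closed_coord_ball) = - w p (Z # Y # closed_coord_ball)" for Z closed_coord_ball using altD[OF Cons.prems, of p "[]" Y Z closed_coord_ball] by simp
  have "extd (\<lambda>q. ins Y (w q)) p Ys = (\<Sum>i<length Ys. (-1) ^ i * (Ys ! i) p (\<lambda>q. ins Y (w q) (omit i Ys))) +
     (\<Sum>j<length Ys. \<Sum>i<j. (-1) ^ (i + j) * ins Y (w p) (lie_bracket (Ys ! i) (Ys ! j) # omit i (omit j Ys)))"
    by (rule Cons.IH) (rule alt_ins[OF Cons.prems])
  then show ?case
    by (simp add: Lie_alternating[OF Cons.prems] sum.lessThan_Suc_shift omit_def ins_def sw sum_negf sum_subtractf sum.distrib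
        del: sum.lessThan_Suc)
qed simp

definition onfields :: "'a form \<Rightarrow> 'a \<Rightarrow> 'a vfield list \<Rightarrow> real" where
  "onfields w p Xs = w p (map (\<lambda>X. X p) Xs)"

lemma onfields_alt: "alt (w p) \<Longrightarrow> alt (onfields w p)"
  by (rule altI) (simp add: onfields_def, rule altD)

lemma ext_deriv_formula_extd:
  assumes "\<And>p. alt (w p)"
  shows "ext_deriv_formula w Xs p = extd (onfields w) p Xs"
  by (simp add: extd_eq_formula[OF onfields_alt[OF assms]] ext_deriv_formula_def onfields_def)

lemma onfields_wedge: "onfields (\<lambda>p. wedge (w p) (t p)) = (\<lambda>p. wedge (onfields w p) (onfields t p))"
proof (intro ext)
  fix p Xs
  show "onfields (\<lambda>p. wedge (w p) (t p)) p Xs = wedge (onfields w p) (onfields t p) Xs"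
    using wedge_map[of "w p" "\<lambda>X. X p" "t p" Xs] by (simp add: onfields_def[abs_def])
qed

lemma Lie_deg:
  assumes "\<And>p. deg k (w p)" "X \<in> VF"
  shows "length Xs \<noteq> k \<Longrightarrow> Lie X w p Xs = 0"
  using assms(1)
proof (induction Xs arbitrary: k w)
  case Nil
  then have "(\<lambda>q. w q []) = (\<lambda>q. 0)" by (auto simp: deg_def)
  then show ?case using T_const[OF VF_T[OF assms(2)]] by simp
next
  case (Cons Y Ys)
  have "Lie X (\<lambda>q. ins Y (w q)) p Ys = 0"
  proof (cases k)
    case 0
    \<comment> \<open>A contracted 0-form is zero and so has every degree; this one differs from the
      number of remaining arguments.\<close>
    then show ?thesis by (intro Cons.IH[of "Suc (length Ys)"]) (use Cons.prems in \<open>auto simp: deg_def ins_def\<close>)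
  next
    case (Suc k')
    then show ?thesis by (intro Cons.IH[of k']) (use Cons.prems in \<open>auto simp: deg_def ins_def\<close>)
  qed
  then show ?case using Cons.prems by (auto simp: deg_def)
qed

lemma extd_deg:
  assumes "\<And>p. deg k (w p)" "set Xs \<subseteq> VF"
  shows "length Xs \<noteq> Suc k \<Longrightarrow> extd w p Xs = 0"
  using assms
proof (induction Xs arbitrary: k w)
  case (Cons Y Ys)
  have "extd (\<lambda>q. ins Y (w q)) p Ys = 0"
  proof (cases k)
    case 0
    \<comment> \<open>The same choice, shifted because d raises the degree by one.\<close>
    then show ?thesis by (intro Cons.IH[of "length Ys"]) (use Cons.prems in \<open>auto simp: deg_def ins_def\<close>)
  next
    case (Suc k')
    then show ?thesis by (intro Cons.IH[of k']) (use Cons.prems in \<open>auto simp: deg_def ins_def\<close>)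
  qed
  moreover have "Lie Y w p Ys = 0" by (rule Lie_deg) (use Cons.prems in auto)
  ultimately show ?case by simp
qed simp

lemma extd_one: "set Xs \<subseteq> VF \<Longrightarrow> extd (\<lambda>q. one_form0) p Xs = 0"
proof (induction Xs)
  case (Cons X Xs)
  have s: "smoothf (\<lambda>q. one_form0)" by (simp add: smoothf_def C_const)
  have z: "(\<lambda>q. ins Y one_form0) = (\<lambda>q Ys. 0 * one_form0 Ys)" for Y :: "'a vfield" by (simp add: ins_one)
  have "Lie X (\<lambda>q. one_form0) p Xs = 0"
  proof (cases Xs)
    case Nil
    then show ?thesis using T_const[OF VF_T, of X] Cons.prems by simp
  next
    case (Cons Y Ys)
    then show ?thesis using Lie_scale[OF _ s, of X Ys 0 p] \<open>set (X # Xs) \<subseteq> VF\<close> unfolding Cons Lie.simps z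
      by (simp add: one_form0_def)
  qed
  then show ?case unfolding extd.simps z using extd_scale[OF s, of Xs 0 p] Cons.prems by simp
qed simp

subsection \<open>Differential forms\<close>

lemma diff_formsI:
  assumes "\<And>p. deg k (w p)" "\<And>p. supp (TS p) (w p)" "\<And>p. mlin cmbT (TS p) (w p)" "\<And>p. alt (w p)"
    "smoothf (onfields w)"
  shows "w \<in> diff_forms A k"
  unfolding diff_forms_def
proof (intro CollectI conjI allI impI ballI)
  fix p vs assume "\<not> (length vs = k \<and> set vs \<subseteq> TS p)"
  then show "w p vs = 0" using assms(1,2)[of p] by (auto simp: deg_def supp_def)
next
  fix p vs i u v a b
  assume vs: "length vs = k \<and> set vs \<subseteq> TS p" and i: "i < k" and uv: "u \<in> TS p" "v \<in> TS p"
  have "set (take i vs) \<subseteq> TS p" "set (drop (Suc i) vs) \<subseteq> TS p"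
    using vs by (meson set_take_subset set_drop_subset order_trans)+
  from mlinD[OF assms(3) this uv, of a b]
  show "w p (vs[i := (\<lambda>f. a * u f + b * v f)]) = a * w p (vs[i := u]) + b * w p (vs[i := v])"
    using vs i by (simp add: upd_conv_take_nth_drop cmbT_def)
next
  fix p vs i j assume "length vs = k \<and> set vs \<subseteq> TS p" "i < k" "j < k" "i \<noteq> j \<and> vs ! i = vs ! j"
  then have "\<not> distinct vs" by (auto simp: distinct_conv_nth)
  then show "w p vs = 0" using alt_not_distinct[OF assms(4)] by blast
next
  fix Xs assume "length Xs = k \<and> set Xs \<subseteq> VF"
  then show "(\<lambda>p. w p (map (\<lambda>X. X p) Xs)) \<in> C" using assms(5) by (simp add: smoothf_def onfields_def)
qed

lemma diff_formsD:
  assumes "w \<in> diff_forms A k"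
  shows "deg k (w p)" "supp (TS p) (w p)" "mlin cmbT (TS p) (w p)" "alt (w p)" "smoothf (onfields w)"
proof -
  have z: "\<not> (length vs = k \<and> set vs \<subseteq> TS p) \<Longrightarrow> w p vs = 0" for vs p
    using assms by (simp add: diff_forms_def)
  have l: "length vs = k \<Longrightarrow> set vs \<subseteq> TS p \<Longrightarrow> i < k \<Longrightarrow> u \<in> TS p \<Longrightarrow> v \<in> TS p \<Longrightarrow>
      w p (vs[i := (\<lambda>f. a * u f + b * v f)]) = a * w p (vs[i := u]) + b * w p (vs[i := v])" for vs p i u v a b
    using assms by (simp add: diff_forms_def)
  have r: "length vs = k \<Longrightarrow> set vs \<subseteq> TS p \<Longrightarrow> i < k \<Longrightarrow> j < k \<Longrightarrow> i \<noteq> j \<Longrightarrow> vs ! i = vs ! j \<Longrightarrow> w p vs = 0" for vs p i j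
    using assms by (simp add: diff_forms_def)
  show d: "deg k (w p)" and "supp (TS p) (w p)" using z by (auto simp: deg_def supp_def)
  show m: "mlin cmbT (TS p) (w p)"
  proof (rule mlinI)
    fix xs ys u v a b
    assume a: "set xs \<subseteq> TS p" "set ys \<subseteq> TS p" "u \<in> TS p" "v \<in> TS p"
    show "w p (xs @ cmbT a u b v # ys) = a * w p (xs @ u # ys) + b * w p (xs @ v # ys)"
    proof (cases "Suc (length xs + length ys) = k")
      case True
      then show ?thesis using l[of "xs @ u # ys" p "length xs" u v a b] a by (simp add: cmbT_def)
    next
      case False
      then show ?thesis using d by (simp add: deg_def)
    qed
  qed
  show "alt (w p)"
  proof (rule altI)
    fix xs y z' ys
    show "w p (xs @ y # z' # ys) = - w p (xs @ z' # y # ys)"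
    proof (cases "length (xs @ y # z' # ys) = k \<and> set (xs @ y # z' # ys) \<subseteq> TS p")
      case True
      then have a: "set xs \<subseteq> TS p" "set ys \<subseteq> TS p" "y \<in> TS p" "z' \<in> TS p" by auto
      \<comment> \<open>Polarisation: expanding the form with y + z' in both places turns vanishing
        on repeated entries into skewness.\<close>
      define s where "s = cmbT 1 y 1 z'"
      have s: "s \<in> TS p" unfolding s_def using a by (intro T_cmb)
      have rr: "w p (xs @ x # x # ys) = 0" if "x \<in> TS p" for x
        by (rule r[of _ _ "length xs" "Suc (length xs)"]) (use True a that in \<open>auto simp: nth_append\<close>)
      have "0 = w p (xs @ s # s # ys)" using rr[OF s] by simp
      also have "\<dots> = w p (xs @ y # s # ys) + w p (xs @ z' # s # ys)"
        using mlinD[OF m, of xs "s # ys" y z' 1 1] a s by (simp add: s_def)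
      also have "w p (xs @ y # s # ys) = w p (xs @ y # y # ys) + w p (xs @ y # z' # ys)"
        using mlinD[OF m, of "xs @ [y]" ys y z' 1 1] a by (simp add: s_def)
      also have "w p (xs @ z' # s # ys) = w p (xs @ z' # y # ys) + w p (xs @ z' # z' # ys)"
        using mlinD[OF m, of "xs @ [z']" ys y z' 1 1] a by (simp add: s_def)
      finally show ?thesis using rr a by simp
    next
      case False
      then have "w p (xs @ y # z' # ys) = 0" "w p (xs @ z' # y # ys) = 0"
        by (intro z; auto)+
      then show ?thesis by simp
    qed
  qed
  show "smoothf (onfields w)"
    unfolding smoothf_def onfields_def
  proof (intro allI impI)
    fix Xs assume Xs: "set Xs \<subseteq> VF"
    show "(\<lambda>p. w p (map (\<lambda>X. X p) Xs)) \<in> C"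
    proof (cases "length Xs = k")
      case True
      then show ?thesis using assms Xs by (simp add: diff_forms_def)
    next
      case False
      then have "(\<lambda>p. w p (map (\<lambda>X. X p) Xs)) = (\<lambda>p. 0)" by (intro ext z) simp
      then show ?thesis by (simp add: C_const)
    qed
  qed
qed

lemma diff_forms_wedge:
  assumes "w \<in> diff_forms A j" "t \<in> diff_forms A k"
  shows "(\<lambda>p. wedge (w p) (t p)) \<in> diff_forms A (j + k)"
  by (rule diff_formsI)
    (auto simp: onfields_wedge intro!: deg_wedge supp_wedge mlin_wedge alt_wedge smoothf_wedge
      diff_formsD[OF assms(1)] diff_formsD[OF assms(2)])

lemma diff_forms_one: "(\<lambda>p. one_form0) \<in> diff_forms A 0"
  by (rule diff_formsI)
    (auto simp: deg_def supp_def mlin_one alt_one smoothf_def onfields_def,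
      auto simp: one_form0_def C_const split: if_splits)

text \<open>On lists of the wrong length both sides vanish by degree. The relation can therefore be
  used on all lists of fields, as the product rule demands.\<close>

lemma is_ext_deriv_iff:
  "is_ext_deriv A k w t \<longleftrightarrow> w \<in> diff_forms A k \<and> t \<in> diff_forms A (Suc k) \<and>
     (\<forall>p Xs. set Xs \<subseteq> VF \<longrightarrow> onfields t p Xs = extd (onfields w) p Xs)" (is "_ \<longleftrightarrow> ?R")
proof -
  have e: "ext_deriv_formula w Xs p = extd (onfields w) p Xs" if "w \<in> diff_forms A k" for Xs p
    by (rule ext_deriv_formula_extd) (rule diff_formsD[OF that])
  have z: "onfields t p Xs = extd (onfields w) p Xs"
    if "w \<in> diff_forms A k" "t \<in> diff_forms A (Suc k)" "length Xs \<noteq> Suc k" "set Xs \<subseteq> VF" for p Xs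
  proof -
    have "deg k (onfields w p)" for p using diff_formsD(1)[OF that(1), of p] by (simp add: deg_def onfields_def)
    from extd_deg[OF this that(4) that(3)] have "extd (onfields w) p Xs = 0" .
    moreover have "onfields t p Xs = 0" using diff_formsD(1)[OF that(2), of p] that(3) by (simp add: deg_def onfields_def)
    ultimately show ?thesis by simp
  qed
  show ?thesis
    unfolding is_ext_deriv_def using e z by (auto simp: onfields_def) metis
qed

end

section \<open>Charts, cut-offs and coordinate frames\<close>

context smooth_mfd
begin

lemma chart_homeo:
  assumes "(U, \<psi>) \<in> A"
  shows "inj_on \<psi> U" "continuous_on U \<psi>" "continuous_on (\<psi> ` U) (inv_into U \<psi>)"
    "q \<in> U \<Longrightarrow> inv_into U \<psi> (\<psi> q) = q"
proof -
  have h: "homeomorphism U (\<psi> ` U) \<psi> (inv_into U \<psi>)"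
    using mfd assms by (auto simp: smooth_manifold_def is_chart_def)
  then show "inj_on \<psi> U" "continuous_on U \<psi>" "continuous_on (\<psi> ` U) (inv_into U \<psi>)"
    by (auto simp: homeomorphism_def intro: inj_on_inverseI)
  then show "q \<in> U \<Longrightarrow> inv_into U \<psi> (\<psi> q) = q" by simp
qed

lemma chart_image_open:
  assumes "(U, \<psi>) \<in> A" "open W" "W \<subseteq> U"
  shows "open (\<psi> ` W)"
proof -
  have "\<psi> ` W = \<psi> ` U \<inter> inv_into U \<psi> -` W"
    using assms(3) chart_homeo(4)[OF assms(1)] by force
  then show ?thesis
    using continuous_open_preimage[OF chart_homeo(3)[OF assms(1)] chart_open(2)[OF assms(1)] assms(2)] by simp
qed

lemma chart_preimage_open:
  assumes "(U, \<psi>) \<in> A" "open T"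
  shows "open {q \<in> U. \<psi> q \<in> T}"
proof -
  have "{q \<in> U. \<psi> q \<in> T} = U \<inter> \<psi> -` T" by auto
  then show ?thesis using continuous_open_preimage[OF chart_homeo(2) chart_open(1)] assms by metis
qed

lemma chart_transition:
  assumes "(U, \<psi>) \<in> A" "(V, \<theta>) \<in> A"
  shows "smooth_on (\<psi> ` (U \<inter> V)) (\<lambda>x. \<theta> (inv_into U \<psi> x))"
proof -
  have "smooth_on (\<psi> ` (U \<inter> V)) (\<theta> \<circ> inv_into U \<psi>)"
    using mfd assms unfolding smooth_manifold_def by fast
  then show ?thesis by (simp add: o_def)
qed

lemma chart_preimage_compact:
  assumes "(U, \<psi>) \<in> A" "compact K" "K \<subseteq> \<psi> ` U"
  shows "compact {q \<in> U. \<psi> q \<in> K}"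
proof -
  have "{q \<in> U. \<psi> q \<in> K} = inv_into U \<psi> ` K"
    using assms(3) chart_homeo(4)[OF assms(1)] by force
  then show ?thesis using compact_continuous_image continuous_on_subset chart_homeo(3)[OF assms(1)] assms by metis
qed

text \<open>Each point has a neighbourhood either over T, where a transition map gives smoothness,
  or off the part of the chart over K, where u is 0. The latter region is open because compact
  subsets of a Hausdorff space are closed.\<close>

lemma C_extend:
  assumes chart: "(U, \<psi>) \<in> A" and T: "open T" "T \<subseteq> \<psi> ` U" and K: "compact K" "K \<subseteq> T"
    and u: "smooth_on T (\<lambda>x. u (inv_into U \<psi> x))" and z: "\<And>q. \<not> (q \<in> U \<and> \<psi> q \<in> K) \<Longrightarrow> u q = 0"
  shows "u \<in> C"
proof (rule C_I)
  fix V \<theta> assume V: "(V, \<theta>) \<in> A"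
  let ?W = "{q \<in> U. \<psi> q \<in> T}" and ?K = "{q \<in> U. \<psi> q \<in> K}"
  have W: "open ?W" by (rule chart_preimage_open[OF chart T(1)])
  have K': "closed ?K" by (rule compact_imp_closed, rule chart_preimage_compact) (use chart K T in auto)
  show "smooth_on (\<theta> ` V) (\<lambda>x. u (inv_into V \<theta> x))"
  proof (rule smooth_on_local)
    fix x assume "x \<in> \<theta> ` V"
    then obtain q where q: "q \<in> V" "x = \<theta> q" by auto
    show "\<exists>S. open S \<and> x \<in> S \<and> smooth_on S (\<lambda>x. u (inv_into V \<theta> x))"
    proof (cases "q \<in> ?W")
      case True
      let ?S = "\<theta> ` (V \<inter> ?W)"
      have S: "open ?S" by (rule chart_image_open[OF V]) (use W chart_open(1)[OF V] in auto)
      have "smooth_on ?S (\<lambda>y. (\<lambda>x. u (inv_into U \<psi> x)) (\<psi> (inv_into V \<theta> y)))"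
      proof (rule smooth_on_compose[OF S T(1) _ _ u])
        show "(\<lambda>y. \<psi> (inv_into V \<theta> y)) ` ?S \<subseteq> T" using chart_homeo(4)[OF V] by auto
        show "smooth_on ?S (\<lambda>y. \<psi> (inv_into V \<theta> y))"
          by (rule smooth_on_subset[OF chart_transition[OF V chart]]) auto
      qed
      then have "smooth_on ?S (\<lambda>y. u (inv_into V \<theta> y))"
        by (rule smooth_on_cong[THEN iffD1, rotated 2])
          (use S chart_homeo(4)[OF V] chart_homeo(4)[OF chart] in auto)
      then show ?thesis using S q True by blast
    next
      case False
      let ?S = "\<theta> ` (V - ?K)"
      have S: "open ?S" by (rule chart_image_open[OF V]) (use K' chart_open(1)[OF V] in auto)
      have "smooth_on ?S (\<lambda>y. 0 :: real)" by (rule smooth_on_const)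
      then have "smooth_on ?S (\<lambda>y. u (inv_into V \<theta> y))"
      proof (rule smooth_on_cong[THEN iffD1, rotated 2])
        fix y assume "y \<in> ?S"
        then have "u (inv_into V \<theta> y) = 0" using chart_homeo(4)[OF V] by (intro z) auto
        then show "0 = u (inv_into V \<theta> y)" by simp
      qed (rule S)
      moreover have "q \<notin> ?K" using False K(2) by auto
      ultimately show ?thesis using S q by blast
    qed
  qed
qed

lemma cutoff_exists:
  assumes chart: "(U, \<psi>) \<in> A" and r: "0 < r" "r < R" "cball c R \<subseteq> \<psi> ` U"
  shows "\<exists>\<kappa>\<in>C. (\<forall>q. 0 \<le> \<kappa> q) \<and> (\<forall>q\<in>U. dist c (\<psi> q) \<le> r \<longrightarrow> \<kappa> q = 1) \<and>
    (\<forall>q. \<not> (q \<in> U \<and> dist c (\<psi> q) < R) \<longrightarrow> \<kappa> q = 0)"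
proof -
  obtain \<beta> :: "'e \<Rightarrow> real" where b: "smooth_on UNIV \<beta>" "\<And>x. 0 \<le> \<beta> x"
    "\<And>x. dist c x \<le> r \<Longrightarrow> \<beta> x = 1" "\<And>x. dist c x \<ge> R \<Longrightarrow> \<beta> x = 0"
    using plateau[OF r(1,2)] by metis
  define \<kappa> where "\<kappa> = (\<lambda>q. if q \<in> U then \<beta> (\<psi> q) else 0)"
  have "smooth_on (\<psi> ` U) (\<lambda>x. \<kappa> (inv_into U \<psi> x))"
  proof (rule smooth_on_cong[THEN iffD1, OF chart_open(2)[OF chart]])
    show "smooth_on (\<psi> ` U) \<beta>" using b(1) smooth_on_subset by blast
  qed (auto simp: \<kappa>_def chart_homeo(4)[OF chart])
  then have "\<kappa> \<in> C"
    by (rule C_extend[OF chart chart_open(2)[OF chart] subset_refl compact_cball r(3)])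
      (use b(4) in \<open>auto simp: \<kappa>_def\<close>)
  then show ?thesis by (intro bexI[of _ \<kappa>]) (use b in \<open>auto simp: \<kappa>_def not_less\<close>)
qed

text \<open>Around the centre \<open>c\<close> the cut-off \<open>\<kappa>\<close> is 1 up to radius \<open>2r\<close> and 0 from radius \<open>3r\<close> on; the coordinate
  fields \<open>fld\<close> below are therefore global fields which are the genuine \<open>\<partial>\<^sub>v\<close> up to radius \<open>2r\<close>.\<close>

definition frame :: "'a set \<Rightarrow> ('a \<Rightarrow> 'e) \<Rightarrow> 'e \<Rightarrow> real \<Rightarrow> ('a \<Rightarrow> real) \<Rightarrow> bool" where
  "frame U \<psi> c r \<kappa> \<longleftrightarrow> (U, \<psi>) \<in> A \<and> 0 < r \<and> cball c (4 * r) \<subseteq> \<psi> ` U \<and> \<kappa> \<in> C \<and>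
     (\<forall>q\<in>U. dist c (\<psi> q) \<le> 2 * r \<longrightarrow> \<kappa> q = 1) \<and> (\<forall>q. \<not> (q \<in> U \<and> dist c (\<psi> q) < 3 * r) \<longrightarrow> \<kappa> q = 0)"

definition coord_ball :: "'a set \<Rightarrow> ('a \<Rightarrow> 'e) \<Rightarrow> 'e \<Rightarrow> real \<Rightarrow> 'a set" where
  "coord_ball U \<psi> c s = {q \<in> U. dist c (\<psi> q) < s}"

definition fld :: "'a set \<Rightarrow> ('a \<Rightarrow> 'e) \<Rightarrow> ('a \<Rightarrow> real) \<Rightarrow> 'e \<Rightarrow> 'a vfield" where
  "fld U \<psi> \<kappa> v = (\<lambda>q f. if f \<in> C \<and> q \<in> U
     then \<kappa> q * frechet_derivative (\<lambda>x. f (inv_into U \<psi> x)) (at (\<psi> q)) v else 0)"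

definition crd :: "'a set \<Rightarrow> ('a \<Rightarrow> 'e) \<Rightarrow> ('a \<Rightarrow> real) \<Rightarrow> 'e \<Rightarrow> 'a \<Rightarrow> real" where
  "crd U \<psi> \<kappa> b = (\<lambda>q. if q \<in> U then \<kappa> q * (\<psi> q \<bullet> b) else 0)"

lemma frame_exists: "\<exists>U \<psi> r \<kappa>. p \<in> U \<and> frame U \<psi> (\<psi> p) r \<kappa>"
proof -
  have "p \<in> (\<Union>(U, \<psi>)\<in>A. U)" using mfd by (simp add: smooth_manifold_def)
  then obtain U \<psi> where U: "(U, \<psi>) \<in> A" "p \<in> U" by auto
  then obtain R where R: "R > 0" "cball (\<psi> p) R \<subseteq> \<psi> ` U"
    using chart_open(2)[OF U(1)] open_contains_cball by blast
  define r where "r = R / 4"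
  have "cball (\<psi> p) (3 * r) \<subseteq> cball (\<psi> p) R" by (rule subset_cball) (use R in \<open>simp add: r_def\<close>)
  then have "\<exists>\<kappa>\<in>C. (\<forall>q. 0 \<le> \<kappa> q) \<and> (\<forall>q\<in>U. dist (\<psi> p) (\<psi> q) \<le> 2 * r \<longrightarrow> \<kappa> q = 1) \<and>
    (\<forall>q. \<not> (q \<in> U \<and> dist (\<psi> p) (\<psi> q) < 3 * r) \<longrightarrow> \<kappa> q = 0)"
    by (intro cutoff_exists U) (use R in \<open>auto simp: r_def\<close>)
  then have "\<exists>\<kappa>. frame U \<psi> (\<psi> p) r \<kappa>" using U R by (auto simp: frame_def r_def)
  then show ?thesis using U by blast
qed

context
  fixes U \<psi> c r \<kappa>
  assumes fr: "frame U \<psi> c r \<kappa>"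
begin

lemma fr_chart: "(U, \<psi>) \<in> A" and fr_r: "0 < r" and fr_sub: "cball c (4 * r) \<subseteq> \<psi> ` U" and fr_C: "\<kappa> \<in> C"
  and fr_1: "q \<in> U \<Longrightarrow> dist c (\<psi> q) \<le> 2 * r \<Longrightarrow> \<kappa> q = 1"
  and fr_0: "\<not> (q \<in> U \<and> dist c (\<psi> q) < 3 * r) \<Longrightarrow> \<kappa> q = 0"
  using fr by (auto simp: frame_def)

abbreviation (input) "core \<equiv> coord_ball U \<psi> c (2 * r)"

lemma coord_ball_open: "open (coord_ball U \<psi> c s)"
  using chart_preimage_open[OF fr_chart open_ball[of c s]] by (simp add: coord_ball_def)

lemma core_1: "q \<in> core \<Longrightarrow> \<kappa> q = 1" "q \<in> core \<Longrightarrow> q \<in> U"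
  using fr_1 by (auto simp: coord_ball_def)

lemma fr_inv: "q \<in> U \<Longrightarrow> inv_into U \<psi> (\<psi> q) = q"
  by (rule chart_homeo(4)[OF fr_chart])

lemma inv_ball: "x \<in> cball c (4 * r) \<Longrightarrow> inv_into U \<psi> x \<in> U \<and> \<psi> (inv_into U \<psi> x) = x"
  using fr_sub by (meson f_inv_into_f inv_into_into subsetD)

lemma fr_dv: "f \<in> C \<Longrightarrow> q \<in> U \<Longrightarrow>
    ((\<lambda>x. f (inv_into U \<psi> x)) has_derivative frechet_derivative (\<lambda>x. f (inv_into U \<psi> x)) (at (\<psi> q))) (at (\<psi> q))"
  using smooth_on_has_derivative[OF C_D[OF _ fr_chart]] by blast

lemma fr_extend:
  assumes "smooth_on (ball c (4 * r)) (\<lambda>x. u (inv_into U \<psi> x))" "\<And>q. \<not> (q \<in> U \<and> dist c (\<psi> q) < 3 * r) \<Longrightarrow> u q = 0"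
  shows "u \<in> C"
  by (rule C_extend[OF fr_chart open_ball[of c "4 * r"] _ compact_cball[of c "3 * r"] _ assms(1)])
    (use fr_sub fr_r assms(2) in \<open>auto simp: not_less\<close>)

lemma C_smooth_ball: "f \<in> C \<Longrightarrow> smooth_on (ball c (4 * r)) (\<lambda>x. f (inv_into U \<psi> x))"
  by (rule smooth_on_subset[OF C_D[OF _ fr_chart]], assumption, rule order_trans[OF ball_subset_cball fr_sub])

lemma cut_C:
  assumes "smooth_on (ball c (4 * r)) h"
  shows "(\<lambda>q. if q \<in> U then \<kappa> q * h (\<psi> q) else 0) \<in> C"
proof (rule fr_extend)
  have "smooth_on (ball c (4 * r)) (\<lambda>x. \<kappa> (inv_into U \<psi> x) * h x)"
    by (intro smooth_on_mult open_ball assms C_smooth_ball fr_C)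
  then show "smooth_on (ball c (4 * r)) (\<lambda>x. if inv_into U \<psi> x \<in> U then \<kappa> (inv_into U \<psi> x) * h (\<psi> (inv_into U \<psi> x)) else 0)"
    by (rule smooth_on_cong[THEN iffD1, rotated 2]) (use inv_ball in auto)
qed (use fr_0 in auto)

lemma crd_C: "crd U \<psi> \<kappa> b \<in> C"
  unfolding crd_def by (rule cut_C) (rule smooth_on_bounded_linear[OF bounded_linear_inner_left])

lemma fld_VF: "fld U \<psi> \<kappa> v \<in> VF"
proof (rule VF_I)
  fix p
  show "fld U \<psi> \<kappa> v p \<in> TS p"
  proof (rule T_I)
    fix f h a b assume f: "f \<in> C" "h \<in> C"
    have c1: "(\<lambda>x. a * f x + b * h x) \<in> C" "(\<lambda>x. f x * h x) \<in> C" by (intro C_add C_mult C_const f)+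
    show "fld U \<psi> \<kappa> v p (\<lambda>x. a * f x + b * h x) = a * fld U \<psi> \<kappa> v p f + b * fld U \<psi> \<kappa> v p h"
    proof (cases "p \<in> U")
      case True
      have "((\<lambda>x. a * f (inv_into U \<psi> x) + b * h (inv_into U \<psi> x)) has_derivative
        (\<lambda>v. a * frechet_derivative (\<lambda>x. f (inv_into U \<psi> x)) (at (\<psi> p)) v
           + b * frechet_derivative (\<lambda>x. h (inv_into U \<psi> x)) (at (\<psi> p)) v)) (at (\<psi> p))"
        by (intro has_derivative_add has_derivative_mult_right fr_dv f True)
      from frechet_derivative_at[OF this, symmetric] show ?thesis
        using f c1 True by (simp add: fld_def algebra_simps)
    qed (simp add: fld_def)
    show "fld U \<psi> \<kappa> v p (\<lambda>x. f x * h x) = f p * fld U \<psi> \<kappa> v p h + h p * fld U \<psi> \<kappa> v p f"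
    proof (cases "p \<in> U")
      case True
      from frechet_derivative_at[OF has_derivative_mult[OF fr_dv[OF f(1) True] fr_dv[OF f(2) True]], symmetric]
      show ?thesis using f c1 True by (simp add: fld_def algebra_simps fr_inv)
    qed (simp add: fld_def)
  qed (simp add: fld_def)
next
  fix f assume f: "f \<in> C"
  have "(\<lambda>q. if q \<in> U then \<kappa> q * frechet_derivative (\<lambda>x. f (inv_into U \<psi> x)) (at (\<psi> q)) v else 0) \<in> C"
    by (rule cut_C[where h = "\<lambda>y. frechet_derivative (\<lambda>x. f (inv_into U \<psi> x)) (at y) v"])
      (rule smooth_on_derivative[OF C_smooth_ball[OF f]])
  then show "(\<lambda>p. fld U \<psi> \<kappa> v p f) \<in> C" using f by (simp add: fld_def cong: if_cong)
qed

lemma fld_lin: "fld U \<psi> \<kappa> (a *\<^sub>R v + b *\<^sub>R w) q = cmbT a (fld U \<psi> \<kappa> v q) b (fld U \<psi> \<kappa> w q)"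
proof (rule ext)
  fix f
  show "fld U \<psi> \<kappa> (a *\<^sub>R v + b *\<^sub>R w) q f = cmbT a (fld U \<psi> \<kappa> v q) b (fld U \<psi> \<kappa> w q) f"
  proof (cases "f \<in> C \<and> q \<in> U")
    case True
    then have "linear (frechet_derivative (\<lambda>x. f (inv_into U \<psi> x)) (at (\<psi> q)))"
      using fr_dv has_derivative_linear by blast
    then show ?thesis by (simp add: fld_def cmbT_def linear_add linear_cmul algebra_simps)
  qed (auto simp: fld_def cmbT_def)
qed

text \<open>The germ at q determines the value, so on the core a cut-off function may be
  differentiated as if the cut-off were absent.\<close>

lemma fld_local:
  assumes q: "q \<in> core" and f: "f \<in> C" and S: "open S" "q \<in> S" "S \<subseteq> core"
    and h: "\<And>y. y \<in> S \<Longrightarrow> f y = h (\<psi> y)" and D: "(h has_derivative D) (at (\<psi> q))"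
  shows "fld U \<psi> \<kappa> v q f = D v"
proof -
  have T: "open (\<psi> ` S)" using chart_image_open[OF fr_chart S(1)] S(3) by (auto simp: coord_ball_def)
  have "((\<lambda>x. f (inv_into U \<psi> x)) has_derivative D) (at (\<psi> q))"
    by (rule has_derivative_transform_within_open[OF D T])
      (use S h fr_inv in \<open>auto simp: coord_ball_def subset_iff\<close>)
  then have "frechet_derivative (\<lambda>x. f (inv_into U \<psi> x)) (at (\<psi> q)) = D"
    using frechet_derivative_at by metis
  then show ?thesis using f q core_1 by (simp add: fld_def)
qed

lemma fld_crd:
  assumes "q \<in> core"
  shows "fld U \<psi> \<kappa> v q (crd U \<psi> \<kappa> b) = v \<bullet> b"
  by (rule fld_local[where h = "\<lambda>x. x \<bullet> b" and S = core])
    (use assms coord_ball_open core_1 crd_C in \<open>auto simp: crd_def intro!: bounded_linear_imp_has_derivative bounded_linear_inner_left\<close>)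

lemma fld_inj: "q \<in> core \<Longrightarrow> fld U \<psi> \<kappa> v q = fld U \<psi> \<kappa> w q \<Longrightarrow> v = w"
  by (metis euclidean_eqI fld_crd)

definition comps :: "'a tvec \<Rightarrow> 'e" where
  "comps v = (\<Sum>b\<in>Basis. v (crd U \<psi> \<kappa> b) *\<^sub>R b)"

text \<open>The classical argument that a point derivation is a partial derivative: Hadamard's lemma
  writes f - f(q) as a sum of products with a first factor vanishing at q, and the product rule
  leaves only the values of v on coordinate functions.\<close>

lemma fld_span:
  assumes q: "q \<in> core" and v: "v \<in> TS q"
  shows "v = fld U \<psi> \<kappa> (comps v) q"
proof -
  note q1 = core_1[OF q]
  \<comment> \<open>The coordinate centred at q times the cut-off, hence a global smooth function
    vanishing at q.\<close>
  let ?y = "\<lambda>b q'. crd U \<psi> \<kappa> b q' - (\<psi> q \<bullet> b) * \<kappa> q'"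
  have y: "?y b \<in> C" for b by (intro C_diff C_mult C_const crd_C fr_C)
  have main: "v f = (\<Sum>b\<in>Basis. frechet_derivative (\<lambda>x. f (inv_into U \<psi> x)) (at (\<psi> q)) b * v (?y b))" if f: "f \<in> C" for f
  proof -
    have qb: "\<psi> q \<in> ball c (4 * r)" using q fr_r by (simp add: coord_ball_def)
    obtain h where h: "\<And>b. smooth_on (ball c (4 * r)) (h b)"
      "\<And>x. x \<in> ball c (4 * r) \<Longrightarrow> f (inv_into U \<psi> x) = f (inv_into U \<psi> (\<psi> q)) + (\<Sum>b\<in>Basis. ((x - \<psi> q) \<bullet> b) * h b x)"
      "\<And>b. h b (\<psi> q) = frechet_derivative (\<lambda>x. f (inv_into U \<psi> x)) (at (\<psi> q)) b"
      using Hadamard[OF open_ball convex_ball qb C_smooth_ball[OF f]] by blast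
    define g where "g = (\<lambda>b q'. if q' \<in> U then \<kappa> q' * h b (\<psi> q') else 0)"
    have g: "g b \<in> C" for b unfolding g_def by (rule cut_C[OF h(1)])
    \<comment> \<open>The cut-off enters squared because \<open>?y b\<close> and \<open>g b\<close>
      each contain one factor. Multiplying f - f(q) by the square does not alter its derivative at
      q, where the cut-off is 1 and f - f(q) is 0.\<close>
    have "(\<kappa> q' * \<kappa> q') * (f q' - f q) = (\<Sum>b\<in>Basis. ?y b q' * g b q')" for q'
    proof (cases "q' \<in> U \<and> dist c (\<psi> q') < 3 * r")
      case True
      then have "\<psi> q' \<in> ball c (4 * r)" using fr_r by simp
      from h(2)[OF this] have "f q' - f q = (\<Sum>b\<in>Basis. ((\<psi> q' - \<psi> q) \<bullet> b) * h b (\<psi> q'))"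
        using True fr_inv q1 by simp
      then show ?thesis using True by (simp add: g_def crd_def sum_distrib_left algebra_simps inner_diff_left)
    next
      case False
      then have "\<kappa> q' = 0" "g b q' = 0" for b using fr_0[OF False] by (auto simp: g_def)
      then show ?thesis by simp
    qed
    then have "(\<lambda>q'. (\<kappa> q' * \<kappa> q') * (f q' - f q)) = (\<lambda>q'. \<Sum>b\<in>Basis. ?y b q' * g b q')" by auto
    moreover have "v (\<lambda>q'. (\<kappa> q' * \<kappa> q') * (f q' - f q)) = v f"
    proof -
      have "v (\<lambda>q'. (\<kappa> q' * \<kappa> q') * (f q' - f q)) = v (\<lambda>q'. f q' - f q)"
        using T_mult[OF v C_mult[OF fr_C fr_C] C_diff[OF f C_const], of "f q"] q1 by simp
      also have "\<dots> = v f" using T_add[OF v f C_const, of "- f q"] T_const[OF v] by simp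
      finally show ?thesis .
    qed
    moreover have "v (\<lambda>q'. \<Sum>b\<in>Basis. ?y b q' * g b q') = (\<Sum>b\<in>Basis. ?y b q * v (g b) + g b q * v (?y b))"
      using T_sum[OF v, of Basis "\<lambda>b q'. ?y b q' * g b q'"] T_mult[OF v y g] C_mult[OF y g] by simp
    moreover have "?y b q = 0" "g b q = frechet_derivative (\<lambda>x. f (inv_into U \<psi> x)) (at (\<psi> q)) b" for b
      using q1 h(3) by (auto simp: crd_def g_def)
    ultimately show ?thesis by simp
  qed
  \<comment> \<open>The cut-off is constant near q, so the centring term of \<open>?y\<close>
    contributes nothing.\<close>
  have k: "v \<kappa> = 0"
  proof -
    have "((\<lambda>x. \<kappa> (inv_into U \<psi> x)) has_derivative (\<lambda>v. 0)) (at (\<psi> q))"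
    proof (rule has_derivative_transform_within_open[where f = "\<lambda>x. 1"])
      show "open (\<psi> ` core)" by (rule chart_image_open[OF fr_chart coord_ball_open]) (auto simp: coord_ball_def)
    qed (use q core_1 fr_inv in auto)
    then have "frechet_derivative (\<lambda>x. \<kappa> (inv_into U \<psi> x)) (at (\<psi> q)) = (\<lambda>v. 0)"
      using frechet_derivative_at by metis
    then show ?thesis using main[OF fr_C] by simp
  qed
  have vy: "v (?y b) = v (crd U \<psi> \<kappa> b)" for b
    using T_lin[OF v crd_C fr_C, where a = 1 and b = "- (\<psi> q \<bullet> b)"] k by simp
  show ?thesis
  proof (rule ext)
    fix f
    show "v f = fld U \<psi> \<kappa> (comps v) q f"
    proof (cases "f \<in> C")
      case True
      then have l: "linear (frechet_derivative (\<lambda>x. f (inv_into U \<psi> x)) (at (\<psi> q)))"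
        using fr_dv q1 has_derivative_linear by blast
      show ?thesis unfolding main[OF True] vy using True q1
        by (simp add: fld_def comps_def linear_sum[OF l] linear_cmul[OF l] mult.commute)
    qed (simp add: fld_def T_out[OF v])
  qed
qed

text \<open>The bracket is a derivation annihilating the coordinate functions, hence zero; symmetry of second
  derivatives is not needed.\<close>
lemma fld_bracket:
  assumes q: "q \<in> core"
  shows "lie_bracket (fld U \<psi> \<kappa> v) (fld U \<psi> \<kappa> w) q = (\<lambda>f. 0)"
proof -
  have z: "fld U \<psi> \<kappa> v q (\<lambda>q'. fld U \<psi> \<kappa> w q' (crd U \<psi> \<kappa> b)) = 0" for v w b
  proof -
    have "fld U \<psi> \<kappa> v q (\<lambda>q'. fld U \<psi> \<kappa> w q' (crd U \<psi> \<kappa> b)) = (\<lambda>_. 0) v"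
      by (rule fld_local[where h = "\<lambda>_. w \<bullet> b" and S = core])
        (use q coord_ball_open fld_crd VF_C[OF fld_VF crd_C] in auto)
    then show ?thesis by simp
  qed
  have "lie_bracket (fld U \<psi> \<kappa> v) (fld U \<psi> \<kappa> w) q \<in> TS q"
    by (rule VF_T[OF lie_bracket_VF[OF fld_VF fld_VF]])
  moreover have "comps (lie_bracket (fld U \<psi> \<kappa> v) (fld U \<psi> \<kappa> w) q) = 0"
    unfolding comps_def by (simp add: lie_bracket_def z)
  ultimately have "lie_bracket (fld U \<psi> \<kappa> v) (fld U \<psi> \<kappa> w) q = fld U \<psi> \<kappa> 0 q"
    using fld_span[OF q] by metis
  also have "\<dots> = (\<lambda>f. 0)" using fld_lin[of 0 0 0 0 q] by (simp add: cmbT_def)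
  finally show ?thesis .
qed

end

text \<open>Hadamard's lemma for vector fields: near \<open>p\<close> a field vanishing at \<open>p\<close> is \<open>\<Sum> X\<^sup>b \<partial>\<^sub>b\<close> with
  \<open>X\<^sup>b(p) = 0\<close>; a second cut-off makes this global.\<close>
lemma vanishing_field:
  assumes X: "X \<in> VF" and z: "X p = (\<lambda>f. 0)"
  shows "\<exists>\<mu> a Y. \<mu> \<in> C \<and> \<mu> p = 0 \<and> (\<forall>b\<in>Basis::'e set. a b \<in> C \<and> a b p = 0 \<and> Y b \<in> VF) \<and>
    X = (\<lambda>q f. \<mu> q * X q f + (\<Sum>b\<in>Basis. a b q * Y b q f))"
proof -
  obtain U \<psi> r \<kappa> where U: "p \<in> U" and fr: "frame U \<psi> (\<psi> p) r \<kappa>" using frame_exists by blast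
  note chart = fr_chart[OF fr] and r = fr_r[OF fr]
  have "cball (\<psi> p) (2 * r) \<subseteq> \<psi> ` U" using fr_sub[OF fr] subset_cball[of "2 * r" "4 * r"] r by fastforce
  then obtain \<nu> where n: "\<nu> \<in> C" "\<forall>q\<in>U. dist (\<psi> p) (\<psi> q) \<le> r \<longrightarrow> \<nu> q = 1"
    "\<forall>q. \<not> (q \<in> U \<and> dist (\<psi> p) (\<psi> q) < 2 * r) \<longrightarrow> \<nu> q = 0"
    using cutoff_exists[OF chart, of r "2 * r" "\<psi> p"] r by auto
  define a where "a = (\<lambda>b q. X q (crd U \<psi> \<kappa> b))"
  define Y where "Y = (\<lambda>b q f. \<nu> q * fld U \<psi> \<kappa> b q f)"
  have aC: "a b \<in> C" for b unfolding a_def by (rule VF_C[OF X crd_C[OF fr]])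
  have YV: "Y b \<in> VF" for b
    using VF_cmb[OF fld_VF[OF fr] fld_VF[OF fr] n(1) C_const[of 0], of b b] by (simp add: Y_def cmbT_def)
  \<comment> \<open>On the core X is a combination of coordinate fields, and the two terms add up to
    it; off the core \<open>\<nu>\<close> is 0 and the first term is all of X.\<close>
  have "X q f = (1 - \<nu> q) * X q f + (\<Sum>b\<in>Basis. a b q * Y b q f)" for q f
  proof (cases "q \<in> coord_ball U \<psi> (\<psi> p) (2 * r)")
    case True
    have "X q f = fld U \<psi> \<kappa> (comps U \<psi> \<kappa> (X q)) q f" using fld_span[OF fr True VF_T[OF X]] by metis
    also have "\<dots> = (\<Sum>b\<in>Basis. a b q * fld U \<psi> \<kappa> b q f)"
    proof (cases "f \<in> C")
      case f: True
      have qU: "q \<in> U" using True by (simp add: coord_ball_def)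
      then have l: "linear (frechet_derivative (\<lambda>x. f (inv_into U \<psi> x)) (at (\<psi> q)))"
        using fr_dv[OF fr f] has_derivative_linear by blast
      show ?thesis using f qU
        by (simp add: fld_def comps_def[OF fr] a_def linear_sum[OF l] linear_cmul[OF l] sum_distrib_left algebra_simps)
    qed (simp add: fld_def)
    finally have e: "X q f = (\<Sum>b\<in>Basis. a b q * fld U \<psi> \<kappa> b q f)" .
    have "\<nu> q * X q f = (\<Sum>b\<in>Basis. a b q * Y b q f)"
      unfolding e Y_def by (simp add: sum_distrib_left algebra_simps)
    then show ?thesis by (simp add: algebra_simps)
  next
    case False
    then have "\<nu> q = 0" using n(3) by (auto simp: coord_ball_def)
    then show ?thesis by (simp add: Y_def)
  qed
  then show ?thesis
    by (intro exI[of _ "\<lambda>q. 1 - \<nu> q"] exI[of _ a] exI[of _ Y])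
      (use aC YV n U r z in \<open>auto simp: fun_eq_iff a_def intro!: C_diff C_const\<close>)
qed

end

section \<open>Integration of top forms\<close>

lemma compact_support_integrable:
  fixes G :: "'e::euclidean_space \<Rightarrow> real"
  assumes "continuous_on UNIV G" "\<And>x. dist c x > s \<Longrightarrow> G x = 0"
  shows "G absolutely_integrable_on UNIV"
proof -
  obtain a b where ab: "cball c s \<subseteq> cbox a b" using bounded_subset_cbox_symmetric[OF bounded_cball] by blast
  have "G absolutely_integrable_on cbox a b"
    by (rule absolutely_integrable_continuous) (rule continuous_on_subset[OF assms(1)], simp)
  then have "(\<lambda>x. if x \<in> cbox a b then G x else 0) absolutely_integrable_on UNIV"
    by (simp add: absolutely_integrable_restrict_UNIV)
  moreover have "(\<lambda>x. if x \<in> cbox a b then G x else 0) = G"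
    using assms(2) ab by (force simp: fun_eq_iff)
  ultimately show ?thesis by simp
qed

text \<open>The integral of G(x + t v) over x is independent of t by translation invariance; its
  derivative at t = 0 is the integral in question.\<close>

lemma integral_derivative_zero:
  fixes G :: "'e::euclidean_space \<Rightarrow> real"
  assumes G: "smooth_on UNIV G" and z: "\<And>x. dist c x > s \<Longrightarrow> G x = 0"
  shows "integral UNIV (\<lambda>x. frechet_derivative G (at x) v) = 0"
proof -
  define D where "D = (\<lambda>x. frechet_derivative G (at x) v)"
  \<comment> \<open>The margin \<open>norm v\<close> keeps the support inside the box under all
    shifts by t v with |t| < 1.\<close>
  obtain a b where ab: "cball c (s + norm v) \<subseteq> cbox a b" using bounded_subset_cbox_symmetric[OF bounded_cball] by blast
  have dG: "(G has_derivative frechet_derivative G (at x)) (at x)" for x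
    using smooth_on_has_derivative[OF G] by simp
  have cD: "continuous_on UNIV D" unfolding D_def using smooth_on_continuous[OF smooth_on_derivative[OF G]] .
  have cG: "continuous_on UNIV G" by (rule smooth_on_continuous[OF G])
  have zD: "D x = 0" if "x \<notin> cbox a b" for x
  proof -
    have "dist c x > s" using that ab norm_ge_zero[of v] by (meson add_increasing2 mem_cball not_le order_refl subsetD)
    then have x: "x \<in> - cball c s" by simp
    have "(G has_derivative (\<lambda>_. 0)) (at x)"
      by (rule has_derivative_transform_within_open[of "\<lambda>_. 0" _ _ _ "- cball c s"]) (use z x in auto)
    then have "frechet_derivative G (at x) = (\<lambda>_. 0)" using frechet_derivative_at by metis
    then show ?thesis by (simp add: D_def)
  qed
  let ?U = "ball (0::real) 1"
  have const: "integral (cbox a b) (\<lambda>x. G (x + t *\<^sub>R v)) = integral UNIV G" if t: "t \<in> ?U" for t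
  proof -
    have "integral (cbox a b) (\<lambda>x. G (x + t *\<^sub>R v)) = integral (cbox (a + t *\<^sub>R v) (b + t *\<^sub>R v)) G"
      using integral_shift_cbox[of "a + t *\<^sub>R v" "t *\<^sub>R v" "b + t *\<^sub>R v" G] by simp
    also have "\<dots> = integral UNIV (\<lambda>x. if x \<in> cbox (a + t *\<^sub>R v) (b + t *\<^sub>R v) then G x else 0)"
      by (rule integral_restrict_UNIV[symmetric])
    also have "(\<lambda>x. if x \<in> cbox (a + t *\<^sub>R v) (b + t *\<^sub>R v) then G x else 0) = G"
    proof (rule ext)
      fix x
      show "(if x \<in> cbox (a + t *\<^sub>R v) (b + t *\<^sub>R v) then G x else 0) = G x"
      proof (cases "dist c x > s")
        case False
        have "norm (t *\<^sub>R v) \<le> norm v" using t by (simp add: mult_left_le_one_le)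
        then have "dist c (x - t *\<^sub>R v) \<le> s + norm v"
          using False norm_triangle_ineq[of "c - x" "t *\<^sub>R v"] by (simp add: dist_norm algebra_simps)
        then have "x - t *\<^sub>R v \<in> cbox a b" using ab by auto
        then have "x \<in> cbox (a + t *\<^sub>R v) (b + t *\<^sub>R v)" by (auto simp: mem_box algebra_simps)
        then show ?thesis by simp
      qed (use z in auto)
    qed
    finally show ?thesis .
  qed
  have "((\<lambda>t. integral (cbox a b) (\<lambda>x. G (x + t *\<^sub>R v))) has_field_derivative integral (cbox a b) (\<lambda>x. D (x + 0 *\<^sub>R v))) (at 0 within ?U)"
  proof (rule leibniz_rule_field_derivative[where fx = "\<lambda>t x. D (x + t *\<^sub>R v)"])
    fix t :: real and x
    have "((\<lambda>t. G (x + t *\<^sub>R v)) has_derivative (\<lambda>h. frechet_derivative G (at (x + t *\<^sub>R v)) (h *\<^sub>R v))) (at t)"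
      by (rule has_derivative_compose[where g = G and f = "\<lambda>t. x + t *\<^sub>R v" and x = t, OF _ dG])
        (auto intro!: derivative_eq_intros)
    moreover have "linear (frechet_derivative G (at (x + t *\<^sub>R v)))" using dG has_derivative_linear by blast
    ultimately have "((\<lambda>t. G (x + t *\<^sub>R v)) has_derivative (\<lambda>h. D (x + t *\<^sub>R v) * h)) (at t)"
      by (elim has_derivative_eq_rhs) (auto simp: D_def linear_cmul)
    then show "((\<lambda>t. G (x + t *\<^sub>R v)) has_field_derivative D (x + t *\<^sub>R v)) (at t within ?U)"
      unfolding has_field_derivative_def by (rule has_derivative_at_withinI)
  next
    fix t :: real
    show "(\<lambda>x. G (x + t *\<^sub>R v)) integrable_on cbox a b"
      by (rule integrable_continuous, rule continuous_on_compose2[OF cG]) (auto intro!: continuous_intros)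
  next
    show "continuous_on (?U \<times> cbox a b) (\<lambda>(t, x). D (x + t *\<^sub>R v))"
      unfolding case_prod_beta by (rule continuous_on_compose2[OF cD]) (auto intro!: continuous_intros)
  qed auto
  then have "((\<lambda>t. integral (cbox a b) (\<lambda>x. G (x + t *\<^sub>R v))) has_field_derivative integral (cbox a b) D) (at 0)"
    by (simp add: at_within_open[of 0 ?U])
  moreover have "((\<lambda>t. integral (cbox a b) (\<lambda>x. G (x + t *\<^sub>R v))) has_field_derivative 0) (at 0)"
    by (rule has_field_derivative_transform_within_open[of "\<lambda>_. integral UNIV G" _ _ ?U]) (use const in auto)
  ultimately have "integral (cbox a b) D = 0" using DERIV_unique by blast
  moreover have "integral (cbox a b) D = integral UNIV (\<lambda>x. if x \<in> cbox a b then D x else 0)"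
    by (rule integral_restrict_UNIV[symmetric])
  moreover have "(\<lambda>x. if x \<in> cbox a b then D x else 0) = D" using zD by auto
  ultimately show ?thesis by (simp add: D_def)
qed

lemma integral_compact_support_pos:
  fixes G :: "'e::euclidean_space \<Rightarrow> real"
  assumes "continuous_on UNIV G" "\<And>x. dist c x > s \<Longrightarrow> G x = 0" "\<And>x. G x \<ge> 0" "G x0 > 0"
  shows "integral UNIV G > 0"
proof -
  \<comment> \<open>The two extra points force x0 into the open box, whose nonemptiness the
    criterion for a vanishing integral requires.\<close>
  have "bounded (cball c s \<union> {x0 - One, x0 + One})" by simp
  then obtain b where "cball c s \<union> {x0 - One, x0 + One} \<subseteq> cbox (- b) b"
    using bounded_subset_cbox_symmetric by metis
  then obtain a where ab: "cball c s \<union> {x0 - One, x0 + One} \<subseteq> cbox a b" by blast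
  then have ab': "cball c s \<subseteq> cbox a b" "x0 \<in> box a b" by (force simp: mem_box inner_diff_left inner_add_left)+
  have "(\<lambda>x. if x \<in> cbox a b then G x else 0) = G"
    using assms(2) ab'(1) by (force simp: fun_eq_iff)
  then have e: "integral UNIV G = integral (cbox a b) G" using integral_restrict_UNIV[of "cbox a b" G] by simp
  have c: "continuous_on (cbox a b) G" using continuous_on_subset[OF assms(1)] by simp
  have "integral (cbox a b) G \<noteq> 0"
    using integral_cbox_eq_0_iff[OF c] ab'(2) assms(3,4) box_subset_cbox by (metis empty_iff less_irrefl subsetD)
  moreover have "integral (cbox a b) G \<ge> 0"
    by (rule integral_nonneg) (use c assms(3) in \<open>auto intro: integrable_continuous\<close>)
  ultimately show ?thesis using e by simp
qed

text \<open>The scalar case is read off from the vector-valued theorem by viewing f as a function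
  into \<open>real^1\<close>.\<close>

lemma change_of_variables_real:
  fixes f :: "real^'m::{finite,wellorder} \<Rightarrow> real" and g :: "real^'m::_ \<Rightarrow> real^'m::_"
  assumes S: "S \<in> sets lebesgue"
    and der_g: "\<And>x. x \<in> S \<Longrightarrow> (g has_derivative g' x) (at x within S)"
    and inj: "inj_on g S" and f: "f absolutely_integrable_on (g ` S)"
  shows "integral S (\<lambda>x. \<bar>det (matrix (g' x))\<bar> * f (g x)) = integral (g ` S) f"
proof -
  let ?F = "\<lambda>x. vec (f x) :: real^1"
  have F: "?F absolutely_integrable_on (g ` S)"
    using f absolutely_integrable_on_1_iff by fastforce
  then have c: "(\<lambda>x. \<bar>det (matrix (g' x))\<bar> *\<^sub>R ?F (g x)) absolutely_integrable_on S"
      "integral S (\<lambda>x. \<bar>det (matrix (g' x))\<bar> *\<^sub>R ?F (g x)) = integral (g ` S) ?F"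
    using has_absolute_integral_change_of_variables[OF S der_g inj, of ?F] by blast+
  have "integral S (\<lambda>x. (\<bar>det (matrix (g' x))\<bar> *\<^sub>R ?F (g x)) $ 1) = integral (g ` S) (\<lambda>x. ?F x $ 1)"
    unfolding integral_component_eq_cart[OF set_lebesgue_integral_eq_integral(1)[OF c(1)]]
      integral_component_eq_cart[OF set_lebesgue_integral_eq_integral(1)[OF F]] c(2) ..
  then show ?thesis by simp
qed

section \<open>Locality of forms, multiplication by functions, and coordinate integrals\<close>

context smooth_mfd
begin

lemma pullback_form:
  assumes fr: "frame U \<psi> c r \<kappa>" and w: "w \<in> diff_forms A k"
  shows "alt (\<lambda>vs. w q (map (\<lambda>v. fld U \<psi> \<kappa> v q) vs))" "mlin' (\<lambda>vs. w q (map (\<lambda>v. fld U \<psi> \<kappa> v q) vs))"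
proof -
  show "alt (\<lambda>vs. w q (map (\<lambda>v. fld U \<psi> \<kappa> v q) vs))"
    by (rule altI) (simp, rule altD[OF diff_formsD(4)[OF w]])
  show "mlin' (\<lambda>vs. w q (map (\<lambda>v. fld U \<psi> \<kappa> v q) vs))"
  proof (rule mlinI)
    fix xs ys :: "'e list" and u v a b
    have T: "fld U \<psi> \<kappa> v q \<in> TS q" for v by (rule VF_T[OF fld_VF[OF fr]])
    have "set (map (\<lambda>v. fld U \<psi> \<kappa> v q) zs) \<subseteq> TS q" for zs using T by auto
    from mlinD[OF diff_formsD(3)[OF w] this this T T]
    show "w q (map (\<lambda>v. fld U \<psi> \<kappa> v q) (xs @ (a *\<^sub>R u + b *\<^sub>R v) # ys)) =
        a * w q (map (\<lambda>v. fld U \<psi> \<kappa> v q) (xs @ u # ys)) + b * w q (map (\<lambda>v. fld U \<psi> \<kappa> v q) (xs @ v # ys))"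
      by (simp add: fld_lin[OF fr])
  qed
qed

text \<open>By \<open>fld_span\<close> a derivation is a partial derivative in coordinates, and that
  sees only a neighbourhood.\<close>

lemma T_local:
  assumes v: "v \<in> TS q" and f: "f \<in> C" and S: "open S" "q \<in> S" and z: "\<And>y. y \<in> S \<Longrightarrow> f y = 0"
  shows "v f = 0"
proof -
  obtain U \<psi> r \<kappa> where U: "q \<in> U" and fr: "frame U \<psi> (\<psi> q) r \<kappa>" using frame_exists by blast
  have q: "q \<in> coord_ball U \<psi> (\<psi> q) (2 * r)" using U fr_r[OF fr] by (simp add: coord_ball_def)
  have "fld U \<psi> \<kappa> (comps U \<psi> \<kappa> v) q f = (\<lambda>_. 0) (comps U \<psi> \<kappa> v)"
    by (rule fld_local[OF fr q f, where S = "S \<inter> coord_ball U \<psi> (\<psi> q) (2 * r)" and h = "\<lambda>_. 0"])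
      (use S q z coord_ball_open[OF fr] in auto)
  then show ?thesis using fld_span[OF fr q v] by metis
qed

lemma onfields_zero:
  assumes w: "w \<in> diff_forms A k" and X: "X q = (\<lambda>f. 0)"
  shows "onfields w q (X # Xs) = 0"
proof (cases "set (map (\<lambda>X. X q) Xs) \<subseteq> TS q")
  case True
  from mlinD[OF diff_formsD(3)[OF w] _ this T_zero T_zero, of "[]" 0 0]
  show ?thesis using X by (simp add: onfields_def cmbT_def)
next
  case False
  then show ?thesis using diff_formsD(2)[OF w, of q] X by (auto simp: onfields_def supp_def)
qed

definition fun_form :: "('a \<Rightarrow> real) \<Rightarrow> 'a form" where
  "fun_form \<rho> = (\<lambda>q vs. \<rho> q * one_form0 vs)"

definition dfun_form :: "('a \<Rightarrow> real) \<Rightarrow> 'a form" where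
  "dfun_form \<rho> = (\<lambda>q vs. if length vs = 1 \<and> set vs \<subseteq> TS q then (vs ! 0) \<rho> else 0)"

definition smul :: "('a \<Rightarrow> real) \<Rightarrow> 'a form \<Rightarrow> 'a form" where
  "smul \<rho> w = (\<lambda>q vs. \<rho> q * w q vs)"

lemma fun_form_form:
  assumes "\<rho> \<in> C"
  shows "fun_form \<rho> \<in> diff_forms A 0"
proof (rule diff_formsI)
  show "alt (fun_form \<rho> p)" for p by (rule altI) (simp add: fun_form_def one_form0_def)
  show "mlin cmbT (TS p) (fun_form \<rho> p)" for p by (rule mlinI) (simp add: fun_form_def one_form0_def)
  show "smoothf (onfields (fun_form \<rho>))"
    using assms by (auto simp: smoothf_def onfields_def fun_form_def one_form0_def C_const)
qed (auto simp: deg_def supp_def fun_form_def one_form0_def)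

lemma dfun_form_form:
  assumes "\<rho> \<in> C"
  shows "dfun_form \<rho> \<in> diff_forms A 1"
proof (rule diff_formsI)
  show "alt (dfun_form \<rho> p)" for p by (rule altI) (simp add: dfun_form_def)
  show "mlin cmbT (TS p) (dfun_form \<rho> p)" for p
  proof (rule mlinI)
    fix xs ys u v a b
    assume "set xs \<subseteq> TS p" "set ys \<subseteq> TS p" "u \<in> TS p" "v \<in> TS p"
    then show "dfun_form \<rho> p (xs @ cmbT a u b v # ys) = a * dfun_form \<rho> p (xs @ u # ys) + b * dfun_form \<rho> p (xs @ v # ys)"
      by (cases xs) (auto simp: dfun_form_def T_cmb, auto simp: cmbT_def)
  qed
  show "smoothf (onfields (dfun_form \<rho>))"
    unfolding smoothf_def
  proof (intro allI impI)
    fix Xs assume Xs: "set Xs \<subseteq> VF"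
    show "(\<lambda>p. onfields (dfun_form \<rho>) p Xs) \<in> C"
    proof (cases "length Xs = 1")
      case True
      then obtain X where X: "Xs = [X]" by (cases Xs) auto
      then have "X \<in> VF" using Xs by simp
      then have "(\<lambda>p. onfields (dfun_form \<rho>) p Xs) = (\<lambda>p. X p \<rho>)"
        using VF_T[of X] by (auto simp: X onfields_def dfun_form_def)
      then show ?thesis using VF_C[OF \<open>X \<in> VF\<close> assms] by simp
    qed (auto simp: onfields_def dfun_form_def C_const)
  qed
qed (auto simp: deg_def supp_def dfun_form_def)

text \<open>Seen as a product with a 0-form, multiplication by a function obtains its Leibniz rule
  from \<open>extd_wedge\<close>.\<close>

lemma smul_wedge: "smul \<rho> w q vs = wedge (fun_form \<rho> q) (w q) vs"
proof -
  have "deg 0 (fun_form \<rho> q)" by (simp add: deg_def fun_form_def one_form0_def)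
  then show ?thesis by (simp add: wedge_0_form smul_def fun_form_def one_form0_def)
qed

lemma smul_eq: "smul \<rho> w = (\<lambda>q. wedge (fun_form \<rho> q) (w q))"
  by (intro ext) (rule smul_wedge)

lemma smul_form: "\<rho> \<in> C \<Longrightarrow> w \<in> diff_forms A k \<Longrightarrow> smul \<rho> w \<in> diff_forms A k"
  using diff_forms_wedge[OF fun_form_form, of \<rho> w k] by (simp add: smul_eq)

lemma extd_fun_form:
  assumes r: "\<rho> \<in> C" and Xs: "set Xs \<subseteq> VF"
  shows "extd (onfields (fun_form \<rho>)) q Xs = onfields (dfun_form \<rho>) q Xs"
proof (cases "length Xs = 1")
  case True
  then obtain X where X: "Xs = [X]" by (cases Xs) auto
  then have "X q \<in> TS q" using Xs VF_T by auto
  then show ?thesis by (simp add: X onfields_def fun_form_def dfun_form_def one_form0_def)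
next
  case False
  have "extd (onfields (fun_form \<rho>)) q Xs = 0"
    by (rule extd_deg[where k = 0]) (use False Xs in \<open>auto simp: deg_def onfields_def fun_form_def one_form0_def\<close>)
  then show ?thesis using False by (simp add: onfields_def dfun_form_def)
qed

lemma onfields_add: "onfields (\<lambda>q vs. a q vs + b q vs) q Xs = onfields a q Xs + onfields b q Xs"
  by (simp add: onfields_def)

lemma extd_smul:
  assumes r: "\<rho> \<in> C" and t: "t \<in> diff_forms A k" and Xs: "set Xs \<subseteq> VF"
    and d: "\<And>p Xs. set Xs \<subseteq> VF \<Longrightarrow> onfields th p Xs = extd (onfields t) p Xs"
  shows "extd (onfields (smul \<rho> t)) q Xs = onfields (\<lambda>q vs. wedge (dfun_form \<rho> q) (t q) vs + smul \<rho> th q vs) q Xs"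
proof -
  have "onfields (smul \<rho> t) = (\<lambda>p. wedge (onfields (fun_form \<rho>) p) (onfields t p))"
    by (simp add: onfields_wedge[symmetric] smul_eq)
  then have "extd (onfields (smul \<rho> t)) q Xs =
      wedge (extd (onfields (fun_form \<rho>)) q) (onfields t q) Xs + wedge (sgnf (onfields (fun_form \<rho>) q)) (extd (onfields t) q) Xs"
    using extd_wedge[OF diff_formsD(5)[OF fun_form_form[OF r]] diff_formsD(5)[OF t] Xs, of q] by simp
  also have "wedge (extd (onfields (fun_form \<rho>)) q) (onfields t q) Xs = wedge (onfields (dfun_form \<rho>) q) (onfields t q) Xs"
    by (rule wedge_cong) (use extd_fun_form[OF r] Xs in auto)
  also have "\<dots> = onfields (\<lambda>q. wedge (dfun_form \<rho> q) (t q)) q Xs" by (simp add: onfields_wedge)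
  also have "wedge (sgnf (onfields (fun_form \<rho>) q)) (extd (onfields t) q) Xs = \<rho> q * extd (onfields t) q Xs"
    by (subst wedge_0_form) (auto simp: deg_def sgnf_def onfields_def fun_form_def one_form0_def)
  also have "\<dots> = onfields (smul \<rho> th) q Xs" using d[OF Xs, of q] by (simp add: onfields_def smul_def)
  finally show ?thesis by (simp only: onfields_add)
qed

text \<open>The factor 3/2 lies between the radius r of the covering balls and the radius 2r of the
  core: supports of this size leave room for an extension by 0 inside the core.\<close>

definition closed_coord_ball :: "'a set \<Rightarrow> ('a \<Rightarrow> 'e) \<Rightarrow> 'e \<Rightarrow> real \<Rightarrow> 'a set" where
  "closed_coord_ball U \<psi> c r = {q \<in> U. dist c (\<psi> q) \<le> 3 / 2 * r}"

context
  fixes U \<psi> c r \<kappa>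
  assumes fr: "frame U \<psi> c r \<kappa>"
begin

lemma closed_coord_ball_core: "closed_coord_ball U \<psi> c r \<subseteq> coord_ball U \<psi> c (2 * r)"
  using fr_r[OF fr] by (auto simp: closed_coord_ball_def coord_ball_def)

lemma closed_coord_ball_closed: "closed (closed_coord_ball U \<psi> c r)"
proof -
  have "cball c (3 / 2 * r) \<subseteq> cball c (4 * r)" by (rule subset_cball) (use fr_r[OF fr] in simp)
  then have "compact {q \<in> U. \<psi> q \<in> cball c (3 / 2 * r)}"
    by (intro chart_preimage_compact[OF fr_chart[OF fr]] compact_cball order_trans[OF _ fr_sub[OF fr]])
  then show ?thesis by (simp add: closed_coord_ball_def compact_imp_closed)
qed

lemma ball_core: "x \<in> ball c (2 * r) \<Longrightarrow> inv_into U \<psi> x \<in> coord_ball U \<psi> c (2 * r)"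
  "x \<in> ball c (2 * r) \<Longrightarrow> \<psi> (inv_into U \<psi> x) = x"
  using inv_ball[OF fr, of x] fr_r[OF fr] by (auto simp: coord_ball_def)

lemma core_ball: "q \<in> coord_ball U \<psi> c (2 * r) \<Longrightarrow> \<psi> q \<in> ball c (2 * r)"
  "q \<in> coord_ball U \<psi> c (2 * r) \<Longrightarrow> inv_into U \<psi> (\<psi> q) = q"
  using fr_inv[OF fr] by (auto simp: coord_ball_def)

context
  fixes F :: "'a \<Rightarrow> real"
  assumes F: "F \<in> C" and z: "\<And>q. q \<notin> closed_coord_ball U \<psi> c r \<Longrightarrow> F q = 0"
begin

text \<open>F in coordinates, extended by 0. The extension is smooth because F already vanishes on
  the shell between radius 3r/2 and 2r.\<close>

definition "pulled x = (if x \<in> ball c (2 * r) then F (inv_into U \<psi> x) else 0)"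

lemma pulled_zero: "dist c x > 3 / 2 * r \<Longrightarrow> pulled x = 0"
  using ball_core[of x] z[of "inv_into U \<psi> x"] by (auto simp: pulled_def closed_coord_ball_def)

lemma pulled_smooth: "smooth_on UNIV pulled"
proof (rule smooth_on_local)
  fix x
  show "\<exists>T. open T \<and> x \<in> T \<and> smooth_on T pulled"
  proof (cases "x \<in> ball c (2 * r)")
    case True
    have "ball c (2 * r) \<subseteq> ball c (4 * r)" by (rule subset_ball) (use fr_r[OF fr] in simp)
    then have "smooth_on (ball c (2 * r)) (\<lambda>x. F (inv_into U \<psi> x))"
      using smooth_on_subset[OF C_smooth_ball[OF fr F]] by blast
    then have "smooth_on (ball c (2 * r)) pulled"
      by (rule smooth_on_cong[THEN iffD1, rotated 2]) (auto simp: pulled_def)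
    then show ?thesis using True open_ball by blast
  next
    case False
    have "smooth_on (- cball c (3 / 2 * r)) (\<lambda>x. 0::real)" by (rule smooth_on_const)
    then have "smooth_on (- cball c (3 / 2 * r)) pulled"
      by (rule smooth_on_cong[THEN iffD1, rotated 2]) (auto simp: pulled_zero)
    moreover have "x \<in> - cball c (3 / 2 * r)" using False fr_r[OF fr] by simp
    ultimately show ?thesis by (intro exI[of _ "- cball c (3 / 2 * r)"]) auto
  qed
qed

lemma pulled_integrable: "(\<lambda>x. F (inv_into U \<psi> x)) absolutely_integrable_on ball c (2 * r)"
proof -
  have "pulled absolutely_integrable_on UNIV"
    by (rule compact_support_integrable[OF smooth_on_continuous[OF pulled_smooth]]) (rule pulled_zero)
  then show ?thesis unfolding pulled_def[abs_def] by (simp only: absolutely_integrable_restrict_UNIV)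
qed

lemma pulled_integral: "integral UNIV pulled = integral (ball c (2 * r)) (\<lambda>x. F (inv_into U \<psi> x))"
  unfolding pulled_def[abs_def] by (rule integral_restrict_UNIV)

text \<open>The divergence theorem for one coordinate direction: on the core the field is a partial
  derivative, and F has compact support there.\<close>

lemma has_integral_fld: "((\<lambda>x. fld U \<psi> \<kappa> v (inv_into U \<psi> x) F) has_integral 0) (ball c (2 * r))"
proof -
  let ?D = "\<lambda>x. frechet_derivative pulled (at x) v"
  have Dz: "?D x = 0" if "dist c x > 3 / 2 * r" for x
  proof -
    have "(pulled has_derivative (\<lambda>_. 0)) (at x)"
      by (rule has_derivative_transform_within_open[of "\<lambda>_. 0" _ _ _ "- cball c (3 / 2 * r)"])
        (use that pulled_zero in auto)
    then have "frechet_derivative pulled (at x) = (\<lambda>_. 0)" using frechet_derivative_at by metis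
    then show ?thesis by simp
  qed
  have Df: "fld U \<psi> \<kappa> v (inv_into U \<psi> x) F = ?D x" if x: "x \<in> ball c (2 * r)" for x
  proof -
    have "(pulled has_derivative frechet_derivative pulled (at x)) (at x)"
      using smooth_on_has_derivative[OF pulled_smooth] by simp
    moreover have "F y = pulled (\<psi> y)" if "y \<in> coord_ball U \<psi> c (2 * r)" for y
      using core_ball[OF that] by (simp add: pulled_def)
    ultimately show ?thesis
      by (intro fld_local[OF fr, where S = "coord_ball U \<psi> c (2 * r)" and h = pulled])
        (use x ball_core F coord_ball_open[OF fr] in auto)
  qed
  have "?D absolutely_integrable_on UNIV"
    by (rule compact_support_integrable[OF smooth_on_continuous[OF smooth_on_derivative[OF pulled_smooth]]]) (rule Dz)
  then have "?D integrable_on UNIV" by (rule set_lebesgue_integral_eq_integral)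
  moreover have "integral UNIV ?D = 0"
    by (rule integral_derivative_zero[OF pulled_smooth]) (rule pulled_zero)
  ultimately have "(?D has_integral 0) UNIV" by (metis integrable_integral)
  moreover have "?D = (\<lambda>x. if x \<in> ball c (2 * r) then fld U \<psi> \<kappa> v (inv_into U \<psi> x) F else 0)"
    using Df Dz fr_r[OF fr] by (fastforce simp: fun_eq_iff)
  ultimately show ?thesis by (simp only: has_integral_restrict_UNIV)
qed

end

end

lemma frame_change:
  assumes fr: "frame U \<psi> c r \<kappa>" and fr': "frame U' \<psi>' c' r' \<kappa>'"
    and q: "q \<in> coord_ball U \<psi> c (2 * r)" "q \<in> coord_ball U' \<psi>' c' (2 * r')"
  shows "fld U \<psi> \<kappa> v q = fld U' \<psi>' \<kappa>' (frechet_derivative (\<lambda>x. \<psi>' (inv_into U \<psi> x)) (at (\<psi> q)) v) q"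
proof (rule ext)
  fix f
  let ?T = "\<lambda>x. \<psi>' (inv_into U \<psi> x)" and ?S = "\<psi> ` (U \<inter> U')"
  note q1 = core_1[OF fr q(1)] core_1[OF fr' q(2)]
  show "fld U \<psi> \<kappa> v q f = fld U' \<psi>' \<kappa>' (frechet_derivative ?T (at (\<psi> q)) v) q f"
  proof (cases "f \<in> C")
    case f: True
    have S: "open ?S"
      by (rule chart_image_open[OF fr_chart[OF fr]]) (use chart_open fr_chart[OF fr] fr_chart[OF fr'] in auto)
    have qS: "\<psi> q \<in> ?S" using q1 by auto
    have Tq: "?T (\<psi> q) = \<psi>' q" using fr_inv[OF fr q1(2)] by simp
    have T: "(?T has_derivative frechet_derivative ?T (at (\<psi> q))) (at (\<psi> q))"
      by (rule smooth_on_has_derivative[OF chart_transition[OF fr_chart[OF fr] fr_chart[OF fr']] qS])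
    have "((\<lambda>x. f (inv_into U' \<psi>' (?T x))) has_derivative
        (\<lambda>v. frechet_derivative (\<lambda>x. f (inv_into U' \<psi>' x)) (at (\<psi>' q)) (frechet_derivative ?T (at (\<psi> q)) v))) (at (\<psi> q))"
      by (rule has_derivative_compose[where g = "\<lambda>x. f (inv_into U' \<psi>' x)", OF T]) (unfold Tq, rule fr_dv[OF fr' f q1(4)])
    then have "((\<lambda>x. f (inv_into U \<psi> x)) has_derivative
        (\<lambda>v. frechet_derivative (\<lambda>x. f (inv_into U' \<psi>' x)) (at (\<psi>' q)) (frechet_derivative ?T (at (\<psi> q)) v))) (at (\<psi> q))"
      by (rule has_derivative_transform_within_open[OF _ S qS]) (auto simp: fr_inv[OF fr] fr_inv[OF fr'])
    from fun_cong[OF frechet_derivative_at[OF this], of v, symmetric] show ?thesis using f q1 by (simp add: fld_def)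
  qed (simp add: fld_def)
qed

end

section \<open>Top forms and their integrals in charts\<close>

locale smooth_mfd_cart = smooth_mfd A
  for A :: "('a::{t2_space, second_countable_topology}, real^'n::{finite,wellorder}) chart set"
begin

definition axes :: "'n list" where "axes = sorted_list_of_set UNIV"

lemma axes: "distinct axes" "set axes = UNIV" "length axes = CARD('n)"
  by (simp_all add: axes_def)

definition cframe :: "'a set \<Rightarrow> ('a \<Rightarrow> (real, 'n) vec) \<Rightarrow> ('a \<Rightarrow> real) \<Rightarrow> 'a vfield list" where
  "cframe U \<psi> \<kappa> = map (\<lambda>i. fld U \<psi> \<kappa> (axis i 1)) axes"

definition top_coeff :: "'a set \<Rightarrow> ('a \<Rightarrow> (real, 'n) vec) \<Rightarrow> ('a \<Rightarrow> real) \<Rightarrow> 'a form \<Rightarrow> 'a \<Rightarrow> real" where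
  "top_coeff U \<psi> \<kappa> w q = onfields w q (cframe U \<psi> \<kappa>)"

text \<open>The integral with respect to the orientation given by the chart; a sign making it
  independent of the chart is multiplied in where needed.\<close>

definition chart_integral :: "'a set \<Rightarrow> ('a \<Rightarrow> (real, 'n) vec) \<Rightarrow> (real, 'n) vec \<Rightarrow> real \<Rightarrow> ('a \<Rightarrow> real) \<Rightarrow> 'a form \<Rightarrow> real" where
  "chart_integral U \<psi> c r \<kappa> w = integral (ball c (2 * r)) (\<lambda>x. top_coeff U \<psi> \<kappa> w (inv_into U \<psi> x))"

lemma cframe_VF: "frame U \<psi> c r \<kappa> \<Longrightarrow> set (cframe U \<psi> \<kappa>) \<subseteq> VF"
  by (auto simp: cframe_def intro: fld_VF)

lemma top_coeff_C: "frame U \<psi> c r \<kappa> \<Longrightarrow> w \<in> diff_forms A k \<Longrightarrow> top_coeff U \<psi> \<kappa> w \<in> C"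
  unfolding top_coeff_def[abs_def] using diff_formsD(5) cframe_VF by (metis smoothf_def)

lemma top_coeff_det:
  assumes fr: "frame U \<psi> c r \<kappa>" and w: "w \<in> diff_forms A k"
  shows "w q (map (\<lambda>i. fld U \<psi> \<kappa> (v i) q) axes) = det (\<chi> i. v i) * top_coeff U \<psi> \<kappa> w q"
  using alt_top_det[OF pullback_form[OF fr w] axes(1,2), of q v]
  by (simp add: top_coeff_def onfields_def cframe_def o_def)

lemma top_coeff_change:
  assumes fr: "frame U \<psi> c r \<kappa>" and fr': "frame U' \<psi>' c' r' \<kappa>'" and w: "w \<in> diff_forms A k"
    and q: "q \<in> coord_ball U \<psi> c (2 * r)" "q \<in> coord_ball U' \<psi>' c' (2 * r')"
  shows "top_coeff U \<psi> \<kappa> w q = det (matrix (frechet_derivative (\<lambda>x. \<psi>' (inv_into U \<psi> x)) (at (\<psi> q)))) * top_coeff U' \<psi>' \<kappa>' w q"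
proof -
  let ?D = "frechet_derivative (\<lambda>x. \<psi>' (inv_into U \<psi> x)) (at (\<psi> q))"
  have "top_coeff U \<psi> \<kappa> w q = w q (map (\<lambda>i. fld U' \<psi>' \<kappa>' (?D (axis i 1)) q) axes)"
    by (simp add: top_coeff_def onfields_def cframe_def o_def frame_change[OF fr fr' q])
  also have "\<dots> = det (\<chi> i. ?D (axis i 1)) * top_coeff U' \<psi>' \<kappa>' w q" by (rule top_coeff_det[OF fr' w])
  \<comment> \<open>The images of the axes are rows on the left but columns of the Jacobian matrix;
    the determinant does not see the difference.\<close>
  also have "(\<chi> i. ?D (axis i 1)) = transpose (matrix ?D)" by (simp add: matrix_def transpose_def vec_eq_iff)
  finally show ?thesis by (simp add: det_transpose)
qed

text \<open>Any arguments can be written in the coordinate frame, so every value of w at q is a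
  multiple of the coefficient.\<close>

lemma top_coeff_nonzero:
  assumes fr: "frame U \<psi> c r \<kappa>" and w: "w \<in> diff_forms A (CARD('n))"
    and q: "q \<in> coord_ball U \<psi> c (2 * r)" and vs: "w q vs \<noteq> 0"
  shows "top_coeff U \<psi> \<kappa> w q \<noteq> 0"
proof -
  have l: "length vs = length axes" and T: "set vs \<subseteq> TS q"
    using vs diff_formsD(1,2)[OF w, of q] by (auto simp: deg_def supp_def axes)
  define v where "v = (\<lambda>i. comps U \<psi> \<kappa> (the (map_of (zip axes vs) i)))"
  have "vs = map (\<lambda>i. fld U \<psi> \<kappa> (v i) q) axes"
  proof (rule nth_equalityI)
    fix k assume k: "k < length vs"
    then have "map_of (zip axes vs) (axes ! k) = Some (vs ! k)"
      using l axes(1) by (intro map_of_zip_nth) auto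
    moreover have "vs ! k \<in> TS q" using k T by auto
    ultimately show "vs ! k = map (\<lambda>i. fld U \<psi> \<kappa> (v i) q) axes ! k"
      using k l fld_span[OF fr q, of "vs ! k"] by (simp add: v_def)
  qed (simp add: l)
  then show ?thesis using top_coeff_det[OF fr w, of q v] vs by auto
qed

text \<open>Stokes' theorem in one chart: the coefficient of ds is an alternating sum of partial
  derivatives of compactly supported functions.\<close>

lemma chart_integral_exact:
  assumes fr: "frame U \<psi> c r \<kappa>" and s: "s \<in> diff_forms A k"
    and z: "\<And>q vs. q \<notin> closed_coord_ball U \<psi> c r \<Longrightarrow> s q vs = 0"
    and d: "\<And>p Xs. set Xs \<subseteq> VF \<Longrightarrow> onfields th p Xs = extd (onfields s) p Xs"
  shows "chart_integral U \<psi> c r \<kappa> th = 0"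
proof -
  let ?L = "cframe U \<psi> \<kappa>"
  define F where "F = (\<lambda>i q. onfields s q (omit i ?L))"
  have so: "set (omit i ?L) \<subseteq> VF" for i
    using cframe_VF[OF fr] set_take_subset[of i ?L] set_drop_subset[of "Suc i" ?L] by (auto simp: omit_def)
  have FC: "F i \<in> C" for i unfolding F_def using diff_formsD(5)[OF s] so by (simp add: smoothf_def)
  have Fz: "F i q = 0" if "q \<notin> closed_coord_ball U \<psi> c r" for i q by (simp add: F_def onfields_def z[OF that])
  have L: "?L ! i = fld U \<psi> \<kappa> (axis (axes ! i) 1)" if "i < length axes" for i
    using that by (simp add: cframe_def)
  have e: "top_coeff U \<psi> \<kappa> th q = (\<Sum>i<length axes. (-1) ^ i * fld U \<psi> \<kappa> (axis (axes ! i) 1) q (F i))"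
    if q: "q \<in> coord_ball U \<psi> c (2 * r)" for q
  proof -
    have "top_coeff U \<psi> \<kappa> th q = extd (onfields s) q ?L" unfolding top_coeff_def by (rule d[OF cframe_VF[OF fr]])
    also have "\<dots> = (\<Sum>i<length ?L. (-1) ^ i * (?L ! i) q (F i)) +
       (\<Sum>j<length ?L. \<Sum>i<j. (-1) ^ (i + j) * onfields s q (lie_bracket (?L ! i) (?L ! j) # omit i (omit j ?L)))"
      unfolding F_def by (rule extd_eq_formula) (rule onfields_alt[OF diff_formsD(4)[OF s]])
    \<comment> \<open>Coordinate fields commute on the core, so every bracket term has a zero
      argument.\<close>
    also have "(\<Sum>j<length ?L. \<Sum>i<j. (-1) ^ (i + j) * onfields s q (lie_bracket (?L ! i) (?L ! j) # omit i (omit j ?L))) = 0"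
    proof (intro sum.neutral ballI)
      fix j i assume "j \<in> {..<length ?L}" "i \<in> {..<j}"
      then have "lie_bracket (?L ! i) (?L ! j) q = (\<lambda>f. 0)"
        using fld_bracket[OF fr q] by (simp add: cframe_def)
      from onfields_zero[where X = "lie_bracket (?L ! i) (?L ! j)" and q = q, OF s this] show "(-1) ^ (i + j) * onfields s q (lie_bracket (?L ! i) (?L ! j) # omit i (omit j ?L)) = 0"
        by simp
    qed
    also have "(\<Sum>i<length ?L. (-1) ^ i * (?L ! i) q (F i)) = (\<Sum>i<length axes. (-1) ^ i * fld U \<psi> \<kappa> (axis (axes ! i) 1) q (F i))"
      by (rule sum.cong) (auto simp: L, simp add: cframe_def)
    finally show ?thesis by simp
  qed
  have h: "((\<lambda>x. \<Sum>i<length axes. (-1) ^ i * fld U \<psi> \<kappa> (axis (axes ! i) 1) (inv_into U \<psi> x) (F i))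
      has_integral (\<Sum>i<length axes. (-1) ^ i * 0)) (ball c (2 * r))"
    by (intro has_integral_sum has_integral_mult_right has_integral_fld[OF fr FC]) (auto simp: Fz)
  have "((\<lambda>x. top_coeff U \<psi> \<kappa> th (inv_into U \<psi> x)) has_integral (\<Sum>i<length axes. (-1) ^ i * 0)) (ball c (2 * r))"
    by (rule has_integral_eq[OF _ h]) (use e ball_core[OF fr] in auto)
  then show ?thesis by (simp add: chart_integral_def integral_unique)
qed

text \<open>The form th orients both charts: its sign times the Jacobian determinant turns into the
  absolute value that the change of variables formula contains. The support condition reduces both
  integrals to the overlap.\<close>

lemma chart_integral_change:
  assumes fr: "frame U \<psi> c r \<kappa>" and fr': "frame U' \<psi>' c' r' \<kappa>'"
    and w: "w \<in> diff_forms A k" and th: "th \<in> diff_forms A k"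
    and z: "\<And>q vs. q \<notin> closed_coord_ball U \<psi> c r \<inter> closed_coord_ball U' \<psi>' c' r' \<Longrightarrow> w q vs = 0"
    and s: "\<bar>s\<bar> = 1" "\<And>q. q \<in> coord_ball U \<psi> c (2 * r) \<Longrightarrow> s * top_coeff U \<psi> \<kappa> th q > 0"
    and s': "\<bar>s'\<bar> = 1" "\<And>q. q \<in> coord_ball U' \<psi>' c' (2 * r') \<Longrightarrow> s' * top_coeff U' \<psi>' \<kappa>' th q > 0"
  shows "s * chart_integral U \<psi> c r \<kappa> w = s' * chart_integral U' \<psi>' c' r' \<kappa>' w"
proof -
  let ?W = "coord_ball U \<psi> c (2 * r) \<inter> coord_ball U' \<psi>' c' (2 * r')"
  let ?S = "\<psi> ` ?W"
  let ?T = "\<lambda>x. \<psi>' (inv_into U \<psi> x)"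
  define D where "D = (\<lambda>x. frechet_derivative ?T (at x))"
  define f where "f = (\<lambda>x. top_coeff U \<psi> \<kappa> w (inv_into U \<psi> x))"
  define f' where "f' = (\<lambda>x. top_coeff U' \<psi>' \<kappa>' w (inv_into U' \<psi>' x))"
  have W: "open ?W" by (intro open_Int coord_ball_open[OF fr] coord_ball_open[OF fr'])
  have WU: "?W \<subseteq> U \<inter> U'" by (auto simp: coord_ball_def)
  have S: "open ?S" by (rule chart_image_open[OF fr_chart[OF fr] W]) (use WU in auto)
  have TS: "?T ` ?S = \<psi>' ` ?W" using core_ball(2)[OF fr] by (force simp: image_image)
  have inj: "inj_on ?T ?S"
  proof (rule inj_onI)
    fix x y assume xy: "x \<in> ?S" "y \<in> ?S" "?T x = ?T y"
    then obtain p q where pq: "p \<in> ?W" "q \<in> ?W" "x = \<psi> p" "y = \<psi> q" by blast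
    then have "\<psi>' p = \<psi>' q" using xy core_ball(2)[OF fr] by auto
    have "p = inv_into U' \<psi>' (\<psi>' p)" using core_ball(2)[OF fr', of p] pq(1) by simp
    also have "\<dots> = q" unfolding \<open>\<psi>' p = \<psi>' q\<close> using core_ball(2)[OF fr', of q] pq(2) by simp
    finally have "p = q" .
    then show "x = y" using pq by simp
  qed
  have cz: "top_coeff U \<psi> \<kappa> w q = 0" "top_coeff U' \<psi>' \<kappa>' w q = 0" if "q \<notin> ?W" for q
    using z[of q] that closed_coord_ball_core[OF fr] closed_coord_ball_core[OF fr'] by (auto simp: top_coeff_def onfields_def)
  \<comment> \<open>The coefficient vanishes on the part of the ball that does not come from the
    overlap.\<close>
  have f1: "(\<lambda>x. if x \<in> ball c (2 * r) then f x else 0) = (\<lambda>x. if x \<in> ?S then f x else 0)"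
  proof (rule ext)
    fix x
    show "(if x \<in> ball c (2 * r) then f x else 0) = (if x \<in> ?S then f x else 0)"
    proof (cases "x \<in> ?S")
      case True
      then show ?thesis using core_ball(1)[OF fr] by auto
    next
      case False
      then have "x \<in> ball c (2 * r) \<Longrightarrow> inv_into U \<psi> x \<notin> ?W" using ball_core[OF fr, of x] by force
      then show ?thesis using False cz by (auto simp: f_def)
    qed
  qed
  have f2: "(\<lambda>x. if x \<in> ball c' (2 * r') then f' x else 0) = (\<lambda>x. if x \<in> \<psi>' ` ?W then f' x else 0)"
  proof (rule ext)
    fix x
    show "(if x \<in> ball c' (2 * r') then f' x else 0) = (if x \<in> \<psi>' ` ?W then f' x else 0)"
    proof (cases "x \<in> \<psi>' ` ?W")
      case True
      then show ?thesis using core_ball(1)[OF fr'] by auto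
    next
      case False
      then have "x \<in> ball c' (2 * r') \<Longrightarrow> inv_into U' \<psi>' x \<notin> ?W" using ball_core[OF fr', of x] by force
      then show ?thesis using False cz by (auto simp: f'_def)
    qed
  qed
  have "f' absolutely_integrable_on ball c' (2 * r')"
    unfolding f'_def by (rule pulled_integrable[OF fr' top_coeff_C[OF fr' w]]) (use z in \<open>auto simp: top_coeff_def onfields_def\<close>)
  then have f'i: "f' absolutely_integrable_on ?T ` ?S"
    unfolding TS by (subst absolutely_integrable_restrict_UNIV[symmetric], subst f2[symmetric])
      (simp only: absolutely_integrable_restrict_UNIV)
  have der: "(?T has_derivative D x) (at x within ?S)" if "x \<in> ?S" for x
    unfolding D_def
    by (rule has_derivative_at_withinI,
        rule smooth_on_has_derivative[OF chart_transition[OF fr_chart[OF fr] fr_chart[OF fr']]])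
      (use that WU in auto)
  have cv: "integral ?S (\<lambda>x. \<bar>det (matrix (D x))\<bar> * f' (?T x)) = integral (?T ` ?S) f'"
    by (rule change_of_variables_real[OF _ der inj f'i]) (use S in auto)
  have pw: "s * f x = s' * (\<bar>det (matrix (D x))\<bar> * f' (?T x))" if x: "x \<in> ?S" for x
  proof -
    obtain q where q: "q \<in> ?W" "x = \<psi> q" using x by auto
    then have i: "inv_into U \<psi> x = q" "inv_into U' \<psi>' (\<psi>' q) = q" using core_ball(2)[OF fr] core_ball(2)[OF fr'] by auto
    let ?d = "det (matrix (D x))"
    have 1: "f x = ?d * f' (?T x)"
      unfolding f_def f'_def i D_def using top_coeff_change[OF fr fr' w, of q] q by simp
    have 2: "top_coeff U \<psi> \<kappa> th q = ?d * top_coeff U' \<psi>' \<kappa>' th q"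
      unfolding D_def using top_coeff_change[OF fr fr' th, of q] q by simp
    have "s * (?d * top_coeff U' \<psi>' \<kappa>' th q) > 0" "s' * top_coeff U' \<psi>' \<kappa>' th q > 0"
      using s(2)[of q] s'(2)[of q] q 2 by auto
    moreover have "s = 1 \<or> s = -1" "s' = 1 \<or> s' = -1" using s(1) s'(1) by auto
    \<comment> \<open>The coefficients of th differ by the factor \<open>?d\<close> and have signs s
      and s', so \<open>?d\<close> has the sign s s'.\<close>
    ultimately have "s * ?d = s' * \<bar>?d\<bar>"
      by (elim disjE) (auto simp: zero_less_mult_iff mult_less_0_iff)
    then have "s * (?d * f' (?T x)) = s' * (\<bar>?d\<bar> * f' (?T x))" by (simp only: mult.assoc[symmetric])
    then show ?thesis unfolding 1 .
  qed
  have "s * chart_integral U \<psi> c r \<kappa> w = s * integral ?S f"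
    unfolding chart_integral_def f_def[symmetric]
    by (subst integral_restrict_UNIV[symmetric], subst f1) (simp only: integral_restrict_UNIV)
  also have "\<dots> = integral ?S (\<lambda>x. s * f x)" by simp
  also have "\<dots> = integral ?S (\<lambda>x. s' * (\<bar>det (matrix (D x))\<bar> * f' (?T x)))" by (rule integral_cong) (rule pw)
  also have "\<dots> = s' * integral (\<psi>' ` ?W) f'" unfolding TS[symmetric] cv[symmetric] by simp
  also have "integral (\<psi>' ` ?W) f' = chart_integral U' \<psi>' c' r' \<kappa>' w"
    unfolding chart_integral_def f'_def[symmetric]
    by (subst (2) integral_restrict_UNIV[symmetric], subst f2) (simp only: integral_restrict_UNIV)
  finally show ?thesis .
qed

text \<open>The image of the ball under the coefficient is an interval that omits 0.\<close>

lemma top_coeff_sgn_const: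
  assumes fr: "frame U \<psi> c r \<kappa>" and w: "w \<in> diff_forms A k"
    and nz: "\<And>q. q \<in> coord_ball U \<psi> c (2 * r) \<Longrightarrow> top_coeff U \<psi> \<kappa> w q \<noteq> 0"
  shows "\<exists>s. \<bar>s\<bar> = 1 \<and> (\<forall>q\<in>coord_ball U \<psi> c (2 * r). s * top_coeff U \<psi> \<kappa> w q > 0)"
proof -
  let ?f = "\<lambda>x. top_coeff U \<psi> \<kappa> w (inv_into U \<psi> x)" and ?B = "ball c (2 * r)"
  have "?B \<subseteq> ball c (4 * r)" by (rule subset_ball) (use fr_r[OF fr] in simp)
  then have "continuous_on ?B ?f"
    using smooth_on_continuous[OF C_smooth_ball[OF fr top_coeff_C[OF fr w]]] continuous_on_subset by blast
  then have "connected (?f ` ?B)" by (rule connected_continuous_image) simp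
  then have iv: "is_interval (?f ` ?B)" by (simp add: is_interval_connected_1)
  have nz': "0 \<notin> ?f ` ?B" using nz ball_core(1)[OF fr] by force
  have fq: "top_coeff U \<psi> \<kappa> w q \<in> ?f ` ?B" if "q \<in> coord_ball U \<psi> c (2 * r)" for q
    using core_ball[OF fr that] by (auto simp: image_iff intro!: bexI[of _ "\<psi> q"])
  have "(\<forall>y\<in>?f ` ?B. y > 0) \<or> (\<forall>y\<in>?f ` ?B. y < 0)"
  proof (rule ccontr)
    assume "\<not> ?thesis"
    then obtain y z where "y \<in> ?f ` ?B" "z \<in> ?f ` ?B" "y \<le> 0" "0 \<le> z" by (auto simp: not_less)
    then have "0 \<in> ?f ` ?B" using iv[unfolded is_interval_1] by blast
    then show False using nz' by simp
  qed
  then show ?thesis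
  proof
    assume "\<forall>y\<in>?f ` ?B. y > 0"
    from bspec[OF this fq] show ?thesis by (intro exI[of _ 1]) simp
  next
    assume "\<forall>y\<in>?f ` ?B. y < 0"
    from bspec[OF this fq] show ?thesis by (intro exI[of _ "-1"]) simp
  qed
qed

section \<open>Partition of unity and the global Stokes argument\<close>

lemma partition_of_unity:
  assumes cpt: "compact (UNIV :: 'a set)" and fr: "\<And>p. frame (U p) (\<psi> p) (\<psi> p p) (r p) (\<kappa> p)" and pU: "\<And>p. p \<in> U p"
  obtains I \<rho> where "finite I" "\<And>p. \<rho> p \<in> C" "\<And>p q. \<rho> p q \<ge> 0"
    "\<And>p q. q \<notin> closed_coord_ball (U p) (\<psi> p) (\<psi> p p) (r p) \<Longrightarrow> \<rho> p q = 0" "\<And>q. (\<Sum>p\<in>I. \<rho> p q) = 1"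
proof -
  have "\<exists>\<mu>\<in>C. (\<forall>q. 0 \<le> \<mu> q) \<and> (\<forall>q\<in>U p. dist (\<psi> p p) (\<psi> p q) \<le> r p \<longrightarrow> \<mu> q = 1) \<and>
    (\<forall>q. \<not> (q \<in> U p \<and> dist (\<psi> p p) (\<psi> p q) < 3 / 2 * r p) \<longrightarrow> \<mu> q = 0)" for p
  proof (rule cutoff_exists[OF fr_chart[OF fr]])
    show "cball (\<psi> p p) (3 / 2 * r p) \<subseteq> \<psi> p ` U p"
      by (rule order_trans[OF _ fr_sub[OF fr]], rule subset_cball) (use fr_r[OF fr[of p]] in simp)
  qed (use fr_r[OF fr[of p]] in auto)
  then obtain \<mu> where m: "\<And>p. \<mu> p \<in> C" "\<And>p q. 0 \<le> \<mu> p q"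
    "\<And>p q. q \<in> U p \<Longrightarrow> dist (\<psi> p p) (\<psi> p q) \<le> r p \<Longrightarrow> \<mu> p q = 1"
    "\<And>p q. \<not> (q \<in> U p \<and> dist (\<psi> p p) (\<psi> p q) < 3 / 2 * r p) \<Longrightarrow> \<mu> p q = 0" by metis
  let ?O = "\<lambda>p. coord_ball (U p) (\<psi> p) (\<psi> p p) (r p)"
  have "p \<in> ?O p" for p using pU fr_r[OF fr[of p]] by (simp add: coord_ball_def)
  then have cov: "UNIV \<subseteq> (\<Union>p\<in>UNIV. ?O p)" by blast
  obtain I where I: "finite I" "UNIV \<subseteq> (\<Union>p\<in>I. ?O p)"
    by (rule compactE_image[OF cpt _ cov]) (use coord_ball_open[OF fr] in auto)
  \<comment> \<open>Positive because the balls of radius r cover the manifold and each plateau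
    function is 1 on its ball; division by S makes the sum 1.\<close>
  define S where "S = (\<lambda>q. \<Sum>p\<in>I. \<mu> p q)"
  have S: "S q > 0" for q
  proof -
    obtain p where p: "p \<in> I" "q \<in> ?O p" using I(2) by blast
    then have "\<mu> p q = 1" using m(3) by (simp add: coord_ball_def)
    then show ?thesis unfolding S_def using p I(1) m(2) by (intro sum_pos2[of I p]) auto
  qed
  have SC: "(\<lambda>q. inverse (S q)) \<in> C"
  proof (rule C_inverse)
    show "S \<in> C" unfolding S_def by (rule C_sum) (rule m)
    show "S q \<noteq> 0" for q using S[of q] by simp
  qed
  show ?thesis
  proof (rule that[of I "\<lambda>p q. \<mu> p q * inverse (S q)"])
    show "(\<lambda>q. \<mu> p q * inverse (S q)) \<in> C" for p by (rule C_mult[OF m(1) SC])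
    show "0 \<le> \<mu> p q * inverse (S q)" for p q using m(2) S[of q] by simp
    show "\<mu> p q * inverse (S q) = 0" if "q \<notin> closed_coord_ball (U p) (\<psi> p) (\<psi> p p) (r p)" for p q
      using m(4)[of q p] that by (auto simp: closed_coord_ball_def)
    show "(\<Sum>p\<in>I. \<mu> p q * inverse (S q)) = 1" for q
      using S[of q] fun_cong[OF S_def, of q, symmetric] by (simp add: sum_distrib_right[symmetric])
  qed (rule I)
qed

lemma top_coeff_smul: "top_coeff U \<psi> \<kappa> (smul \<rho> w) q = \<rho> q * top_coeff U \<psi> \<kappa> w q"
  by (simp add: top_coeff_def onfields_def smul_def)

text \<open>Orienting each chart by the sign \<open>s\<close> of the volume form \<open>th = dt\<close>, Stokes in charts gives
  \<open>\<Sum>\<^sub>a \<integral>\<^sub>a \<rho>\<^sub>a th = - \<Sum>\<^sub>a \<integral>\<^sub>a d\<rho>\<^sub>a \<and> t = - \<Sum>\<^sub>b \<integral>\<^sub>b \<rho>\<^sub>b (\<Sum>\<^sub>a d\<rho>\<^sub>a) \<and> t = 0\<close>, although the left side is positive.\<close>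
theorem volume_form_not_exact:
  assumes cpt: "compact (UNIV :: 'a set)"
    and t: "t \<in> diff_forms A k" and th: "th \<in> diff_forms A (CARD('n))" and k: "CARD('n) = Suc k"
    and d: "\<And>p Xs. set Xs \<subseteq> VF \<Longrightarrow> onfields th p Xs = extd (onfields t) p Xs"
    and nz: "\<And>p. \<exists>vs. th p vs \<noteq> 0"
  shows False
proof -
  obtain U \<psi> r \<kappa> where pU: "\<And>p. p \<in> U p" and fr: "\<And>p. frame (U p) (\<psi> p) (\<psi> p p) (r p) (\<kappa> p)"
    using frame_exists by metis
  let ?Z = "\<lambda>p. closed_coord_ball (U p) (\<psi> p) (\<psi> p p) (r p)"
  let ?N = "\<lambda>p. coord_ball (U p) (\<psi> p) (\<psi> p p) (2 * r p)"
  let ?top_coeff = "\<lambda>p. top_coeff (U p) (\<psi> p) (\<kappa> p)"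
  let ?int = "\<lambda>p. chart_integral (U p) (\<psi> p) (\<psi> p p) (r p) (\<kappa> p)"
  obtain I \<rho> where I: "finite I" and rC: "\<And>p. \<rho> p \<in> C" and r0: "\<And>p q. \<rho> p q \<ge> 0"
    and rz: "\<And>p q. q \<notin> ?Z p \<Longrightarrow> \<rho> p q = 0" and r1: "\<And>q. (\<Sum>p\<in>I. \<rho> p q) = 1"
    using partition_of_unity[OF cpt fr pU] by metis
  have "\<exists>s. \<bar>s\<bar> = 1 \<and> (\<forall>q\<in>?N p. s * ?top_coeff p th q > 0)" for p
    by (rule top_coeff_sgn_const[OF fr th]) (use top_coeff_nonzero[OF fr th] nz in metis)
  then obtain s where s1: "\<And>p. \<bar>s p\<bar> = 1" and s: "\<And>p q. q \<in> ?N p \<Longrightarrow> s p * ?top_coeff p th q > 0" by metis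
  define dr where "dr = (\<lambda>a q. wedge (dfun_form (\<rho> a) q) (t q))"
  have dr: "dr a \<in> diff_forms A (CARD('n))" for a
    unfolding dr_def using diff_forms_wedge[OF dfun_form_form[OF rC] t] k by simp
  \<comment> \<open>The complement of the closed ball is open and \<open>\<rho> a\<close> vanishes
    on it, so by locality its differential does too.\<close>
  have drz: "dr a q vs = 0" if "q \<notin> ?Z a" for a q vs
  proof -
    have "v (\<rho> a) = 0" if "v \<in> TS q" for v
      by (rule T_local[OF that rC, where S = "- ?Z a"]) (use closed_coord_ball_closed[OF fr] \<open>q \<notin> ?Z a\<close> rz in auto)
    then have "dfun_form (\<rho> a) q = (\<lambda>vs. 0)"
      by (auto simp: dfun_form_def fun_eq_iff length_Suc_conv)
    then show ?thesis by (simp add: dr_def wedge_zero_left)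
  qed
  have int: "(\<lambda>x. ?top_coeff b w (inv_into (U b) (\<psi> b) x)) integrable_on ball (\<psi> b b) (2 * r b)"
    if "w \<in> diff_forms A (CARD('n))" "\<And>q vs. q \<notin> ?Z b \<Longrightarrow> w q vs = 0" for b w
    by (rule set_lebesgue_integral_eq_integral(1), rule pulled_integrable[OF fr top_coeff_C[OF fr that(1)]])
      (simp add: top_coeff_def onfields_def that(2))
  have rth: "smul (\<rho> a) th \<in> diff_forms A (CARD('n))" for a by (rule smul_form[OF rC th])
  have rthz: "smul (\<rho> a) th q vs = 0" if "q \<notin> ?Z a" for a q vs by (simp add: smul_def rz[OF that])
  have rdr: "smul (\<rho> b) (dr a) \<in> diff_forms A (CARD('n))" for a b by (rule smul_form[OF rC dr])
  have rdrz: "smul (\<rho> b) (dr a) q vs = 0" if "q \<notin> ?Z a \<inter> ?Z b" for a b q vs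
    using rz drz that by (auto simp: smul_def)
  have stokes: "?int a (smul (\<rho> a) th) = - ?int a (dr a)" for a
  proof -
    have "?int a (\<lambda>q vs. wedge (dfun_form (\<rho> a) q) (t q) vs + smul (\<rho> a) th q vs) = 0"
    proof (rule chart_integral_exact[OF fr smul_form[OF rC t], of a "a"])
      show "smul (\<rho> a) t q vs = 0" if "q \<notin> ?Z a" for q vs by (simp add: smul_def rz[OF that])
    qed (rule extd_smul[OF rC t _ d, symmetric])
    moreover have "?int a (\<lambda>q vs. wedge (dfun_form (\<rho> a) q) (t q) vs + smul (\<rho> a) th q vs) =
        ?int a (dr a) + ?int a (smul (\<rho> a) th)"
      unfolding chart_integral_def dr_def[symmetric]
      by (subst integral_add[symmetric]) (use int[OF dr drz] int[OF rth rthz] in \<open>auto simp: top_coeff_def onfields_def dr_def\<close>)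
    ultimately show ?thesis by simp
  qed
  \<comment> \<open>A factor 1, written as the sum of all \<open>\<rho> b\<close>, is inserted; each
    piece is then supported in two charts and can be moved from a to b.\<close>
  have split: "?int a (dr a) = (\<Sum>b\<in>I. ?int a (smul (\<rho> b) (dr a)))" for a
  proof -
    have "?top_coeff a (dr a) q = (\<Sum>b\<in>I. ?top_coeff a (smul (\<rho> b) (dr a)) q)" for q
      by (simp add: top_coeff_smul sum_distrib_right[symmetric] r1)
    then show ?thesis
      unfolding chart_integral_def by (subst integral_sum[symmetric]) (use I int[OF rdr] rdrz in auto)
  qed
  have swap: "s a * ?int a (smul (\<rho> b) (dr a)) = s b * ?int b (smul (\<rho> b) (dr a))" for a b
    by (rule chart_integral_change[OF fr fr rdr th rdrz s1 s s1 s])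
  have zero: "(\<Sum>a\<in>I. ?int b (smul (\<rho> b) (dr a))) = 0" for b
  proof -
    \<comment> \<open>The sum of the differentials is the differential of the constant 1.\<close>
    have "(\<Sum>a\<in>I. dfun_form (\<rho> a) q vs) = 0" for q vs
    proof (cases "length vs = 1 \<and> set vs \<subseteq> TS q")
      case True
      then have v: "vs ! 0 \<in> TS q" by (cases vs) auto
      have "(\<Sum>a\<in>I. dfun_form (\<rho> a) q vs) = (vs ! 0) (\<lambda>x. \<Sum>a\<in>I. \<rho> a x)"
        using True T_sum[OF v, of I \<rho>] rC by (simp add: dfun_form_def)
      then show ?thesis using T_const[OF v] by (simp add: r1)
    next
      case False
      show ?thesis unfolding dfun_form_def if_not_P[OF False] by simp
    qed
    then have "(\<Sum>a\<in>I. dr a q vs) = 0" for q vs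
      using wedge_sum_left[of "\<lambda>a. dfun_form (\<rho> a) q" I "t q" vs] by (simp add: dr_def wedge_zero_left)
    then have "(\<Sum>a\<in>I. ?top_coeff b (smul (\<rho> b) (dr a)) q) = 0" for q
      by (simp add: top_coeff_def onfields_def smul_def sum_distrib_left[symmetric])
    then show ?thesis
      unfolding chart_integral_def by (subst integral_sum[symmetric]) (use I int[OF rdr] rdrz in auto)
  qed
  have "(\<Sum>a\<in>I. s a * ?int a (smul (\<rho> a) th)) = - (\<Sum>a\<in>I. \<Sum>b\<in>I. s a * ?int a (smul (\<rho> b) (dr a)))"
    by (simp add: stokes split sum_negf sum_distrib_left)
  also have "\<dots> = - (\<Sum>b\<in>I. s b * (\<Sum>a\<in>I. ?int b (smul (\<rho> b) (dr a))))"
  proof -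
    have "(\<Sum>a\<in>I. \<Sum>b\<in>I. s a * ?int a (smul (\<rho> b) (dr a))) = (\<Sum>a\<in>I. \<Sum>b\<in>I. s b * ?int b (smul (\<rho> b) (dr a)))"
      by (intro sum.cong refl swap)
    also have "\<dots> = (\<Sum>b\<in>I. \<Sum>a\<in>I. s b * ?int b (smul (\<rho> b) (dr a)))" by (rule sum.swap)
    finally show ?thesis by (simp add: sum_distrib_left)
  qed
  also have "\<dots> = 0" by (simp add: zero)
  finally have z: "(\<Sum>a\<in>I. s a * ?int a (smul (\<rho> a) th)) = 0" .
  let ?G = "\<lambda>a q. s a * ?top_coeff a (smul (\<rho> a) th) q"
  have GC: "?G a \<in> C" for a by (intro C_mult C_const top_coeff_C[OF fr rth])
  have Gz: "?G a q = 0" if "q \<notin> ?Z a" for a q by (simp add: top_coeff_smul rz[OF that])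
  have G0: "?G a q \<ge> 0" for a q
  proof (cases "q \<in> ?N a")
    case True
    then have "\<rho> a q * (s a * ?top_coeff a th q) \<ge> 0" using s[OF True] r0[of a q] by simp
    then show ?thesis by (simp add: top_coeff_smul algebra_simps)
  next
    case False
    then have "q \<notin> ?Z a" using closed_coord_ball_core[OF fr] by blast
    from Gz[OF this] show ?thesis by (rule eq_refl[OF sym])
  qed
  let ?P = "\<lambda>a. pulled (U a) (\<psi> a) (\<psi> a a) (r a) (?G a)"
  have P: "s a * ?int a (smul (\<rho> a) th) = integral UNIV (?P a)" for a
    using pulled_integral[OF fr GC Gz, of a] by (simp add: chart_integral_def)
  have P0: "?P a x \<ge> 0" for a x using G0[of a] by (simp add: pulled_def[OF fr GC Gz])
  have Pc: "continuous_on UNIV (?P a)" for a by (rule smooth_on_continuous[OF pulled_smooth[OF fr GC Gz]])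
  have Pz: "dist (\<psi> a a) x > 3 / 2 * r a \<Longrightarrow> ?P a x = 0" for a x by (rule pulled_zero[OF fr GC Gz])
  have nn: "s a * ?int a (smul (\<rho> a) th) \<ge> 0" for a
    unfolding P
    by (rule integral_nonneg[OF set_lebesgue_integral_eq_integral(1)[OF compact_support_integrable[OF Pc Pz]] P0])
  \<comment> \<open>Types are inhabited, so there is a point. Some \<open>\<rho> a\<close> is
    positive there, which makes one summand strictly positive while the others are
    nonnegative.\<close>
  fix p0 :: 'a
  obtain a where a: "a \<in> I" "\<rho> a p0 \<noteq> 0" using r1[of p0] by (metis sum.neutral zero_neq_one)
  then have "p0 \<in> ?Z a" using rz by blast
  then have N: "p0 \<in> ?N a" using closed_coord_ball_core[OF fr] by blast
  have "\<rho> a p0 * (s a * ?top_coeff a th p0) > 0" using s[OF N] a(2) r0[of a p0] by simp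
  then have "?G a p0 > 0" by (simp add: top_coeff_smul algebra_simps)
  then have "?P a (\<psi> a p0) > 0" using core_ball[OF fr N] by (simp add: pulled_def[OF fr GC Gz])
  then have "s a * ?int a (smul (\<rho> a) th) > 0"
    unfolding P by (intro integral_compact_support_pos[OF Pc Pz P0])
  then have "(\<Sum>a\<in>I. s a * ?int a (smul (\<rho> a) th)) > 0"
    using I a(1) nn by (intro sum_pos2[of I a]) auto
  then show False using z by simp
qed

end

section \<open>Cohomology\<close>

context smooth_mfd
begin

lemma diff_forms_cmb:
  assumes "w \<in> diff_forms A k" "t \<in> diff_forms A k"
  shows "(\<lambda>p vs. a * w p vs + b * t p vs) \<in> diff_forms A k"
proof (rule diff_formsI)
  note W = diff_formsD[OF assms(1)] and T = diff_formsD[OF assms(2)]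
  fix p
  show "deg k (\<lambda>vs. a * w p vs + b * t p vs)" using W(1)[of p] T(1)[of p] by (simp add: deg_def)
  show "supp (TS p) (\<lambda>vs. a * w p vs + b * t p vs)" using W(2)[of p] T(2)[of p] by (simp add: supp_def)
  show "alt (\<lambda>vs. a * w p vs + b * t p vs)"
  proof (rule altI)
    fix xs y z ys
    show "a * w p (xs @ y # z # ys) + b * t p (xs @ y # z # ys) = - (a * w p (xs @ z # y # ys) + b * t p (xs @ z # y # ys))"
      unfolding altD[OF W(4), of p xs y z ys] altD[OF T(4), of p xs y z ys] by simp
  qed
  show "mlin cmbT (TS p) (\<lambda>vs. a * w p vs + b * t p vs)"
  proof (rule mlinI)
    fix xs ys u v s r
    assume h: "set xs \<subseteq> TS p" "set ys \<subseteq> TS p" "u \<in> TS p" "v \<in> TS p"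
    show "a * w p (xs @ cmbT s u r v # ys) + b * t p (xs @ cmbT s u r v # ys) =
        s * (a * w p (xs @ u # ys) + b * t p (xs @ u # ys)) + r * (a * w p (xs @ v # ys) + b * t p (xs @ v # ys))"
      unfolding mlinD[OF W(3) h, of s r] mlinD[OF T(3) h, of s r] by (simp add: algebra_simps)
  qed
next
  show "smoothf (onfields (\<lambda>p vs. a * w p vs + b * t p vs))"
    using smoothf_add[OF smoothf_scale[OF diff_formsD(5)[OF assms(1)], of a] smoothf_scale[OF diff_formsD(5)[OF assms(2)], of b]]
    by (simp add: onfields_def[abs_def])
qed

lemma zero_form_form: "zero_form \<in> diff_forms A k"
  by (rule diff_formsI) (auto simp: zero_form_def deg_def supp_def mlin_def alt_def smoothf_def onfields_def C_const)

lemma is_ext_deriv_cmb: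
  assumes "is_ext_deriv A k w w'" "is_ext_deriv A k t t'"
  shows "is_ext_deriv A k (\<lambda>p vs. a * w p vs + b * t p vs) (\<lambda>p vs. a * w' p vs + b * t' p vs)"
proof -
  note W = assms(1)[unfolded is_ext_deriv_iff] and T = assms(2)[unfolded is_ext_deriv_iff]
  have "extd (onfields (\<lambda>p vs. a * w p vs + b * t p vs)) p Xs = a * extd (onfields w) p Xs + b * extd (onfields t) p Xs"
    if "set Xs \<subseteq> VF" for p Xs
  proof -
    have "smoothf (onfields w)" "smoothf (onfields t)" using W T diff_formsD(5) by blast+
    then have "extd (\<lambda>p Xs. a * onfields w p Xs + b * onfields t p Xs) p Xs = a * extd (onfields w) p Xs + b * extd (onfields t) p Xs"
      using that by (simp add: extd_add extd_scale smoothf_scale)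
    then show ?thesis by (simp add: onfields_def[abs_def])
  qed
  then show ?thesis
    unfolding is_ext_deriv_iff using W T by (auto intro!: diff_forms_cmb) (simp add: onfields_def)
qed

lemma onfields_zero_form: "onfields zero_form = (\<lambda>p Xs. 0)"
  by (intro ext) (simp add: onfields_def zero_form_def)

lemma is_ext_deriv_zero: "is_ext_deriv A k zero_form zero_form"
proof -
  have "extd (onfields zero_form) p Xs = 0" if "set Xs \<subseteq> VF" for p Xs
    using extd_scale[OF diff_formsD(5)[OF zero_form_form] that, of 0 p] by (simp add: onfields_zero_form)
  then show ?thesis unfolding is_ext_deriv_iff by (simp add: zero_form_form onfields_zero_form)
qed

text \<open>The class of w alone is an independent family, so the supremum is at least 1.\<close>

lemma betti_pos:
  assumes c: "w \<in> closed_forms A (Suc j)" and e: "w \<notin> exact_forms A (Suc j)"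
  shows "betti A (Suc j) > 0"
proof -
  have ecmb: "(\<lambda>p vs. a * u p vs + b * v p vs) \<in> exact_forms A (Suc j)"
    if "u \<in> exact_forms A (Suc j)" "v \<in> exact_forms A (Suc j)" for a b u v
    using that is_ext_deriv_cmb by (fastforce simp: exact_forms_def)
  have ez: "zero_form \<in> exact_forms A (Suc j)" using is_ext_deriv_zero by (auto simp: exact_forms_def)
  let ?a = "coh_class A (Suc j) w"
  have "coh_independent A (Suc j) {?a}"
    unfolding coh_independent_def
  proof (intro allI impI ballI)
    fix s x assume l: "coh_lincomb A (Suc j) {?a} s = coh_class A (Suc j) zero_form" and x: "x \<in> {?a}"
    have "zero_form \<in> coh_class A (Suc j) zero_form"
      using ez is_ext_deriv_zero by (simp add: coh_class_def closed_forms_def) (simp add: zero_form_def)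
    then obtain r where r: "r ?a \<in> ?a" and z: "zero_form \<in> coh_class A (Suc j) (\<lambda>p vs. s ?a * r ?a p vs)"
      unfolding l[symmetric] coh_lincomb_def by auto
    define \<rho> where "\<rho> = r ?a"
    have 1: "(\<lambda>p vs. \<rho> p vs - w p vs) \<in> exact_forms A (Suc j)" using r by (simp add: \<rho>_def coh_class_def)
    have 2: "(\<lambda>p vs. zero_form p vs - s ?a * \<rho> p vs) \<in> exact_forms A (Suc j)" using z by (simp add: \<rho>_def coh_class_def)
    have "s ?a = 0"
    proof (rule ccontr)
      assume s: "s ?a \<noteq> 0"
      \<comment> \<open>With a nonzero coefficient both the representative and its difference from w
        are exact, which expresses w as a combination of exact forms.\<close>
      have "(\<lambda>p vs. (- 1) * (\<rho> p vs - w p vs) + (- (1 / s ?a)) * (zero_form p vs - s ?a * \<rho> p vs)) = w"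
        using s by (auto simp: zero_form_def fun_eq_iff)
      then show False using ecmb[OF 1 2, of "- 1" "- (1 / s ?a)"] e by simp
    qed
    then show "s x = 0" using x by simp
  qed
  moreover have "{?a} \<subseteq> de_rham A (Suc j)" using c by (auto simp: de_rham_def)
  ultimately have "enat (card {?a}) \<in> {enat (card S) | S. finite S \<and> S \<subseteq> de_rham A (Suc j) \<and> coh_independent A (Suc j) S}"
    by blast
  from Sup_upper[OF this] have "enat (card {?a}) \<le> betti A (Suc j)" unfolding betti_def .
  moreover have "(0::enat) < enat (card {?a})" by (simp add: zero_enat_def)
  ultimately show ?thesis by (rule order.strict_trans2[rotated])
qed

end

section \<open>Anti-quasi-Sasakian manifolds\<close>

text \<open>Both claims follow from J^3 computed in two ways. For \<xi> one has J (J \<xi>) = 0, so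
  J \<xi> = c \<xi> with c = h (J \<xi>) and c^2 = 0; for general x the comparison leaves h (J x)
  \<xi> = 0.\<close>

lemma almost_contact_vector:
  fixes J :: "'v::real_vector \<Rightarrow> 'v" and h :: "'v \<Rightarrow> real"
  assumes J: "\<And>a b x y. J (a *\<^sub>R x + b *\<^sub>R y) = a *\<^sub>R J x + b *\<^sub>R J y"
    and h: "\<And>a b x y. h (a *\<^sub>R x + b *\<^sub>R y) = a * h x + b * h y"
    and JJ: "\<And>x. J (J x) = - x + h x *\<^sub>R \<xi>" and xi: "h \<xi> = 1"
  shows "J \<xi> = 0" "h (J x) = 0"
proof -
  have Js: "J (a *\<^sub>R x) = a *\<^sub>R J x" for a x using J[of a x 0 0] by simp
  have hs: "h (a *\<^sub>R x) = a * h x" for a x using h[of a x 0 0] by simp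
  have J0: "J 0 = 0" using Js[of 0 0] by simp
  have "J (J \<xi>) = 0" by (simp add: JJ xi)
  then have "J \<xi> = h (J \<xi>) *\<^sub>R \<xi>" using JJ[of "J \<xi>"] J0 by simp
  moreover from this have "J (J \<xi>) = (h (J \<xi>) * h (J \<xi>)) *\<^sub>R \<xi>" using Js by (metis scaleR_scaleR)
  moreover have "\<xi> \<noteq> 0" using xi hs[of 0 0] by auto
  ultimately show z: "J \<xi> = 0" using \<open>J (J \<xi>) = 0\<close> by auto
  have "J (J (J x)) = J ((- 1) *\<^sub>R x + h x *\<^sub>R \<xi>)" by (simp add: JJ)
  also have "\<dots> = - J x" unfolding J by (simp add: z)
  finally have "h (J x) *\<^sub>R \<xi> = 0" using JJ[of "J x"] by simp
  then show "h (J x) = 0" using \<open>\<xi> \<noteq> 0\<close> by simp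
qed

locale aqs_mfd = smooth_mfd_cart A
  for A :: "('a::{t2_space, second_countable_topology}, real^'n::{finite,wellorder}) chart set" +
  fixes \<phi> :: "'a \<Rightarrow> 'a tvec \<Rightarrow> 'a tvec" and \<xi> :: "'a vfield" and \<eta> :: "'a \<Rightarrow> 'a tvec \<Rightarrow> real"
    and g :: "'a \<Rightarrow> 'a tvec \<Rightarrow> 'a tvec \<Rightarrow> real" and n :: nat
  assumes aqs: "anti_quasi_Sasakian A \<phi> \<xi> \<eta> g" and card: "CARD('n) = 2 * n + 1" and n1: "n \<ge> 1"
begin

lemma acm: "almost_contact_metric A \<phi> \<xi> \<eta> g"
  using aqs by (simp add: anti_quasi_Sasakian_def)

lemma phi_T: "u \<in> TS p \<Longrightarrow> \<phi> p u \<in> TS p"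
  using acm by (simp add: almost_contact_metric_def tensor11_def)

lemma phi_lin: "u \<in> TS p \<Longrightarrow> v \<in> TS p \<Longrightarrow> \<phi> p (cmbT a u b v) = cmbT a (\<phi> p u) b (\<phi> p v)"
  using acm by (simp add: almost_contact_metric_def tensor11_def cmbT_def)

lemma phi_VF: "X \<in> VF \<Longrightarrow> (\<lambda>p. \<phi> p (X p)) \<in> VF"
  using acm by (simp add: almost_contact_metric_def tensor11_def)

lemma xi_VF: "\<xi> \<in> VF"
  using acm by (simp add: almost_contact_metric_def)

lemma eta_lin: "u \<in> TS p \<Longrightarrow> v \<in> TS p \<Longrightarrow> \<eta> p (cmbT a u b v) = a * \<eta> p u + b * \<eta> p v"
  using acm by (simp add: almost_contact_metric_def one_form_def cmbT_def)

lemma eta_C: "X \<in> VF \<Longrightarrow> (\<lambda>p. \<eta> p (X p)) \<in> C"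
  using acm by (simp add: almost_contact_metric_def one_form_def)

lemma g_lin: "u \<in> TS p \<Longrightarrow> v \<in> TS p \<Longrightarrow> w \<in> TS p \<Longrightarrow> g p (cmbT a u b v) w = a * g p u w + b * g p v w"
  using acm by (simp add: almost_contact_metric_def riemannian_metric_def cmbT_def)

lemma g_sym: "u \<in> TS p \<Longrightarrow> v \<in> TS p \<Longrightarrow> g p u v = g p v u"
  using acm by (simp add: almost_contact_metric_def riemannian_metric_def)

lemma g_pos: "u \<in> TS p \<Longrightarrow> u \<noteq> (\<lambda>f. 0) \<Longrightarrow> g p u u > 0"
  using acm by (simp add: almost_contact_metric_def riemannian_metric_def)

lemma phi_phi: "v \<in> TS p \<Longrightarrow> \<phi> p (\<phi> p v) = cmbT (- 1) v (\<eta> p v) (\<xi> p)"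
  using acm by (simp add: almost_contact_metric_def cmbT_def)

lemma eta_xi: "\<eta> p (\<xi> p) = 1"
  using acm by (simp add: almost_contact_metric_def)

lemma g_phi: "X \<in> VF \<Longrightarrow> Y \<in> VF \<Longrightarrow> g p (\<phi> p (X p)) (\<phi> p (Y p)) = g p (X p) (Y p) - \<eta> p (X p) * \<eta> p (Y p)"
  using acm by (simp add: almost_contact_metric_def)

subsection \<open>The structure on a tangent space\<close>

context
  fixes p U \<psi> r \<kappa>
  assumes pU: "p \<in> U" and fr: "frame U \<psi> (\<psi> p) r \<kappa>"
begin

text \<open>\<open>emb\<close> is a linear isomorphism of the Euclidean model onto the tangent space
  at p, with inverse \<open>crds\<close>. The structure at p is moved to the model, where
  \<open>contact_vector_space\<close> applies.\<close>

definition "emb x = fld U \<psi> \<kappa> x p"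
definition "crds v = comps U \<psi> \<kappa> v"
definition "G' x y = g p (emb x) (emb y)"
definition "J' x = crds (\<phi> p (emb x))"
definition "h' x = \<eta> p (emb x)"

lemma p_core: "p \<in> coord_ball U \<psi> (\<psi> p) (2 * r)"
  using pU fr_r[OF fr] by (simp add: coord_ball_def)

lemma emb_T: "emb x \<in> TS p"
  unfolding emb_def by (rule VF_T[OF fld_VF[OF fr]])

lemma emb_crds: "v \<in> TS p \<Longrightarrow> emb (crds v) = v"
  unfolding emb_def crds_def using fld_span[OF fr p_core] by metis

lemma emb_inj: "emb x = emb y \<Longrightarrow> x = y"
  unfolding emb_def using fld_inj[OF fr p_core] by metis

lemma emb_lin: "emb (a *\<^sub>R x + b *\<^sub>R y) = cmbT a (emb x) b (emb y)"
  unfolding emb_def by (rule fld_lin[OF fr])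

lemma emb_J: "emb (J' x) = \<phi> p (emb x)"
  unfolding J'_def by (rule emb_crds[OF phi_T[OF emb_T]])

lemma emb_xi: "emb (crds (\<xi> p)) = \<xi> p"
  by (rule emb_crds[OF VF_T[OF xi_VF]])

lemma J'_JJ: "J' (J' x) = - x + h' x *\<^sub>R crds (\<xi> p)"
  by (rule emb_inj) (use emb_lin[of "- 1" x "h' x"] in \<open>simp add: emb_J phi_phi[OF emb_T] emb_xi h'_def\<close>)

lemma J'_lin: "J' (a *\<^sub>R x + b *\<^sub>R y) = a *\<^sub>R J' x + b *\<^sub>R J' y"
  by (rule emb_inj) (simp add: emb_J emb_lin phi_lin[OF emb_T emb_T])

lemma h'_lin: "h' (a *\<^sub>R x + b *\<^sub>R y) = a * h' x + b * h' y"
  by (simp add: h'_def emb_lin eta_lin[OF emb_T emb_T])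

lemma h'_xi: "h' (crds (\<xi> p)) = 1"
  by (simp add: h'_def emb_xi eta_xi)

lemma contact_vector_space: "contact_vector_space G' J' (crds (\<xi> p)) h' n"
proof
  show "DIM((real, 'n) vec) = 2 * n + 1" by (simp add: card)
  show "G' (a *\<^sub>R x + b *\<^sub>R y) z = a * G' x z + b * G' y z" for a x b y z
    by (simp add: G'_def emb_lin g_lin[OF emb_T emb_T emb_T])
  show "G' x y = G' y x" for x y unfolding G'_def by (rule g_sym[OF emb_T emb_T])
  show "G' x x > 0" if "x \<noteq> 0" for x
  proof -
    have "emb 0 = (\<lambda>f. 0)" using emb_lin[of 0 0 0 0] by (simp add: cmbT_def)
    then have "emb x \<noteq> (\<lambda>f. 0)" using emb_inj[of x 0] that by auto
    then show ?thesis unfolding G'_def by (rule g_pos[OF emb_T])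
  qed
  show "J' (crds (\<xi> p)) = 0" "h' (J' x) = 0" for x
    using almost_contact_vector[OF J'_lin h'_lin J'_JJ h'_xi] by auto
  show "G' (J' x) (J' y) = G' x y - h' x * h' y" for x y
    unfolding G'_def h'_def emb_J unfolding emb_def by (rule g_phi[OF fld_VF[OF fr] fld_VF[OF fr]])
qed (rule J'_JJ h'_xi)+

lemma eta_phi_at: "v \<in> TS p \<Longrightarrow> \<eta> p (\<phi> p v) = 0"
  using contact_vector_space.h_J[OF contact_vector_space, of "crds v"] by (simp add: h'_def emb_J emb_crds)

end

lemma eta_phi: "v \<in> TS p \<Longrightarrow> \<eta> p (\<phi> p v) = 0"
  using frame_exists[of p] eta_phi_at by metis

subsection \<open>The differential of the contact form\<close>

abbreviation "d\<eta> \<equiv> d_one_form \<eta>"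

text \<open>The terms with \<open>Y p a\<close> and \<open>Y p b\<close> that the product rule
  creates in the derivative along Y cancel those created in the bracket.\<close>

lemma deta_C_linear:
  assumes X: "X1 \<in> VF" "X2 \<in> VF" and Y: "Y \<in> VF" and ab: "a \<in> C" "b \<in> C"
  shows "d\<eta> (\<lambda>q. cmbT (a q) (X1 q) (b q) (X2 q)) Y p = a p * d\<eta> X1 Y p + b p * d\<eta> X2 Y p"
proof -
  let ?X = "\<lambda>q. cmbT (a q) (X1 q) (b q) (X2 q)"
  have XV: "?X \<in> VF" by (rule VF_cmb[OF X ab])
  note YT = VF_T[OF Y, of p] and XT = VF_T[OF X(1)] VF_T[OF X(2)]
  have e: "(\<lambda>q. \<eta> q (?X q)) = (\<lambda>q. a q * \<eta> q (X1 q) + b q * \<eta> q (X2 q))"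
    by (rule ext) (rule eta_lin[OF XT])
  have Y1: "Y p (\<lambda>q. \<eta> q (?X q)) = a p * Y p (\<lambda>q. \<eta> q (X1 q)) + \<eta> p (X1 p) * Y p a
      + (b p * Y p (\<lambda>q. \<eta> q (X2 q)) + \<eta> p (X2 p) * Y p b)"
    unfolding e using T_add[OF YT C_mult[OF ab(1) eta_C[OF X(1)]] C_mult[OF ab(2) eta_C[OF X(2)]]]
      T_mult[OF YT ab(1) eta_C[OF X(1)]] T_mult[OF YT ab(2) eta_C[OF X(2)]] by simp
  let ?L = "lie_bracket X1 Y p" and ?M = "lie_bracket X2 Y p"
  have LT: "?L \<in> TS p" "?M \<in> TS p" by (rule VF_T[OF lie_bracket_VF[OF X(1) Y]], rule VF_T[OF lie_bracket_VF[OF X(2) Y]])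
  \<comment> \<open>The Leibniz expansion of [a X1 + b X2, Y]: brackets first, derivatives of the
    coefficients second.\<close>
  let ?R = "cmbT 1 (cmbT (a p) ?L (b p) ?M) 1 (cmbT (- Y p a) (X1 p) (- Y p b) (X2 p))"
  have RT: "?R \<in> TS p" by (intro T_cmb LT XT)
  have "lie_bracket ?X Y p = ?R"
  proof (rule ext)
    fix f
    show "lie_bracket ?X Y p f = ?R f"
    proof (cases "f \<in> C")
      case True
      have "Y p (\<lambda>q. ?X q f) = a p * Y p (\<lambda>q. X1 q f) + X1 p f * Y p a + (b p * Y p (\<lambda>q. X2 q f) + X2 p f * Y p b)"
        unfolding cmbT_def using T_add[OF YT C_mult[OF ab(1) VF_C[OF X(1) True]] C_mult[OF ab(2) VF_C[OF X(2) True]]]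
          T_mult[OF YT ab(1) VF_C[OF X(1) True]] T_mult[OF YT ab(2) VF_C[OF X(2) True]] by simp
      then show ?thesis by (simp add: lie_bracket_def) (simp add: cmbT_def algebra_simps)
    next
      case False
      show ?thesis unfolding T_out[OF RT False] by (rule T_out[OF VF_T[OF lie_bracket_VF[OF XV Y]] False])
    qed
  qed
  then have "\<eta> p (lie_bracket ?X Y p) = a p * \<eta> p ?L + b p * \<eta> p ?M - Y p a * \<eta> p (X1 p) - Y p b * \<eta> p (X2 p)"
    by (simp add: eta_lin[OF T_cmb[OF LT] T_cmb[OF XT]] eta_lin[OF LT] eta_lin[OF XT])
  then show ?thesis
    unfolding d_one_form_def Y1 by (simp add: cmbT_def algebra_simps)
qed

lemma deta_skew:
  assumes "X \<in> VF" "Y \<in> VF"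
  shows "d\<eta> X Y p = - d\<eta> Y X p"
proof -
  have T: "lie_bracket Y X p \<in> TS p" by (rule VF_T[OF lie_bracket_VF[OF assms(2,1)]])
  have "lie_bracket X Y p = cmbT (- 1) (lie_bracket Y X p) 0 (lie_bracket Y X p)"
    by (auto simp: lie_bracket_def cmbT_def)
  then have "\<eta> p (lie_bracket X Y p) = - \<eta> p (lie_bracket Y X p)"
    using eta_lin[OF T T, of "- 1" 0] by simp
  then show ?thesis by (simp add: d_one_form_def)
qed

text \<open>By \<open>vanishing_field\<close> X is a combination of fields whose coefficients vanish
  at p, and \<open>deta_C_linear\<close> takes these coefficients out.\<close>

lemma deta_tensorial_zero:
  assumes X: "X \<in> VF" and Y: "Y \<in> VF" and z: "X p = (\<lambda>f. 0)"
  shows "d\<eta> X Y p = 0"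
proof -
  obtain \<mu> a Z where mm: "\<mu> \<in> C \<and> \<mu> p = 0 \<and> (\<forall>b\<in>(Basis :: (real, 'n) vec set). a b \<in> C \<and> a b p = 0 \<and> Z b \<in> VF) \<and>
      X = (\<lambda>q f. \<mu> q * X q f + (\<Sum>b\<in>Basis. a b q * Z b q f))"
    using vanishing_field[OF X z] by (elim exE) (rule that, assumption)
  note m = conjunct1[OF mm] conjunct1[OF conjunct2[OF mm]] bspec[OF conjunct1[OF conjunct2[OF conjunct2[OF mm]]]]
    conjunct2[OF conjunct2[OF conjunct2[OF mm]]]
  have s: "d\<eta> (\<lambda>q f. \<Sum>b\<in>I. a b q * Z b q f) Y p = 0" if "finite I" "I \<subseteq> Basis" for I
    using that
  proof (induction I rule: finite_induct)
    case empty
    show ?case using deta_C_linear[OF X X Y C_const[of 0] C_const[of 0], of p] by (simp add: cmbT_def)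
  next
    case (insert i I)
    have "(\<lambda>q f. \<Sum>b\<in>I. a b q * Z b q f) \<in> VF" by (rule VF_sum) (use insert m(3) in auto)
    from deta_C_linear[OF _ this Y _ C_const[of 1], of "Z i" "a i" p]
    have "d\<eta> (\<lambda>q. cmbT (a i q) (Z i q) 1 (\<lambda>f. \<Sum>b\<in>I. a b q * Z b q f)) Y p = 0"
      using insert m(3)[of i] by simp
    moreover have "(\<lambda>q. cmbT (a i q) (Z i q) 1 (\<lambda>f. \<Sum>b\<in>I. a b q * Z b q f)) = (\<lambda>q f. \<Sum>b\<in>insert i I. a b q * Z b q f)"
      using insert by (simp add: cmbT_def fun_eq_iff)
    ultimately show ?case by simp
  qed
  have SV: "(\<lambda>q f. \<Sum>b\<in>Basis. a b q * Z b q f) \<in> VF" by (rule VF_sum) (use m(3) in auto)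
  have "X = (\<lambda>q. cmbT (\<mu> q) (X q) 1 (\<lambda>f. \<Sum>b\<in>Basis. a b q * Z b q f))"
    by (subst m(4)) (simp add: cmbT_def)
  then have "d\<eta> X Y p = d\<eta> (\<lambda>q. cmbT (\<mu> q) (X q) 1 (\<lambda>f. \<Sum>b\<in>Basis. a b q * Z b q f)) Y p" by simp
  also have "\<dots> = 0" using deta_C_linear[OF X SV Y m(1) C_const[of 1], of p] m(2) s[of Basis] by simp
  finally show ?thesis .
qed

text \<open>This permits replacing a field by another one that agrees with it at p only, for
  instance an arbitrary field by a coordinate field.\<close>

lemma deta_tensorial:
  assumes "X \<in> VF" "X' \<in> VF" "Y \<in> VF" "Y' \<in> VF" "X p = X' p" "Y p = Y' p"
  shows "d\<eta> X Y p = d\<eta> X' Y' p"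
proof -
  have 1: "d\<eta> X Y p = d\<eta> X' Y p" if "X \<in> VF" "X' \<in> VF" "Y \<in> VF" "X p = X' p" for X X' Y
  proof -
    have "d\<eta> (\<lambda>q. cmbT 1 (X q) (- 1) (X' q)) Y p = 0"
      by (rule deta_tensorial_zero[OF VF_cmb[OF that(1,2) C_const C_const] that(3)]) (simp add: cmbT_def that(4))
    then show ?thesis using deta_C_linear[OF that(1-3) C_const[of 1] C_const[of "- 1"], of p] by simp
  qed
  have "d\<eta> X Y p = d\<eta> X' Y p" by (rule 1) (use assms in auto)
  also have "\<dots> = - d\<eta> Y X' p" by (rule deta_skew[OF assms(2,3)])
  also have "d\<eta> Y X' p = d\<eta> Y' X' p" by (rule 1) (use assms in auto)
  also have "- d\<eta> Y' X' p = d\<eta> X' Y' p" by (rule deta_skew[OF assms(2,4), symmetric])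
  finally show ?thesis .
qed

text \<open>Since \<open>\<eta> \<circ> \<phi> = 0\<close>, applying \<open>\<eta>\<close> to \<open>[\<phi>,\<phi>] = d\<eta> \<otimes> \<xi>\<close> gives \<open>\<eta>[\<phi>X,\<phi>Y] = d\<eta>(X,Y)\<close>.\<close>
lemma deta_phi:
  assumes X: "X \<in> VF" and Y: "Y \<in> VF"
  shows "d\<eta> (\<lambda>q. \<phi> q (X q)) (\<lambda>q. \<phi> q (Y q)) p = - d\<eta> X Y p"
proof -
  let ?pX = "\<lambda>q. \<phi> q (X q)" and ?pY = "\<lambda>q. \<phi> q (Y q)"
  note pX = phi_VF[OF X] and pY = phi_VF[OF Y]
  let ?u = "\<phi> p (\<phi> p (lie_bracket X Y p))" and ?v = "\<phi> p (lie_bracket X ?pY p)" and ?w = "\<phi> p (lie_bracket ?pX Y p)"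
  have T1: "lie_bracket X Y p \<in> TS p" "lie_bracket X ?pY p \<in> TS p" "lie_bracket ?pX Y p \<in> TS p"
    by (rule VF_T[OF lie_bracket_VF[OF X Y]], rule VF_T[OF lie_bracket_VF[OF X pY]],
        rule VF_T[OF lie_bracket_VF[OF pX Y]])
  note T = phi_T[OF phi_T[OF T1(1)]] phi_T[OF T1(2)] phi_T[OF T1(3)] VF_T[OF xi_VF, of p]
  have "N_tensor \<phi> \<xi> \<eta> X Y = (\<lambda>p f. 2 * d\<eta> X Y p * \<xi> p f)"
    using aqs X Y by (simp add: anti_quasi_Sasakian_def)
  from fun_cong[OF fun_cong[OF this, of p]]
  have N: "lie_bracket ?pX ?pY p f + ?u f - ?v f - ?w f + d\<eta> X Y p * \<xi> p f = 2 * d\<eta> X Y p * \<xi> p f" for f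
    by (simp add: N_tensor_def nijenhuis_def)
  \<comment> \<open>The tensor condition solved for [\<phi>X, \<phi>Y]: apart from d\<eta>(X,Y)
    \<xi>, every term lies in the image of \<phi> and is killed by \<eta>.\<close>
  have "lie_bracket ?pX ?pY p = cmbT 1 (cmbT (d\<eta> X Y p) (\<xi> p) (- 1) ?u) 1 (cmbT 1 ?v 1 ?w)"
  proof (rule ext)
    fix f show "lie_bracket ?pX ?pY p f = cmbT 1 (cmbT (d\<eta> X Y p) (\<xi> p) (- 1) ?u) 1 (cmbT 1 ?v 1 ?w) f"
      using N[of f] unfolding cmbT_def by algebra
  qed
  then have "\<eta> p (lie_bracket ?pX ?pY p) = d\<eta> X Y p"
    by (simp add: eta_lin T T_cmb eta_xi eta_phi T1 phi_T)
  \<comment> \<open>The two derivative terms of d\<eta>(\<phi>X, \<phi>Y) differentiate the zero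
    function, so only the bracket term with its minus sign is left.\<close>
  moreover have "(\<lambda>q. \<eta> q (\<phi> q (X q))) = (\<lambda>q. 0)" "(\<lambda>q. \<eta> q (\<phi> q (Y q))) = (\<lambda>q. 0)"
    using eta_phi VF_T[OF X] VF_T[OF Y] by auto
  ultimately show ?thesis
    using T_const[OF VF_T[OF pX]] T_const[OF VF_T[OF pY]] by (simp add: d_one_form_def)
qed

subsection \<open>The forms\<close>

abbreviation "\<Phi> \<equiv> fundamental_form A \<phi> g"

definition H :: "'a form" where
  "H = (\<lambda>p vs. if length vs = 1 \<and> set vs \<subseteq> TS p then \<eta> p (vs ! 0) else 0)"

definition \<Psi> :: "'a form" where
  "\<Psi> = (\<lambda>p. wedge (H p) (wpow (\<Phi> p) (n - 1)))"

lemma Phi_closed: "is_ext_deriv A 2 \<Phi> zero_form"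
  using aqs by (simp add: anti_quasi_Sasakian_def)

lemma Phi_form: "\<Phi> \<in> diff_forms A 2"
  using Phi_closed by (simp add: is_ext_deriv_def)

lemma extd_Phi: "set Xs \<subseteq> VF \<Longrightarrow> extd (onfields \<Phi>) p Xs = 0"
  using Phi_closed unfolding is_ext_deriv_iff onfields_zero_form by simp

lemma H_form: "H \<in> diff_forms A 1"
proof (rule diff_formsI)
  show "alt (H p)" for p by (rule altI) (simp add: H_def)
  show "mlin cmbT (TS p) (H p)" for p
  proof (rule mlinI)
    fix xs ys u v a b
    assume "set xs \<subseteq> TS p" "set ys \<subseteq> TS p" "u \<in> TS p" "v \<in> TS p"
    then show "H p (xs @ cmbT a u b v # ys) = a * H p (xs @ u # ys) + b * H p (xs @ v # ys)"
      by (cases xs) (auto simp: H_def T_cmb eta_lin)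
  qed
  show "smoothf (onfields H)"
    unfolding smoothf_def
  proof (intro allI impI)
    fix Xs assume Xs: "set Xs \<subseteq> VF"
    show "(\<lambda>p. onfields H p Xs) \<in> C"
    proof (cases "length Xs = 1")
      case True
      then obtain X where X: "Xs = [X]" by (cases Xs) auto
      then have "X \<in> VF" using Xs by simp
      then have "(\<lambda>p. onfields H p Xs) = (\<lambda>p. \<eta> p (X p))"
        using VF_T[of X] by (auto simp: X onfields_def H_def)
      then show ?thesis using eta_C[OF \<open>X \<in> VF\<close>] by simp
    qed (auto simp: onfields_def H_def C_const)
  qed
qed (auto simp: deg_def supp_def H_def)

lemma wpow_form: "(\<lambda>p. wpow (\<Phi> p) k) \<in> diff_forms A (2 * k)"
proof (induction k)
  case 0
  then show ?case using diff_forms_one by simp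
next
  case (Suc k)
  show ?case using diff_forms_wedge[OF Suc Phi_form] by simp
qed

lemma Psi_form: "\<Psi> \<in> diff_forms A (2 * n - 1)"
proof -
  have "1 + 2 * (n - 1) = 2 * n - 1" using n1 by simp
  then show ?thesis unfolding \<Psi>_def using diff_forms_wedge[OF H_form wpow_form[of "n - 1"]] by simp
qed

lemma wedge_zero_on_left: "(\<And>Ys. set Ys \<subseteq> set Xs \<Longrightarrow> w Ys = 0) \<Longrightarrow> wedge w t Xs = 0"
  using wedge_cong[of Xs w "\<lambda>_. 0" t t] by (simp add: wedge_zero_left)

lemma wedge_zero_on_right: "(\<And>Ys. set Ys \<subseteq> set Xs \<Longrightarrow> t Ys = 0) \<Longrightarrow> wedge w t Xs = 0"
  using wedge_cong[of Xs w w t "\<lambda>_. 0"] by (simp add: wedge_zero_right)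

lemma extd_wedge_forms:
  assumes "w \<in> diff_forms A j" "t \<in> diff_forms A k" "set Xs \<subseteq> VF"
  shows "extd (onfields (\<lambda>p. wedge (w p) (t p))) p Xs
    = wedge (extd (onfields w) p) (onfields t p) Xs + wedge (sgnf (onfields w p)) (extd (onfields t) p) Xs"
  unfolding onfields_wedge by (rule extd_wedge[OF diff_formsD(5)[OF assms(1)] diff_formsD(5)[OF assms(2)] assms(3)])

lemma extd_wpow: "set Xs \<subseteq> VF \<Longrightarrow> extd (onfields (\<lambda>p. wpow (\<Phi> p) k)) p Xs = 0"
proof (induction k arbitrary: Xs)
  case 0
  have "onfields (\<lambda>p. one_form0) = (\<lambda>p. one_form0)" by (auto simp: onfields_def one_form0_def fun_eq_iff)
  then show ?case using extd_one[OF 0] by simp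
next
  case (Suc k)
  show ?case
    unfolding wpow.simps extd_wedge_forms[OF wpow_form Phi_form Suc.prems]
    by (subst wedge_zero_on_left, rule Suc.IH) (use Suc.prems in \<open>auto intro!: wedge_zero_on_right extd_Phi\<close>)
qed

lemma extd_H:
  assumes "set Xs \<subseteq> VF"
  shows "extd (onfields H) p Xs = (if length Xs = 2 then d\<eta> (Xs ! 0) (Xs ! 1) p else 0)"
proof (cases "length Xs = 2")
  case True
  then obtain X Y where XY: "Xs = [X, Y]" by (cases Xs; cases "tl Xs") auto
  then have V: "X \<in> VF" "Y \<in> VF" using assms by auto
  have 1: "onfields H q [Z] = \<eta> q (Z q)" if "Z \<in> VF" for q Z
    using VF_T[OF that] by (simp add: onfields_def H_def)
  have "extd (onfields H) p [X, Y] = X p (\<lambda>q. onfields H q [Y]) - onfields H p [lie_bracket X Y] - Y p (\<lambda>q. onfields H q [X])"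
    by (simp add: ins_def)
  then show ?thesis unfolding 1[OF V(1)] 1[OF V(2)] 1[OF lie_bracket_VF[OF V]] using XY by (simp add: d_one_form_def)
next
  case False
  then have "extd (onfields H) p Xs = 0"
    by (intro extd_deg[where k = 1]) (use assms in \<open>auto simp: deg_def onfields_def H_def\<close>)
  then show ?thesis using False by simp
qed

context
  fixes p U \<psi> r \<kappa>
  assumes pU: "p \<in> U" and fr: "frame U \<psi> (\<psi> p) r \<kappa>"
begin

private abbreviation "E \<equiv> emb p U \<psi> \<kappa>"
private abbreviation "B \<equiv> contact_vector_space.B (G' p U \<psi> \<kappa>) (J' p U \<psi> \<kappa>)"

lemma Phi_emb: "\<Phi> p (map E vs) = bil_form B vs"
proof -
  note cv = contact_vector_space[OF pU fr]
  have "set (map E vs) \<subseteq> TS p" using emb_T[OF pU fr] by auto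
  then show ?thesis
    by (auto simp: fundamental_form_def bil_form_def contact_vector_space.B_def[OF cv] G'_def[OF pU fr] emb_J[OF pU fr])
qed

lemma H_emb: "H p (map E vs) = lin_form (h' p U \<psi> \<kappa>) vs"
proof -
  have "set (map E vs) \<subseteq> TS p" using emb_T[OF pU fr] by auto
  then show ?thesis by (auto simp: H_def lin_form_def h'_def[OF pU fr])
qed

lemma wpow_emb: "wpow (\<Phi> p) k (map E vs) = wpow (bil_form B) k vs"
  using wpow_map[of "\<Phi> p" E k vs] by (simp add: Phi_emb)

lemma Psi_emb: "\<Psi> p (map E vs) = wedge (lin_form (h' p U \<psi> \<kappa>)) (wpow (bil_form B) (n - 1)) vs"
  using wedge_map[of "H p" E "wpow (\<Phi> p) (n - 1)" vs] by (simp add: \<Psi>_def H_emb wpow_emb)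

lemma volume_nonzero_at: "\<exists>vs. wedge (\<Psi> p) (\<Phi> p) vs \<noteq> 0"
proof -
  obtain xs where "wedge (wedge (lin_form (h' p U \<psi> \<kappa>)) (wpow (bil_form B) (n - 1))) (bil_form B) xs \<noteq> 0"
    using contact_vector_space.volume_nonzero[OF contact_vector_space[OF pU fr] n1] by blast
  then have "wedge (\<Psi> p) (\<Phi> p) (map E xs) \<noteq> 0"
    using wedge_map[of "\<Psi> p" E "\<Phi> p" xs] by (simp add: Psi_emb Phi_emb)
  then show ?thesis by blast
qed

text \<open>The form is d\<eta> wedge \<Phi>^(n-1), evaluated on fields at p; it is transported to
  the model, where \<open>anti_invariant_wedge_zero\<close> applies.\<close>

lemma extd_Psi_at:
  assumes Xs: "set Xs \<subseteq> VF" "length Xs = 2 * n"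
  shows "wedge (extd (onfields H) p) (onfields (\<lambda>p. wpow (\<Phi> p) (n - 1)) p) Xs = 0"
proof -
  note cv = contact_vector_space[OF pU fr]
  let ?c = "\<lambda>X. crds U \<psi> \<kappa> (X p)"
  \<comment> \<open>d\<eta> at p, computed on coordinate fields; by tensoriality the choice of
    extending fields is immaterial.\<close>
  define a where "a = (\<lambda>x y. d\<eta> (fld U \<psi> \<kappa> x) (fld U \<psi> \<kappa> y) p)"
  have fV: "fld U \<psi> \<kappa> x \<in> VF" for x by (rule fld_VF[OF fr])
  have Ec: "E (?c X) = X p" if "X \<in> VF" for X using emb_crds[OF pU fr VF_T[OF that]] .
  have fc: "fld U \<psi> \<kappa> (?c X) p = X p" if "X \<in> VF" for X using Ec[OF that] by (simp add: emb_def[OF pU fr])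
  have a1: "a (s *\<^sub>R x + t *\<^sub>R y) z = s * a x z + t * a y z" for s x t y z
  proof -
    have "fld U \<psi> \<kappa> (s *\<^sub>R x + t *\<^sub>R y) = (\<lambda>q. cmbT s (fld U \<psi> \<kappa> x q) t (fld U \<psi> \<kappa> y q))"
      using fld_lin[OF fr] by auto
    then show ?thesis unfolding a_def using deta_C_linear[OF fV fV fV C_const[of s] C_const[of t]] by simp
  qed
  have a2: "a x y = - a y x" for x y unfolding a_def by (rule deta_skew[OF fV fV])
  \<comment> \<open>The coordinate field of J' x and the field \<phi> applied to the coordinate
    field of x agree only at p, which is where tensoriality is used.\<close>
  have aJ: "a (J' p U \<psi> \<kappa> x) (J' p U \<psi> \<kappa> y) = - a x y" for x y
  proof -
    have "a (J' p U \<psi> \<kappa> x) (J' p U \<psi> \<kappa> y) = d\<eta> (\<lambda>q. \<phi> q (fld U \<psi> \<kappa> x q)) (\<lambda>q. \<phi> q (fld U \<psi> \<kappa> y q)) p"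
      unfolding a_def
      by (rule deta_tensorial[OF fV phi_VF[OF fV] fV phi_VF[OF fV]])
        (use emb_J[OF pU fr] in \<open>simp_all add: emb_def[OF pU fr]\<close>)
    also have "\<dots> = - a x y" unfolding a_def by (rule deta_phi[OF fV fV])
    finally show ?thesis .
  qed
  have "wedge (extd (onfields H) p) (onfields (\<lambda>p. wpow (\<Phi> p) (n - 1)) p) Xs =
      wedge (\<lambda>Ys. bil_form a (map ?c Ys)) (\<lambda>Ys. wpow (bil_form B) (n - 1) (map ?c Ys)) Xs"
  proof (rule wedge_cong)
    fix Ys assume "set Ys \<subseteq> set Xs"
    then have Y: "set Ys \<subseteq> VF" using Xs by auto
    show "extd (onfields H) p Ys = bil_form a (map ?c Ys)"
    proof (cases "length Ys = 2")
      case True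
      then have V: "Ys ! 0 \<in> VF" "Ys ! 1 \<in> VF" using Y nth_mem[of 0 Ys] nth_mem[of 1 Ys] by auto
      have "d\<eta> (Ys ! 0) (Ys ! 1) p = a (?c (Ys ! 0)) (?c (Ys ! 1))"
        unfolding a_def by (rule deta_tensorial[OF V(1) fV V(2) fV fc[OF V(1), symmetric] fc[OF V(2), symmetric]])
      then show ?thesis using True extd_H[OF Y] by (simp add: bil_form_def)
    qed (simp add: extd_H[OF Y] bil_form_def)
    have "map (\<lambda>X. X p) Ys = map E (map ?c Ys)" using Y Ec by (auto simp: subset_iff)
    then show "onfields (\<lambda>p. wpow (\<Phi> p) (n - 1)) p Ys = wpow (bil_form B) (n - 1) (map ?c Ys)"
      unfolding onfields_def by (simp only: wpow_emb)
  qed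
  also have "\<dots> = wedge (bil_form a) (wpow (bil_form B) (n - 1)) (map ?c Xs)" by (rule wedge_map)
  also have "\<dots> = 0"
    by (rule contact_vector_space.anti_invariant_wedge_zero[where a = a, OF cv a1 a2 aJ n1]) (simp add: Xs)
  finally show ?thesis .
qed

end

lemma volume_nonzero: "\<exists>vs. wedge (\<Psi> p) (\<Phi> p) vs \<noteq> 0"
  using frame_exists[of p] volume_nonzero_at by metis

lemma extd_Psi:
  assumes "set Xs \<subseteq> VF"
  shows "extd (onfields \<Psi>) p Xs = 0"
proof (cases "length Xs = 2 * n")
  case True
  have "wedge (extd (onfields H) p) (onfields (\<lambda>p. wpow (\<Phi> p) (n - 1)) p) Xs = 0"
    using frame_exists[of p] extd_Psi_at[OF _ _ assms True] by metis
  then show ?thesis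
    unfolding \<Psi>_def extd_wedge_forms[OF H_form wpow_form assms]
    using assms by (simp add: wedge_zero_on_right extd_wpow)
next
  case False
  show ?thesis
    by (rule extd_deg[where k = "2 * n - 1", OF _ assms])
      (use diff_formsD(1)[OF Psi_form] False n1 in \<open>auto simp: deg_def onfields_def\<close>)
qed

lemma volume_form: "(\<lambda>p. wedge (\<Psi> p) (\<Phi> p)) \<in> diff_forms A (CARD('n))"
proof -
  have "2 * n - 1 + 2 = 2 * n + 1" using n1 by simp
  then show ?thesis using diff_forms_wedge[OF Psi_form Phi_form] by (simp add: card)
qed

lemma Phi_not_exact:
  assumes "compact (UNIV :: 'a set)"
  shows "\<not> is_ext_deriv A 1 b \<Phi>"
proof
  assume "is_ext_deriv A 1 b \<Phi>"
  then have b: "b \<in> diff_forms A 1" and d: "\<And>p Xs. set Xs \<subseteq> VF \<Longrightarrow> onfields \<Phi> p Xs = extd (onfields b) p Xs"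
    unfolding is_ext_deriv_iff by auto
  let ?V = "\<lambda>p. wedge (\<Psi> p) (\<Phi> p)"
  \<comment> \<open>The degree 2n - 1 is odd; this is the origin of the minus sign in d(\<Psi> wedge
    b).\<close>
  have s: "sgnf (onfields \<Psi> p) = (\<lambda>Ys. - onfields \<Psi> p Ys)" for p
  proof (rule ext)
    fix Ys
    show "sgnf (onfields \<Psi> p) Ys = - onfields \<Psi> p Ys"
    proof (cases "length Ys = 2 * n - 1")
      case True
      then have "odd (length Ys)" using n1 by simp
      then show ?thesis by (simp add: sgnf_def)
    next
      case False
      then show ?thesis using diff_formsD(1)[OF Psi_form, of p] by (simp add: sgnf_def deg_def onfields_def)
    qed
  qed
  show False
  \<comment> \<open>The last instance is the negative of the volume form, spelled as a linear
    combination to match \<open>diff_forms_cmb\<close>.\<close>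
  proof (rule volume_form_not_exact[OF assms, of "\<lambda>p. wedge (\<Psi> p) (b p)" "2 * n" "\<lambda>p vs. (- 1) * ?V p vs + 0 * ?V p vs"])
    show "(\<lambda>p. wedge (\<Psi> p) (b p)) \<in> diff_forms A (2 * n)"
      using diff_forms_wedge[OF Psi_form b] n1 by simp
    show "(\<lambda>p vs. (- 1) * ?V p vs + 0 * ?V p vs) \<in> diff_forms A (CARD('n))"
      by (rule diff_forms_cmb[OF volume_form volume_form])
    show "\<exists>vs. (- 1) * ?V p vs + 0 * ?V p vs \<noteq> 0" for p using volume_nonzero[of p] by simp
    fix p Xs assume Xs: "set Xs \<subseteq> VF"
    have "wedge (sgnf (onfields \<Psi> p)) (extd (onfields b) p) Xs = wedge (\<lambda>Ys. - onfields \<Psi> p Ys) (onfields \<Phi> p) Xs"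
      by (rule wedge_cong) (use s d Xs in auto)
    also have "\<dots> = - onfields ?V p Xs" by (simp add: wedge_minus_left onfields_wedge)
    finally have "extd (onfields (\<lambda>p. wedge (\<Psi> p) (b p))) p Xs = - onfields ?V p Xs"
      unfolding extd_wedge_forms[OF Psi_form b Xs] using Xs by (simp add: wedge_zero_on_left extd_Psi)
    then show "onfields (\<lambda>p vs. (- 1) * ?V p vs + 0 * ?V p vs) p Xs = extd (onfields (\<lambda>p. wedge (\<Psi> p) (b p))) p Xs"
      by (simp add: onfields_def)
  qed (simp add: card)
qed

text \<open>For n = 1 the degree 2n - 2 is 0: then b is a function and \<Psi> is the contact form
  itself.\<close>

lemma Psi_not_exact:
  assumes "compact (UNIV :: 'a set)"
  shows "\<not> is_ext_deriv A (2 * n - 2) b \<Psi>"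
proof
  assume "is_ext_deriv A (2 * n - 2) b \<Psi>"
  then have b: "b \<in> diff_forms A (2 * n - 2)" and d: "\<And>p Xs. set Xs \<subseteq> VF \<Longrightarrow> onfields \<Psi> p Xs = extd (onfields b) p Xs"
    unfolding is_ext_deriv_iff by auto
  show False
  proof (rule volume_form_not_exact[OF assms, of "\<lambda>p. wedge (b p) (\<Phi> p)" "2 * n" "\<lambda>p. wedge (\<Psi> p) (\<Phi> p)"])
    have "2 * n - 2 + 2 = 2 * n" using n1 by simp
    then show "(\<lambda>p. wedge (b p) (\<Phi> p)) \<in> diff_forms A (2 * n)"
      using diff_forms_wedge[OF b Phi_form] by metis
    fix p Xs assume Xs: "set Xs \<subseteq> VF"
    have "wedge (extd (onfields b) p) (onfields \<Phi> p) Xs = wedge (onfields \<Psi> p) (onfields \<Phi> p) Xs"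
      by (rule wedge_cong) (use d Xs in auto)
    then show "onfields (\<lambda>p. wedge (\<Psi> p) (\<Phi> p)) p Xs = extd (onfields (\<lambda>p. wedge (b p) (\<Phi> p))) p Xs"
      unfolding extd_wedge_forms[OF b Phi_form Xs]
      using Xs by (simp add: onfields_wedge[of \<Psi>] wedge_zero_on_right extd_Phi)
  qed (use volume_form volume_nonzero card in auto)
qed

theorem betti_numbers_pos:
  assumes "compact (UNIV :: 'a set)"
  shows "betti A 2 > 0" "betti A (2 * n - 1) > 0"
proof -
  have "betti A (Suc 1) > 0"
  proof (rule betti_pos)
    show "\<Phi> \<in> closed_forms A (Suc 1)" using Phi_closed by (simp add: closed_forms_def numeral_2_eq_2)
    show "\<Phi> \<notin> exact_forms A (Suc 1)" using Phi_not_exact[OF assms] by (simp add: exact_forms_def)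
  qed
  then show "betti A 2 > 0" by (simp add: numeral_2_eq_2)
  have s: "2 * n - 1 = Suc (2 * n - 2)" using n1 by simp
  have "is_ext_deriv A (2 * n - 1) \<Psi> zero_form"
    unfolding is_ext_deriv_iff onfields_zero_form
    by (intro conjI allI impI Psi_form zero_form_form extd_Psi[symmetric])
  then have "\<Psi> \<in> closed_forms A (Suc (2 * n - 2))" using s by (simp add: closed_forms_def)
  then show "betti A (2 * n - 1) > 0"
    unfolding s by (rule betti_pos) (use Psi_not_exact[OF assms] in \<open>simp add: exact_forms_def\<close>)
qed

end

section \<open>Reduction to Cartesian models\<close>

text \<open>The change of variables theorem is available for \<open>real^'n\<close> with a well-ordered index type only,
  so the model space is replaced by \<open>real^'n\<close> with one index for each basis vector.\<close>

typedef (overloaded) 'e basis_index = "Basis :: 'e::euclidean_space set"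
  using nonempty_Basis by blast

instance basis_index :: (euclidean_space) finite
proof
  show "finite (UNIV :: 'a basis_index set)"
    using type_definition.univ[OF type_definition_basis_index] by (metis finite_Basis finite_imageI)
qed

text \<open>The order is pulled back from the naturals along an enumeration of \<open>Basis\<close>,
  and well-foundedness comes with it.\<close>

instantiation basis_index :: (euclidean_space) wellorder
begin

definition "x \<le> y \<longleftrightarrow> to_nat_on Basis (Rep_basis_index x) \<le> to_nat_on Basis (Rep_basis_index y)"

definition "x < y \<longleftrightarrow> to_nat_on Basis (Rep_basis_index x) < to_nat_on Basis (Rep_basis_index y)"

instance
proof
  fix x y :: "'a basis_index"
  assume "x \<le> y" "y \<le> x"
  then have "to_nat_on Basis (Rep_basis_index x) = to_nat_on Basis (Rep_basis_index y)"
    by (simp add: less_eq_basis_index_def)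
  then have "Rep_basis_index x = Rep_basis_index y"
    using Rep_basis_index[of x] Rep_basis_index[of y] by (simp add: countable_finite to_nat_on_inj)
  then show "x = y" by (simp add: Rep_basis_index_inject)
next
  fix P :: "'a basis_index \<Rightarrow> bool" and x
  assume h: "\<And>x. (\<And>y. y < x \<Longrightarrow> P y) \<Longrightarrow> P x"
  show "P x"
    by (induction "to_nat_on Basis (Rep_basis_index x)" arbitrary: x rule: less_induct)
      (rule h, simp add: less_basis_index_def)
qed (auto simp: less_eq_basis_index_def less_basis_index_def)

end

lemma CARD_basis_index: "CARD('e::euclidean_space basis_index) = DIM('e)"
  by (rule type_definition.card[OF type_definition_basis_index])

definition to_cart :: "'e::euclidean_space \<Rightarrow> real^'e basis_index" where
  "to_cart x = (\<chi> i. x \<bullet> Rep_basis_index i)"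

definition of_cart :: "real^'e basis_index \<Rightarrow> 'e::euclidean_space" where
  "of_cart y = (\<Sum>i\<in>UNIV. (y $ i) *\<^sub>R Rep_basis_index i)"

lemma bounded_linear_cart: "bounded_linear to_cart" "bounded_linear of_cart"
proof -
  have "linear to_cart" by (rule linearI) (simp_all add: to_cart_def vec_eq_iff inner_add_left)
  then show "bounded_linear to_cart" by (rule linear_conv_bounded_linear[THEN iffD1])
  have "linear of_cart"
    by (rule linearI) (simp_all add: of_cart_def scaleR_add_left sum.distrib scaleR_sum_right)
  then show "bounded_linear of_cart" by (rule linear_conv_bounded_linear[THEN iffD1])
qed

lemma of_to_cart: "of_cart (to_cart x) = x"
proof -
  have "bij_betw Rep_basis_index UNIV (Basis :: 'a set)"
    using type_definition.Rep_range[OF type_definition_basis_index] Rep_basis_index_inject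
    by (auto simp: bij_betw_def inj_on_def)
  then have "(\<Sum>i\<in>UNIV. (x \<bullet> Rep_basis_index i) *\<^sub>R Rep_basis_index i) = (\<Sum>b\<in>Basis. (x \<bullet> b) *\<^sub>R b)"
    by (rule sum.reindex_bij_betw)
  then show ?thesis by (simp add: of_cart_def to_cart_def euclidean_representation)
qed

lemma to_of_cart: "to_cart (of_cart y) = y"
proof -
  have o: "(Rep_basis_index i :: 'a) \<bullet> Rep_basis_index j = (if i = j then 1 else 0)" for i j :: "'a basis_index"
    using Rep_basis_index[of i] Rep_basis_index[of j] by (simp add: inner_Basis Rep_basis_index_inject)
  show ?thesis
    by (simp add: to_cart_def of_cart_def vec_eq_iff inner_sum_left o if_distrib sum.delta cong: if_cong)
qed

lemma open_to_cart: "open S \<Longrightarrow> open (to_cart ` S)"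
proof -
  assume "open S"
  moreover have "to_cart ` S = of_cart -` S"
    by (auto simp: of_to_cart) (metis to_of_cart image_eqI)
  ultimately show ?thesis using open_vimage linear_continuous_on[OF bounded_linear_cart(2)] by metis
qed

text \<open>The same charts followed by a linear isomorphism of the model spaces, which does not
  affect smoothness.\<close>

definition cart_atlas :: "('a, 'e::euclidean_space) chart set \<Rightarrow> ('a, real^'e basis_index) chart set" where
  "cart_atlas A = (\<lambda>(U, \<psi>). (U, to_cart \<circ> \<psi>)) ` A"

lemma inv_into_cart:
  fixes \<psi> :: "'a \<Rightarrow> 'e::euclidean_space"
  assumes "x \<in> \<psi> ` U"
  shows "inv_into U (to_cart \<circ> \<psi>) (to_cart x) = inv_into U \<psi> x"
proof -
  have "to_cart y = to_cart z \<longleftrightarrow> y = z" for y z :: 'e using of_to_cart by metis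
  then show ?thesis by (simp add: inv_into_def)
qed

lemma smooth_on_to_cart:
  assumes "open S"
  shows "smooth_on (to_cart ` S) (\<lambda>y. f (of_cart y)) \<longleftrightarrow> smooth_on S f"
proof
  assume "smooth_on S f"
  then show "smooth_on (to_cart ` S) (\<lambda>y. f (of_cart y))"
    by (rule smooth_on_compose[OF open_to_cart[OF assms] assms, rotated -1])
      (auto simp: of_to_cart smooth_on_bounded_linear bounded_linear_cart)
next
  assume "smooth_on (to_cart ` S) (\<lambda>y. f (of_cart y))"
  from smooth_on_compose[OF assms open_to_cart[OF assms] _ _ this, of to_cart]
  show "smooth_on S f" by (simp add: of_to_cart smooth_on_bounded_linear bounded_linear_cart)
qed

lemma smooth_on_cart_chart:
  assumes "open S" "S \<subseteq> \<psi> ` U"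
  shows "smooth_on (to_cart ` S) (\<lambda>y. f (inv_into U (to_cart \<circ> \<psi>) y)) \<longleftrightarrow> smooth_on S (\<lambda>x. f (inv_into U \<psi> x))"
proof -
  have "smooth_on (to_cart ` S) (\<lambda>y. f (inv_into U (to_cart \<circ> \<psi>) y))
      \<longleftrightarrow> smooth_on (to_cart ` S) (\<lambda>y. f (inv_into U \<psi> (of_cart y)))"
  proof (rule smooth_on_cong[OF open_to_cart[OF assms(1)]])
    fix y assume "y \<in> to_cart ` S"
    then obtain x where x: "x \<in> S" "y = to_cart x" by blast
    then have "x \<in> \<psi> ` U" using assms(2) by blast
    from inv_into_cart[OF this] show "f (inv_into U (to_cart \<circ> \<psi>) y) = f (inv_into U \<psi> (of_cart y))"
      unfolding x(2) of_to_cart by simp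
  qed
  then show ?thesis using smooth_on_to_cart[OF assms(1), of "\<lambda>x. f (inv_into U \<psi> x)"] by simp
qed

context smooth_mfd
begin

text \<open>This equality of function algebras is the hypothesis from which
  \<open>atlas_transfer\<close> moves the structure and the Betti numbers between the two
  atlases.\<close>

lemma smooth_funs_cart: "smooth_funs (cart_atlas A) = smooth_funs A"
proof -
  have "smooth_on (to_cart ` \<psi> ` U) (\<lambda>y. f (inv_into U (to_cart \<circ> \<psi>) y)) \<longleftrightarrow> smooth_on (\<psi> ` U) (\<lambda>x. f (inv_into U \<psi> x))"
    if "(U, \<psi>) \<in> A" for U \<psi> and f :: "'a \<Rightarrow> real"
    by (rule smooth_on_cart_chart[OF chart_open(2)[OF that] subset_refl])
  then show ?thesis
    unfolding smooth_funs_def cart_atlas_def by (fastforce simp: o_def image_image)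
qed

lemma smooth_manifold_cart: "smooth_manifold (cart_atlas A)"
proof -
  have "is_chart (U, to_cart \<circ> \<psi>)" if c: "(U, \<psi>) \<in> A" for U \<psi>
  proof -
    let ?g = "inv_into U (to_cart \<circ> \<psi>)"
    note h = chart_homeo[OF c]
    have im: "(to_cart \<circ> \<psi>) ` U = to_cart ` \<psi> ` U" by auto
    have gi: "?g (to_cart (\<psi> q)) = q" if "q \<in> U" for q
      using that inv_into_cart[of "\<psi> q" \<psi> U] h(4) by simp
    have "continuous_on (to_cart ` \<psi> ` U) (\<lambda>y. inv_into U \<psi> (of_cart y))"
      by (rule continuous_on_compose2[OF h(3)])
        (auto simp: of_to_cart intro: linear_continuous_on bounded_linear_cart)
    then have c2: "continuous_on ((to_cart \<circ> \<psi>) ` U) ?g"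
      unfolding im by (rule continuous_on_eq) (auto simp: of_to_cart gi h(4))
    have c1: "continuous_on U (to_cart \<circ> \<psi>)"
      by (rule continuous_on_compose[OF h(2)]) (rule linear_continuous_on[OF bounded_linear_cart(1)])
    have "homeomorphism U ((to_cart \<circ> \<psi>) ` U) (to_cart \<circ> \<psi>) ?g"
      by (rule homeomorphismI[OF c1 c2]) (auto simp: gi)
    moreover have "open ((to_cart \<circ> \<psi>) ` U)" unfolding im by (rule open_to_cart[OF chart_open(2)[OF c]])
    ultimately show ?thesis using chart_open(1)[OF c] by (simp add: is_chart_def)
  qed
  moreover have "smooth_on ((to_cart \<circ> \<psi>) ` (U \<inter> V)) ((to_cart \<circ> \<theta>) \<circ> inv_into U (to_cart \<circ> \<psi>))"
    if c: "(U, \<psi>) \<in> A" "(V, \<theta>) \<in> A" for U \<psi> V \<theta>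
  proof -
    have S: "open (\<psi> ` (U \<inter> V))"
      by (rule chart_image_open[OF c(1)]) (use chart_open(1)[OF c(1)] chart_open(1)[OF c(2)] in auto)
    have "smooth_on (\<psi> ` (U \<inter> V)) (\<lambda>x. to_cart (\<theta> (inv_into U \<psi> x)))"
      by (rule smooth_on_linear_comp[OF bounded_linear_cart(1) S chart_transition[OF c]])
    then have "smooth_on (to_cart ` \<psi> ` (U \<inter> V)) (\<lambda>y. to_cart (\<theta> (inv_into U (to_cart \<circ> \<psi>) y)))"
      using smooth_on_cart_chart[OF S, of \<psi> U "\<lambda>q. to_cart (\<theta> q)"] by auto
    then show ?thesis by (simp add: o_def image_image)
  qed
  moreover have "(\<Union>(U, \<psi>)\<in>cart_atlas A. U) = UNIV"
    using mfd by (auto simp: smooth_manifold_def cart_atlas_def)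
  ultimately show ?thesis unfolding smooth_manifold_def cart_atlas_def by fast
qed

end

text \<open>All notions of the theory depend on the atlas only through the algebra of smooth functions.\<close>
lemma atlas_transfer:
  fixes A :: "('a, 'e::euclidean_space) chart set" and A' :: "('a, 'f::euclidean_space) chart set"
  assumes C: "smooth_funs A' = smooth_funs A"
  shows "betti A' = betti A" "anti_quasi_Sasakian A' = anti_quasi_Sasakian A"
proof -
  have T: "tangent_space A' = tangent_space A" by (simp add: fun_eq_iff tangent_space_def C)
  have V: "vector_fields A' = vector_fields A" by (simp add: vector_fields_def C T)
  have F: "diff_forms A' = diff_forms A" by (simp add: fun_eq_iff diff_forms_def C T V)
  have D: "is_ext_deriv A' = is_ext_deriv A" by (simp add: fun_eq_iff is_ext_deriv_def F V)
  have cl: "closed_forms A' = closed_forms A" by (simp add: fun_eq_iff closed_forms_def D)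
  have ex: "exact_forms A' = exact_forms A" by (simp add: fun_eq_iff exact_forms_def D split: nat.split)
  have cc: "coh_class A' = coh_class A" by (simp add: fun_eq_iff coh_class_def cl ex)
  have li: "coh_lincomb A' = coh_lincomb A" by (simp add: fun_eq_iff coh_lincomb_def cc)
  show "betti A' = betti A"
    by (simp add: fun_eq_iff betti_def de_rham_def coh_independent_def cc cl li)
  have f: "fundamental_form A' = fundamental_form A" by (simp add: fun_eq_iff fundamental_form_def T)
  have "one_form A' = one_form A" "tensor11 A' = tensor11 A" "riemannian_metric A' = riemannian_metric A"
    by (simp_all add: fun_eq_iff one_form_def tensor11_def riemannian_metric_def C T V)
  then have "almost_contact_metric A' = almost_contact_metric A"
    by (simp add: fun_eq_iff almost_contact_metric_def T V)
  then show "anti_quasi_Sasakian A' = anti_quasi_Sasakian A"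
    by (simp add: fun_eq_iff anti_quasi_Sasakian_def D V f)
qed

theorem proposition3p5:
  fixes A :: "('a::{t2_space, second_countable_topology}, 'e::euclidean_space) chart set"
    and \<phi> :: "'a \<Rightarrow> 'a tvec \<Rightarrow> 'a tvec"
    and \<xi> :: "'a vfield"
    and \<eta> :: "'a \<Rightarrow> 'a tvec \<Rightarrow> real"
    and g :: "'a \<Rightarrow> 'a tvec \<Rightarrow> 'a tvec \<Rightarrow> real"
    and n :: nat
  assumes "smooth_manifold A"
    and "DIM('e) = 2 * n + 1"
    and "n \<ge> 1"
    and "compact (UNIV :: 'a set)"
    and "anti_quasi_Sasakian A \<phi> \<xi> \<eta> g"
  shows "betti A 2 > 0 \<and> betti A (2 * n - 1) > 0"
proof -
  interpret A: smooth_mfd A by standard (rule assms(1))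
  note transfer = atlas_transfer[OF A.smooth_funs_cart]
  interpret aqs_mfd "cart_atlas A" \<phi> \<xi> \<eta> g n
  proof
    show "smooth_manifold (cart_atlas A)" by (rule A.smooth_manifold_cart)
    show "anti_quasi_Sasakian (cart_atlas A) \<phi> \<xi> \<eta> g" unfolding transfer by (rule assms(5))
    show "CARD('e basis_index) = 2 * n + 1" by (simp add: CARD_basis_index assms(2))
    show "n \<ge> 1" by (rule assms(3))
  qed
  show ?thesis using betti_numbers_pos[OF assms(4)] by (simp add: transfer)
qed

end
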